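(* Let $H$ be a graph and let $r$ be an integer with $r\ge 4v(H)^3+11v(H)^2$. Then $H$ is $K_{r+1}$-Turán-good and $K_{r+1}$-Turán-stable.
   Context: $v(H)$ is the number of vertices of $H$. $\mathcal N(H,G)$ is the number of (not necessarily induced) subgraphs of $G$ isomorphic to $H$. A graph is $K_{r+1}$-free if it does not contain the complete graph $K_{r+1}$ on $r+1$ vertices as a subgraph. $\mathrm{ex}(n,H,K_{r+1})$ is the maximum of $\mathcal N(H,G)$ over all $n$-vertex $K_{r+1}$-free graphs $G$. $T_r(n)$ is the Turán graph: the complete $r$-partite graph on $n$ vertices whose part sizes are $\lfloor n/r\rfloor$ or $\lceil n/r\rceil$. $H$ is $K_{r+1}$-Turán-good if, for all sufficiently large $n$, the graph $T_r(n)$ contains the maximum number of copies of $H$ among all $n$-vertex $K_{r+1}$-free graphs, that is, $\mathrm{ex}(n,H,K_{r+1})=\mathcal N(H,T_r(n))$. The edit distance $\mathrm{dist}_{\mathrm{edit}}(G,G')$ of two $n$-vertex graphs is the minimum number of edge additions and deletions needed to make them isomorphic. $H$ is $K_{r+1}$-Turán-stable if for every $\varepsilon>0$ there exist $\delta>0$ and $n_0$ such that, whenever $n\ge n_0$ and $G$ is an $n$-vertex $K_{r+1}$-free graph with $\mathcal N(H,G)\ge \mathrm{ex}(n,H,K_{r+1})-\delta n^{v(H)}$, one has $\mathrm{dist}_{\mathrm{edit}}(G,T_r(n))\le \varepsilon n^2$.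
   Formalization: H is assumed to have at least one vertex, and stability is claimed only when H has at least one edge: for edgeless H all n-vertex graphs contain equally many copies, so the empty graph is extremal but far from T_r(n) and stability fails. *)

theory Defs
  imports Complex_Main
begin

record 'a ugraph =
  verts :: "'a set"
  edges :: "'a set set"

definition sgraph :: "'a ugraph \<Rightarrow> bool" where
  "sgraph G \<longleftrightarrow> finite (verts G) \<and> (\<forall>e\<in>edges G. e \<subseteq> verts G \<and> card e = 2)"

definition subgraph :: "'a ugraph \<Rightarrow> 'a ugraph \<Rightarrow> bool" where
  "subgraph F G \<longleftrightarrow> sgraph F \<and> verts F \<subseteq> verts G \<and> edges F \<subseteq> edges G"

definition isomorphic :: "'a ugraph \<Rightarrow> 'b ugraph \<Rightarrow> bool" where
  "isomorphic F G \<longleftrightarrow>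
     (\<exists>f. bij_betw f (verts F) (verts G) \<and> edges G = (\<lambda>e. f ` e) ` edges F)"

(* Subgraphs are counted as pairs (vertex set, edge set), so isolated vertices of H matter. *)
definition copies :: "'a ugraph \<Rightarrow> 'b ugraph \<Rightarrow> nat" where
  "copies H G = card {F. subgraph F G \<and> isomorphic H F}"

definition free_of :: "'a ugraph \<Rightarrow> 'b ugraph \<Rightarrow> bool" where
  "free_of F G \<longleftrightarrow> \<not> (\<exists>F'. subgraph F' G \<and> isomorphic F F')"

definition complete_graph :: "nat \<Rightarrow> nat ugraph" where
  "complete_graph k = \<lparr>verts = {..<k}, edges = {e. e \<subseteq> {..<k} \<and> card e = 2}\<rparr>"

(* The classes of {..<n} modulo r have sizes floor (n/r) and ceiling (n/r)
   (see turan_part_size below). *)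
definition turan_graph :: "nat \<Rightarrow> nat \<Rightarrow> nat ugraph" where
  "turan_graph r n =
     \<lparr>verts = {..<n}, edges = {{u, v} |u v. u < n \<and> v < n \<and> u mod r \<noteq> v mod r}\<rparr>"

(* Every finite graph has an isomorphic copy with natural-number vertices, so it suffices
   to let n-vertex graphs range over nat ugraph; the set of values is finite although the
   set of graphs is not. *)
definition host_graphs :: "nat \<Rightarrow> 'b ugraph \<Rightarrow> nat ugraph set" where
  "host_graphs n F = {G. sgraph G \<and> card (verts G) = n \<and> free_of F G}"

definition ex :: "nat \<Rightarrow> 'a ugraph \<Rightarrow> 'b ugraph \<Rightarrow> nat" where
  "ex n H F = Max (copies H ` host_graphs n F)"

(* Meaningful for graphs with equally many vertices. Passing from G to a graph F on the
   same vertex set takes as many edge additions and deletions as there are edges in the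
   symmetric difference. *)
definition edit_dist :: "'a ugraph \<Rightarrow> 'b ugraph \<Rightarrow> nat" where
  "edit_dist G G' =
     (LEAST k. \<exists>F. sgraph F \<and> verts F = verts G \<and> isomorphic F G' \<and>
        k = card ((edges G - edges F) \<union> (edges F - edges G)))"

definition turan_good :: "nat \<Rightarrow> 'a ugraph \<Rightarrow> bool" where
  "turan_good r H \<longleftrightarrow>
     (\<exists>n0. \<forall>n\<ge>n0. ex n H (complete_graph (r + 1)) = copies H (turan_graph r n))"

definition turan_stable :: "nat \<Rightarrow> 'a ugraph \<Rightarrow> bool" where
  "turan_stable r H \<longleftrightarrow>
     (\<forall>\<epsilon>::real. \<epsilon> > 0 \<longrightarrow> (\<exists>\<delta>::real. \<delta> > 0 \<and> (\<exists>n0. \<forall>n\<ge>n0.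
        \<forall>G\<in>host_graphs n (complete_graph (r + 1)).
          real (copies H G) \<ge> real (ex n H (complete_graph (r + 1)))
                                - \<delta> * real n ^ card (verts H) \<longrightarrow>
          real (edit_dist G (turan_graph r n)) \<le> \<epsilon> * real n ^ 2)))"

lemma turan_part_size:
  fixes r n i :: nat
  assumes "i < r"
  shows "int (card {x. x < n \<and> x mod r = i}) \<in>
           {\<lfloor>real n / real r\<rfloor>, \<lceil>real n / real r\<rceil>}"
proof -
  let ?q = "n div r" and ?s = "n mod r"
  have r: "r > 0" using assms by simp
  have n: "n = ?q * r + ?s" by simp
  have s: "?s < r" using r by simp
  have "{x. x < n \<and> x mod r = i} =
          (\<lambda>k. k * r + i) ` {..<(if i < ?s then ?q + 1 else ?q)}" (is "?A = ?f ` ?B")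
  proof (intro set_eqI iffI)
    fix x assume x: "x \<in> ?A"
    define k where "k = x div r"
    have xk: "x = k * r + i" using x by (auto simp: k_def)
    have "k \<le> ?q" using x by (auto simp: k_def div_le_mono)
    moreover have "i < ?s" if "k = ?q" proof -
      have "?q * r + i < ?q * r + ?s" unfolding n[symmetric] using x xk that by simp
      then show ?thesis by (simp only: add_less_cancel_left)
    qed
    ultimately have "k \<in> ?B" by (cases "k = ?q") auto
    then show "x \<in> ?f ` ?B" using xk by blast
  next
    fix x assume "x \<in> ?f ` ?B"
    then obtain k where k: "x = k * r + i" "k \<in> ?B" by auto
    have "x < n"
    proof (cases "k < ?q")
      case True
      then have "(k + 1) * r \<le> ?q * r" by (intro mult_right_mono) auto
      then have "k * r + r \<le> ?q * r" by (simp add: algebra_simps)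
      then show ?thesis using k(1) assms n by linarith
    next
      case False
      then have "k = ?q" "i < ?s" using k(2) by (auto split: if_splits)
      then have "x = ?q * r + i" using k(1) by simp
      then show ?thesis using \<open>i < ?s\<close> n by linarith
    qed
    then show "x \<in> ?A" using k(1) assms by simp
  qed
  moreover have "inj_on ?f ?B" using r by (auto simp: inj_on_def)
  ultimately have c: "card ?A = (if i < ?s then ?q + 1 else ?q)"
    by (simp add: card_image)
  have fl: "\<lfloor>real n / real r\<rfloor> = int ?q" by (simp add: floor_divide_of_nat_eq)
  show ?thesis
  proof (cases "i < ?s")
    case True
    have "\<lceil>real n / real r\<rceil> = int ?q + 1"
    proof (rule ceiling_unique)
      have "real n = real ?q * real r + real ?s" using n by (metis of_nat_add of_nat_mult)
      moreover have "real ?s < real r" "0 < real ?s" using s True by auto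
      ultimately show "of_int (int ?q + 1) - 1 < real n / real r"
        and "real n / real r \<le> of_int (int ?q + 1)"
        using r by (auto simp: field_simps)
    qed
    then show ?thesis using c True by simp
  next
    case False
    then show ?thesis using c fl by simp
  qed
qed

end

theory Submission
  imports Defs "HOL-Library.FuncSet"
begin

text \<open>
  Copies of \<open>H\<close> are counted through injective homomorphisms. Fueredi's proof of the stability
  theorem colours a \<open>K\<^bsub>r+1\<^esub>\<close>-free graph \<open>G\<close> with \<open>r\<close> colours so that, if \<open>B\<close> is the complete
  multipartite graph of the colouring, at least twice as many edges of \<open>B\<close> are missing in \<open>G\<close> as \<open>G\<close>
  has edges inside colour classes. If every vertex of \<open>G\<close> has at most \<open>(h + 1) n / r\<close> non-neighbours,
  where \<open>h = v(H)\<close>, the copies lost through a missing edge of \<open>B\<close> are almost disjoint for different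
  missing edges, so each costs nearly as many copies as an edge inside a class can create; the factor
  two then makes \<open>B\<close> better than \<open>G\<close>. Moving single vertices from larger to smaller classes of \<open>B\<close>
  increases the count until the Turan graph is reached. A vertex with more non-neighbours lies in
  so few copies that deleting it improves the comparison with the Turan graph by a constant. Hence
  for large \<open>n\<close> the number of copies, plus a multiple of \<open>n\<^bsup>h-2\<^esup>\<close> times the number of edges that \<open>G\<close>
  lacks compared to the Turan graph, is at most the number of copies in the Turan graph. This yields
  goodness, and together with the colouring above also stability.
\<close>

section \<open>Injective homomorphisms\<close>

text \<open>Two opposing demands on the threshold for non-neighbours determine how large
  \<open>r\<close> must be. With \<open>m\<close> pattern edges, a vertex of the Turan graph lies in
  about \<open>h * (1 - m / r)\<close> times \<open>n ^ (h - 1)\<close> embeddings. A vertex with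
  \<open>gap * n\<close> non-neighbours lies in at most \<open>h - m * gap\<close> times
  \<open>n ^ (h - 1)\<close>, since the estimate uses only the pattern edges at this vertex. So the
  threshold must exceed \<open>h / r\<close>, and \<open>(h + 1) / r\<close> leaves a margin
  \<open>m / r\<close>. On the other hand, the factor two of the colouring helps only if fixing the
  image of one pattern edge leaves more than half of all placements. Every other edge excludes twice
  the threshold, for non-neighbours and for the own class, so the loss is about
  \<open>2 * m * (h + 1) / r\<close>. As \<open>2 * m \<le> h * (h - 1)\<close>, this is at most 1/4
  once \<open>r \<ge> 4 * h ^ 3\<close>.

  Deletions may run down to a bounded number of vertices, where the excess over the Turan graph is
  at most a constant. Each deletion raises it by a fixed amount, so a large host cannot start with
  positive excess.\<close>

text \<open>
  The pattern is a set \<open>S\<close> with an orientation \<open>P\<close> of its edges: each edge occurs in \<open>P\<close> once.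
  Edges of the host graph are counted as ordered pairs, that is, twice.
\<close>

definition embs :: "'a set \<Rightarrow> ('a \<times> 'a) set \<Rightarrow> 'b set \<Rightarrow> ('b \<Rightarrow> 'b \<Rightarrow> bool) \<Rightarrow> ('a \<Rightarrow> 'b) set" where
  "embs S P V A = {f \<in> S \<rightarrow>\<^sub>E V. inj_on f S \<and> (\<forall>(k, l)\<in>P. A (f k) (f l))}"

definition arcs :: "'b set \<Rightarrow> ('b \<Rightarrow> 'b \<Rightarrow> bool) \<Rightarrow> ('b \<times> 'b) set" where
  "arcs V A = {(x, y). x \<in> V \<and> y \<in> V \<and> A x y}"

text \<open>\<open>D\<close> holds the pairs to be avoided. Pattern edges inside \<open>R\<close>
  are exempt, since the prescribed values are often exactly a forbidden pair: a missing edge, or the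
  moved vertex and a member of its old class.\<close>

definition extensions ::
  "'a set \<Rightarrow> ('a \<times> 'a) set \<Rightarrow> 'b set \<Rightarrow> ('b \<Rightarrow> 'b \<Rightarrow> bool) \<Rightarrow> 'a set \<Rightarrow> ('a \<Rightarrow> 'b) \<Rightarrow> ('a \<Rightarrow> 'b) set" where
  "extensions S P V D R g = {f \<in> S \<rightarrow>\<^sub>E V. inj_on f S \<and> (\<forall>k\<in>R. f k = g k) \<and>
     (\<forall>(k, l)\<in>P. k \<notin> R \<or> l \<notin> R \<longrightarrow> \<not> D (f k) (f l))}"

lemma finite_embs [simp]: "finite S \<Longrightarrow> finite V \<Longrightarrow> finite (embs S P V A)"
  unfolding embs_def by (rule finite_subset[of _ "S \<rightarrow>\<^sub>E V"]) (auto simp: finite_PiE)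

lemma finite_extensions [simp]:
  "finite S \<Longrightarrow> finite V \<Longrightarrow> finite (extensions S P V D R g)"
  unfolding extensions_def by (rule finite_subset[of _ "S \<rightarrow>\<^sub>E V"]) (auto simp: finite_PiE)

lemma finite_arcs [simp]: "finite V \<Longrightarrow> finite (arcs V A)"
  unfolding arcs_def by (rule finite_subset[of _ "V \<times> V"]) auto

text \<open>One greedy step: the image of \<open>t\<close> has to avoid the images already used and
  the \<open>D\<close>-neighbours of the images of those \<open>l\<close> that a pattern edge joins
  to \<open>t\<close>.\<close>

lemma extensions_step:
  fixes d :: real and S :: "'a set" and V :: "'b set"
  assumes fin: "finite V" "finite S" and t: "t \<notin> S" "R \<subseteq> S"
    and sym: "\<And>x y. D x y \<longleftrightarrow> D y x"
    and deg: "\<And>x. x \<in> V \<Longrightarrow> real (card {y\<in>V. D x y}) \<le> d"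
    and P: "P \<subseteq> insert t S \<times> insert t S" "\<And>k. (k, k) \<notin> P"
    and Nb: "Nb = {l\<in>S. (t, l) \<in> P \<or> (l, t) \<in> P}"
  shows "real (card (extensions S (P \<inter> S \<times> S) V D R g)) * (real (card V) - real (card S) - real (card Nb) * d)
    \<le> real (card (extensions (insert t S) P V D R g))"
proof -
  let ?E = "extensions S (P \<inter> S \<times> S) V D R g"
  define valid where "valid f = V - f ` S - (\<Union>l\<in>Nb. {y\<in>V. D (f l) y})" for f :: "'a \<Rightarrow> 'b"
  have finNb: "finite Nb" unfolding Nb using fin by simp
  have fV: "f l \<in> V" if "f \<in> ?E" "l \<in> S" for f l
    using that unfolding extensions_def by blast
  have valid: "real (card V) - real (card S) - real (card Nb) * d \<le> real (card (valid f))"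
    if f: "f \<in> ?E" for f
  proof -
    have "real (card (\<Union>l\<in>Nb. {y\<in>V. D (f l) y})) \<le> (\<Sum>l\<in>Nb. real (card {y\<in>V. D (f l) y}))"
      using of_nat_mono[OF card_UN_le[OF finNb, of "\<lambda>l. {y\<in>V. D (f l) y}"], where 'a = real]
      by simp
    also have "\<dots> \<le> (\<Sum>l\<in>Nb. d)"
      using deg fV[OF f] Nb by (intro sum_mono) auto
    finally have a: "real (card (\<Union>l\<in>Nb. {y\<in>V. D (f l) y})) \<le> real (card Nb) * d" by simp
    have b: "card (f ` S) \<le> card S" using fin card_image_le by blast
    have "card V \<le> card (valid f \<union> (f ` S \<union> (\<Union>l\<in>Nb. {y\<in>V. D (f l) y})))"
      using fin finNb by (intro card_mono) (auto simp: valid_def)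
    also have "\<dots> \<le> card (valid f) + card (f ` S \<union> (\<Union>l\<in>Nb. {y\<in>V. D (f l) y}))"
      by (rule card_Un_le)
    also have "\<dots> \<le> card (valid f) + (card (f ` S) + card (\<Union>l\<in>Nb. {y\<in>V. D (f l) y}))"
      by (intro add_left_mono card_Un_le)
    finally have "card V \<le> card (valid f) + (card (f ` S) + card (\<Union>l\<in>Nb. {y\<in>V. D (f l) y}))" .
    then show ?thesis using a b by linarith
  qed
  have finE: "finite ?E" using fin by simp
  have finvalid: "finite (valid f)" for f using fin by (auto simp: valid_def)
  have "real (card ?E) * (real (card V) - real (card S) - real (card Nb) * d)
      = (\<Sum>f\<in>?E. real (card V) - real (card S) - real (card Nb) * d)" by simp
  also have "\<dots> \<le> (\<Sum>f\<in>?E. real (card (valid f)))" by (intro sum_mono valid)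
  also have "\<dots> = real (card (Sigma ?E valid))"
    using finE finvalid by simp
  also have "card (Sigma ?E valid) \<le> card (extensions (insert t S) P V D R g)"
  proof (rule card_inj_on_le[where f = "\<lambda>(f, y). f(t := y)"])
    \<comment> \<open>\<open>f\<close> can be read off from \<open>f(t := y)\<close>, because
      extensional maps on \<open>S\<close> take the value \<open>undefined\<close> at
      \<open>t\<close>.\<close>
    show "inj_on (\<lambda>(f, y). f(t := y)) (Sigma ?E valid)"
    proof (rule inj_onI, clarify)
      fix f y f' y' assume f: "f \<in> ?E" "f' \<in> ?E" and eq: "f(t := y) = f'(t := y')"
      have ext: "f \<in> S \<rightarrow>\<^sub>E V" "f' \<in> S \<rightarrow>\<^sub>E V" using f by (auto simp: extensions_def)
      have "f x = f' x" for x
        using fun_cong[OF eq, of x] ext t(1) by (cases "x = t") (auto simp: PiE_def extensional_def)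
      moreover have "y = y'" using fun_cong[OF eq, of t] by simp
      ultimately show "f = f' \<and> y = y'" by auto
    qed
    show "(\<lambda>(f, y). f(t := y)) ` Sigma ?E valid \<subseteq> extensions (insert t S) P V D R g"
    proof clarify
      fix f y assume f: "f \<in> ?E" and y: "y \<in> valid f"
      have ext: "f \<in> S \<rightarrow>\<^sub>E V" and inj: "inj_on f S" and fR: "\<forall>k\<in>R. f k = g k"
        and fP: "\<And>k l. (k, l) \<in> P \<Longrightarrow> k \<in> S \<Longrightarrow> l \<in> S \<Longrightarrow> k \<notin> R \<or> l \<notin> R \<Longrightarrow> \<not> D (f k) (f l)"
        using f by (auto simp: extensions_def)
      have yV: "y \<in> V" "y \<notin> f ` S" and yD: "\<And>l. l \<in> Nb \<Longrightarrow> \<not> D (f l) y"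
        using y by (auto simp: valid_def)
      have "f(t := y) \<in> insert t S \<rightarrow>\<^sub>E V" using ext yV by (auto simp: PiE_def extensional_def)
      moreover have "inj_on (f(t := y)) (insert t S)"
        using inj yV t by (auto simp: inj_on_def)
      moreover have "\<forall>k\<in>R. (f(t := y)) k = g k" using fR t by auto
      moreover have "\<not> D ((f(t := y)) k) ((f(t := y)) l)"
        if kl: "(k, l) \<in> P" "k \<notin> R \<or> l \<notin> R" for k l
      proof -
        have "k \<noteq> l" using P kl by auto
        moreover have "k \<in> insert t S" "l \<in> insert t S" using P kl by auto
        ultimately consider "k = t" "l \<in> S" | "l = t" "k \<in> S" | "k \<in> S" "l \<in> S" "k \<noteq> t" "l \<noteq> t"
          using t by auto
        then show ?thesis
        proof cases
          case 1
          then have "\<not> D (f l) y" using kl Nb by (intro yD) auto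
          then show ?thesis using 1 t sym by auto
        next
          case 2
          then have "\<not> D (f k) y" using kl Nb by (intro yD) auto
          then show ?thesis using 2 t by auto
        next
          case 3
          then show ?thesis using fP[OF kl(1)] kl(2) by auto
        qed
      qed
      ultimately show "f(t := y) \<in> extensions (insert t S) P V D R g"
        unfolding extensions_def mem_Collect_eq by blast
    qed
    show "finite (extensions (insert t S) P V D R g)" using fin by simp
  qed
  finally show ?thesis by simp
qed

text \<open>The factors \<open>n * (1 - b)\<close> of the greedy steps are linearised through
  \<open>(1 - a) * (1 - b) \<ge> 1 - (a + b)\<close>. Each pattern edge is charged at most once,
  when its later end is placed, which gives \<open>card P * d\<close>; the used images add up to at
  most the square of the number of pattern vertices.\<close>

lemma extensions_lower_bound:
  fixes d :: real
  assumes fin: "finite V" "V \<noteq> {}" "finite R" and g: "g \<in> R \<rightarrow> V" "inj_on g R"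
    and sym: "\<And>x y. D x y \<longleftrightarrow> D y x"
    and deg: "\<And>x. x \<in> V \<Longrightarrow> real (card {y\<in>V. D x y}) \<le> d"
    and T: "finite T" "R \<inter> T = {}"
    and P: "P \<subseteq> (R \<union> T) \<times> (R \<union> T)" "\<And>k. (k, k) \<notin> P"
  shows "real (card V) ^ card T * (1 - (real (card P) * d + real (card (R \<union> T)) ^ 2) / real (card V))
    \<le> real (card (extensions (R \<union> T) P V D R g))"
  using T P
proof (induction T arbitrary: P rule: finite_induct)
  case empty
  have d: "0 \<le> d" using fin deg by (metis all_not_in_conv of_nat_0_le_iff order_trans)
  have "restrict g R \<in> extensions (R \<union> {}) P V D R g"
    using g empty by (auto simp: extensions_def inj_on_def)
  then have "1 \<le> card (extensions (R \<union> {}) P V D R g)"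
    using fin by (metis Suc_leI card_gt_0_iff empty_iff finite.emptyI finite_UnI finite_extensions One_nat_def)
  moreover have "0 \<le> (real (card P) * d + real (card (R \<union> {})) ^ 2) / real (card V)"
    using d by auto
  ultimately show ?case by simp
next
  case (insert t T)
  define S where "S = R \<union> T"
  define P' where "P' = P \<inter> S \<times> S"
  define Nb where "Nb = {l\<in>S. (t, l) \<in> P \<or> (l, t) \<in> P}"
  define n where "n = real (card V)"
  have n: "n > 0" using fin by (simp add: n_def card_gt_0_iff)
  have d: "0 \<le> d" using fin deg by (metis all_not_in_conv of_nat_0_le_iff order_trans)
  have S: "finite S" "t \<notin> S" "R \<subseteq> S" using insert fin by (auto simp: S_def)
  have PS: "P \<subseteq> insert t S \<times> insert t S" using insert by (auto simp: S_def)
  have finP: "finite P" by (rule finite_subset[OF PS]) (use S in auto)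
  \<comment> \<open>The edges of \<open>P\<close> at \<open>t\<close> are those missing from
    \<open>P'\<close>, so their charges do not overlap with those of the induction
    hypothesis.\<close>
  have "card Nb \<le> card (P - P')"
  proof (rule card_inj_on_le[where f = "\<lambda>l. if (t, l) \<in> P then (t, l) else (l, t)"])
    show "inj_on (\<lambda>l. if (t, l) \<in> P then (t, l) else (l, t)) Nb"
      using S by (auto simp: inj_on_def Nb_def split: if_splits)
    show "(\<lambda>l. if (t, l) \<in> P then (t, l) else (l, t)) ` Nb \<subseteq> P - P'"
      using S by (auto simp: Nb_def P'_def)
  qed (use finP in auto)
  moreover have "card (P - P') = card P - card P'"
    by (rule card_Diff_subset) (use finP in \<open>auto simp: P'_def\<close>)
  moreover have "card P' \<le> card P" by (rule card_mono) (use finP in \<open>auto simp: P'_def\<close>)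
  ultimately have cP: "card P' + card Nb \<le> card P" by linarith
  define s where "s = real (card S)"
  define a where "a = (real (card P') * d + s ^ 2) / n"
  define b where "b = (s + real (card Nb) * d) / n"
  have ab: "0 \<le> a" "0 \<le> b" using n d by (auto simp: a_def b_def s_def)
  have IH: "n ^ card T * (1 - a) \<le> real (card (extensions S P' V D R g))"
    using insert.IH[of P'] insert.prems unfolding P'_def S_def n_def a_def s_def by auto
  have step: "real (card (extensions S P' V D R g)) * (n - s - real (card Nb) * d)
      \<le> real (card (extensions (insert t S) P V D R g))"
    unfolding P'_def n_def s_def using insert.prems
    by (intro extensions_step[OF fin(1) S sym deg PS _ Nb_def]) auto
  have nb: "n - s - real (card Nb) * d = n * (1 - b)" using n by (simp add: b_def field_simps)
  have cS: "real (card (R \<union> insert t T)) = s + 1" "R \<union> insert t T = insert t S"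
    using S by (auto simp: S_def s_def)
  have le: "a + b \<le> (real (card P) * d + (s + 1) ^ 2) / n"
  proof -
    have "real (card P') * d + real (card Nb) * d \<le> real (card P) * d"
      using cP d by (metis distrib_right mult_right_mono of_nat_add of_nat_mono)
    then have "real (card P') * d + s ^ 2 + (s + real (card Nb) * d) \<le> real (card P) * d + (s + 1) ^ 2"
      by (simp add: power2_eq_square algebra_simps s_def)
    then show ?thesis unfolding a_def b_def using n by (simp add: divide_right_mono flip: add_divide_distrib)
  qed
  have "n ^ card (insert t T) * (1 - (real (card P) * d + (s + 1) ^ 2) / n)
      \<le> n ^ card (insert t T) * (1 - (a + b))"
    using le n by (intro mult_left_mono) auto
  also have "\<dots> \<le> real (card (extensions (insert t S) P V D R g))"
  \<comment> \<open>For \<open>b > 1\<close> the step factor is negative and the induction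
    hypothesis cannot be multiplied by it, but then the claimed bound is at most 0.\<close>
  proof (cases "b \<le> 1")
    case True
    have "n ^ card (insert t T) * (1 - (a + b)) \<le> n ^ card (insert t T) * ((1 - a) * (1 - b))"
      using n ab by (intro mult_left_mono) (auto simp: algebra_simps)
    also have "\<dots> = (n ^ card T * (1 - a)) * (n * (1 - b))" using insert by simp
    also have "\<dots> \<le> real (card (extensions S P' V D R g)) * (n * (1 - b))"
      using IH n True by (intro mult_right_mono) auto
    finally show ?thesis using step nb by simp
  next
    case False
    then have "n ^ card (insert t T) * (1 - (a + b)) \<le> 0"
      using ab n by (intro mult_nonneg_nonpos) auto
    then show ?thesis by (smt (verit) of_nat_0_le_iff)
  qed
  finally show ?case unfolding n_def cS(1) unfolding cS(2) .
qed

section \<open>Colourings and complete multipartite graphs\<close>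

text \<open>
  The first class consists of the non-neighbours of a vertex of maximum degree, and the induction
  continues in its neighbourhood.
\<close>

lemma fueredi_colouring:
  fixes d :: real and A :: "'b \<Rightarrow> 'b \<Rightarrow> bool"
  assumes "finite V" and sym: "\<And>x y. A x y \<longleftrightarrow> A y x" and irr: "\<And>x. \<not> A x x"
    and "\<And>K. K \<subseteq> V \<Longrightarrow> card K = r + 1 \<Longrightarrow> \<exists>x\<in>K. \<exists>y\<in>K. x \<noteq> y \<and> \<not> A x y"
    and "\<And>x. x \<in> V \<Longrightarrow> real (card {y\<in>V. \<not> A x y}) \<le> d" and d: "0 \<le> d"
  shows "\<exists>c :: 'b \<Rightarrow> nat. (\<forall>x\<in>V. c x < r) \<and> (\<forall>i. real (card {x\<in>V. c x = i}) \<le> d) \<and>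
    card (arcs V A) + card (arcs V (\<lambda>x y. A x y \<and> c x = c y)) \<le> card (arcs V (\<lambda>x y. c x \<noteq> c y))"
  using assms(1,4,5)
proof (induction r arbitrary: V)
  case 0
  have "V = {}"
  proof (rule ccontr)
    assume "V \<noteq> {}"
    then obtain x where "x \<in> V" by auto
    then show False using 0(2)[of "{x}"] by auto
  qed
  then show ?case using d by (auto simp: arcs_def)
next
  case (Suc r)
  show ?case
  proof (cases "V = {}")
    case True
    then show ?thesis using d by (auto simp: arcs_def)
  next
    case False
    define deg where "deg x = card {y\<in>V. A x y}" for x
    have "Max (deg ` V) \<in> deg ` V" using False Suc.prems(1) by (intro Max_in) auto
    then obtain x where mx: "Max (deg ` V) = deg x" and x: "x \<in> V" by (rule imageE)
    have mx: "deg y \<le> deg x" if "y \<in> V" for y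
      using that Suc.prems(1) by (simp flip: mx)
    define N where "N = {y\<in>V. A x y}"
    define W where "W = {y\<in>V. \<not> A x y}"
    have NW: "finite N" "finite W" "N \<inter> W = {}" "V = N \<union> W"
      using Suc.prems(1) by (auto simp: N_def W_def)
    have "\<exists>c. (\<forall>x\<in>N. c x < r) \<and> (\<forall>i. real (card {x\<in>N. c x = i}) \<le> d) \<and>
      card (arcs N A) + card (arcs N (\<lambda>x y. A x y \<and> c x = c y)) \<le> card (arcs N (\<lambda>x y. c x \<noteq> c y))"
    proof (rule Suc.IH[OF NW(1)])
      fix K assume K: "K \<subseteq> N" "card K = r + 1"
      have "finite K" using K(1) NW(1) by (rule finite_subset)
      moreover have "x \<notin> K" using K(1) irr by (auto simp: N_def)
      ultimately have "card (insert x K) = Suc r + 1" using K by simp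
      moreover have "insert x K \<subseteq> V" using K x by (auto simp: N_def)
      ultimately obtain y z where "y \<in> insert x K" "z \<in> insert x K" "y \<noteq> z" "\<not> A y z"
        using Suc.prems(2) by blast
      then show "\<exists>x\<in>K. \<exists>y\<in>K. x \<noteq> y \<and> \<not> A x y"
        using K sym by (auto simp: N_def)
    next
      fix y assume y: "y \<in> N"
      have "card {z\<in>N. \<not> A y z} \<le> card {z\<in>V. \<not> A y z}"
        using Suc.prems(1) NW by (intro card_mono) auto
      then show "real (card {z\<in>N. \<not> A y z}) \<le> d"
        using Suc.prems(3)[of y] y NW by auto
    qed
    then obtain c' where c': "\<And>x. x \<in> N \<Longrightarrow> c' x < r" "\<And>i. real (card {x\<in>N. c' x = i}) \<le> d"
      "card (arcs N A) + card (arcs N (\<lambda>x y. A x y \<and> c' x = c' y)) \<le> card (arcs N (\<lambda>x y. c' x \<noteq> c' y))"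
      by auto
    define c where "c y = (if y \<in> N then c' y else r)" for y
    have cr: "\<forall>x\<in>V. c x < Suc r" using c'(1) by (auto simp: c_def less_SucI)
    \<comment> \<open>Every class consists of non-neighbours of a single vertex, so the degree
      hypothesis bounds it.\<close>
    have cd: "real (card {x\<in>V. c x = i}) \<le> d" for i
    proof (cases "i = r")
      case True
      then have "{x\<in>V. c x = i} = W" using c'(1) NW by (auto simp: c_def)
      then show ?thesis using Suc.prems(3)[OF x] by (simp add: W_def)
    next
      case False
      then have "{x\<in>V. c x = i} = {x\<in>N. c' x = i}" using NW by (auto simp: c_def)
      then show ?thesis using c'(2) by simp
    qed
    define X where "X = {(y, z). y \<in> W \<and> z \<in> N \<and> A y z}"
    define X' where "X' = {(y, z). y \<in> N \<and> z \<in> W \<and> A y z}"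
    have finX: "finite X" "finite X'"
      by (rule finite_subset[of _ "V \<times> V"]; use NW in \<open>auto simp: X_def X'_def\<close>)+
    have XX': "card X' = card X"
    proof -
      have "X' = prod.swap ` X" using sym by (auto simp: X_def X'_def image_def)
      then show ?thesis by (simp add: card_image)
    qed
    \<comment> \<open>Summing degrees over \<open>W\<close> counts each edge between
      \<open>W\<close> and \<open>N\<close> once and each arc inside \<open>W\<close> once. Twice
      this sum pays for both directions of the former and for the arcs inside \<open>W\<close> two
      times: once as arcs of the graph, once as arcs inside a class.\<close>
    have XY: "card X + card (arcs W A) \<le> card W * card N"
    proof -
      have "X \<inter> arcs W A = {}" using NW by (auto simp: X_def arcs_def)
      then have "card X + card (arcs W A) = card (X \<union> arcs W A)"
        using finX NW by (intro card_Un_disjoint[symmetric]) simp_all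
      also have "X \<union> arcs W A = Sigma W (\<lambda>y. {z\<in>V. A y z})"
        using NW by (auto simp: X_def arcs_def)
      also have "card \<dots> = (\<Sum>y\<in>W. deg y)" using Suc.prems(1) NW by (simp add: deg_def)
      also have "\<dots> \<le> (\<Sum>y\<in>W. deg x)" using mx NW by (intro sum_mono) auto
      finally show ?thesis by (simp add: deg_def N_def)
    qed
    have eqA: "arcs V A = (arcs N A \<union> X) \<union> (X' \<union> arcs W A)"
      using NW by (auto simp: arcs_def X_def X'_def)
    have 1: "card (arcs V A) \<le> (card (arcs N A) + card X) + (card X + card (arcs W A))"
      unfolding eqA using card_Un_le[of "arcs N A \<union> X" "X' \<union> arcs W A"] card_Un_le[of "arcs N A" X]
        card_Un_le[of X' "arcs W A"] XX' by linarith
    have cNW: "c y = c' y" "c' y \<noteq> r" "r \<noteq> c' y" if "y \<in> N" for y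
      using c'(1)[OF that] that by (auto simp: c_def)
    have cW: "c y = r" if "y \<in> W" for y using that NW by (auto simp: c_def)
    have "arcs V (\<lambda>x y. A x y \<and> c x = c y) = arcs N (\<lambda>x y. A x y \<and> c' x = c' y) \<union> arcs W A"
      using NW(3) unfolding arcs_def NW(4) by (auto simp: cNW cW)
    then have 2: "card (arcs V (\<lambda>x y. A x y \<and> c x = c y))
        \<le> card (arcs N (\<lambda>x y. A x y \<and> c' x = c' y)) + card (arcs W A)"
      by (simp only: card_Un_le)
    have "card (arcs V (\<lambda>x y. c x \<noteq> c y)) = card (arcs N (\<lambda>x y. c' x \<noteq> c' y) \<union> (W \<times> N \<union> N \<times> W))"
      using NW(3) unfolding arcs_def NW(4) by (intro arg_cong[where f = card]) (auto simp: cNW cW)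
    also have "\<dots> = card (arcs N (\<lambda>x y. c' x \<noteq> c' y)) + card (W \<times> N \<union> N \<times> W)"
    proof (rule card_Un_disjoint)
      show "arcs N (\<lambda>x y. c' x \<noteq> c' y) \<inter> (W \<times> N \<union> N \<times> W) = {}"
        using NW by (auto simp: arcs_def)
    qed (use NW in simp_all)
    also have "card (W \<times> N \<union> N \<times> W) = card (W \<times> N) + card (N \<times> W)"
      using NW by (intro card_Un_disjoint) auto
    finally have 3: "card (arcs V (\<lambda>x y. c x \<noteq> c y))
        = card (arcs N (\<lambda>x y. c' x \<noteq> c' y)) + 2 * (card W * card N)"
      by (simp add: card_cartesian_product mult.commute)
    have "card (arcs V A) + card (arcs V (\<lambda>x y. A x y \<and> c x = c y)) \<le> card (arcs V (\<lambda>x y. c x \<noteq> c y))"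
      using 1 2 3 XY c'(3) by linarith
    then show ?thesis using cr cd by (intro exI[of _ c]) auto
  qed
qed

section \<open>Class sizes and counts of maps\<close>

lemma same_class_sizes_bij:
  assumes fin: "finite V" "finite V'"
    and eq: "\<And>i. card {x\<in>V. c x = i} = card {x\<in>V'. c' x = i}"
  shows "\<exists>\<beta>. bij_betw \<beta> V V' \<and> (\<forall>x\<in>V. c' (\<beta> x) = c x)"
proof -
  have "\<exists>b. bij_betw b {x\<in>V. c x = i} {x\<in>V'. c' x = i}" for i
    using fin eq by (intro finite_same_card_bij) auto
  then obtain b where b: "\<And>i. bij_betw (b i) {x\<in>V. c x = i} {x\<in>V'. c' x = i}" by metis
  define \<beta> where "\<beta> x = b (c x) x" for x
  have cl: "\<beta> x \<in> V'" "c' (\<beta> x) = c x" if "x \<in> V" for x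
    using bij_betwE[OF b[of "c x"]] that by (auto simp: \<beta>_def)
  have "inj_on \<beta> V"
  proof (rule inj_onI)
    fix x y assume xy: "x \<in> V" "y \<in> V" "\<beta> x = \<beta> y"
    then have "c x = c y" using cl by metis
    then show "x = y" using xy b[of "c x"] by (auto simp: \<beta>_def bij_betw_def inj_on_def)
  qed
  moreover have "\<beta> ` V = V'"
  proof (intro set_eqI iffI)
    fix y assume y: "y \<in> V'"
    then have "y \<in> b (c' y) ` {x\<in>V. c x = c' y}" using b[of "c' y"] by (auto simp: bij_betw_def)
    then show "y \<in> \<beta> ` V" by (auto simp: \<beta>_def intro!: rev_image_eqI)
  qed (use cl in auto)
  ultimately show ?thesis using cl by (auto simp: bij_betw_def)
qed

lemma card_embs_le:
  assumes fin: "finite S" "finite V'" and P: "P \<subseteq> S \<times> S"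
    and \<beta>: "inj_on \<beta> V" "\<beta> ` V \<subseteq> V'"
    and A: "\<And>x y. x \<in> V \<Longrightarrow> y \<in> V \<Longrightarrow> A x y \<Longrightarrow> A' (\<beta> x) (\<beta> y)"
  shows "card (embs S P V A) \<le> card (embs S P V' A')"
proof (rule card_inj_on_le[where f = "\<lambda>f. restrict (\<beta> \<circ> f) S"])
  show "inj_on (\<lambda>f. restrict (\<beta> \<circ> f) S) (embs S P V A)"
  proof (rule inj_onI)
    fix f g assume f: "f \<in> embs S P V A" "g \<in> embs S P V A"
      and eq: "restrict (\<beta> \<circ> f) S = restrict (\<beta> \<circ> g) S"
    have fg: "f \<in> S \<rightarrow>\<^sub>E V" "g \<in> S \<rightarrow>\<^sub>E V" using f by (auto simp: embs_def)
    show "f = g"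
    proof (rule PiE_ext[OF fg])
      fix x assume x: "x \<in> S"
      then have "\<beta> (f x) = \<beta> (g x)" using fun_cong[OF eq, of x] by simp
      then show "f x = g x" using \<beta>(1) fg x by (auto simp: inj_on_def)
    qed
  qed
  show "(\<lambda>f. restrict (\<beta> \<circ> f) S) ` embs S P V A \<subseteq> embs S P V' A'"
  proof clarify
    fix f assume f: "f \<in> embs S P V A"
    then have fS: "\<And>x. x \<in> S \<Longrightarrow> f x \<in> V" and inj: "inj_on f S"
      and fA: "\<And>k l. (k, l) \<in> P \<Longrightarrow> A (f k) (f l)" by (auto simp: embs_def)
    have "inj_on (restrict (\<beta> \<circ> f) S) S"
      using inj \<beta>(1) fS by (auto simp: inj_on_def)
    moreover have "restrict (\<beta> \<circ> f) S \<in> S \<rightarrow>\<^sub>E V'" using fS \<beta>(2) by auto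
    moreover have "A' (restrict (\<beta> \<circ> f) S k) (restrict (\<beta> \<circ> f) S l)" if "(k, l) \<in> P" for k l
      using that P A[OF fS fS fA] by (auto simp: subset_iff)
    ultimately show "restrict (\<beta> \<circ> f) S \<in> embs S P V' A'"
      unfolding embs_def by blast
  qed
qed (use fin in simp)

text \<open>Class-preserving bijections transport embeddings in both directions. This makes an
  exchange of two colours invisible when a vertex is moved, and identifies the balanced case with
  the Turan graph.\<close>

lemma card_embs_multipartite:
  assumes fin: "finite S" "finite V" "finite V'" and P: "P \<subseteq> S \<times> S"
    and eq: "\<And>i. card {x\<in>V. c x = i} = card {x\<in>V'. c' x = i}"
  shows "card (embs S P V (\<lambda>x y. c x \<noteq> c y)) = card (embs S P V' (\<lambda>x y. c' x \<noteq> c' y))"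
proof (rule antisym)
  obtain \<beta> where "bij_betw \<beta> V V'" "\<forall>x\<in>V. c' (\<beta> x) = c x"
    using same_class_sizes_bij[OF fin(2,3) eq] by auto
  then show "card (embs S P V (\<lambda>x y. c x \<noteq> c y)) \<le> card (embs S P V' (\<lambda>x y. c' x \<noteq> c' y))"
    using fin P by (intro card_embs_le[where \<beta> = \<beta>]) (auto simp: bij_betw_def)
  obtain \<beta> where "bij_betw \<beta> V' V" "\<forall>x\<in>V'. c (\<beta> x) = c' x"
    using same_class_sizes_bij[OF fin(3,2) eq[symmetric]] by auto
  then show "card (embs S P V' (\<lambda>x y. c' x \<noteq> c' y)) \<le> card (embs S P V (\<lambda>x y. c x \<noteq> c y))"
    using fin P by (intro card_embs_le[where \<beta> = \<beta>]) (auto simp: bij_betw_def)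
qed

lemma card_PiE_partial:
  assumes "finite S" "X \<subseteq> S"
  shows "card (PiE S (\<lambda>i. if i \<in> X then Y i else V)) = (\<Prod>i\<in>X. card (Y i)) * card V ^ (card S - card X)"
proof -
  have "card (PiE S (\<lambda>i. if i \<in> X then Y i else V)) = (\<Prod>i\<in>S. if i \<in> X then card (Y i) else card V)"
    using assms by (subst card_PiE) (auto intro!: prod.cong)
  also have "\<dots> = (\<Prod>i\<in>X. card (Y i)) * (\<Prod>i\<in>S - X. card V)"
    using assms by (subst prod.subset_diff[of X]) (auto intro!: prod.cong simp: mult.commute)
  finally show ?thesis using assms by (simp add: card_Diff_subset finite_subset)
qed

text \<open>Bounds the embeddings that use an edge inside a colour class: two values are prescribed
  by a pair in \<open>Q\<close>, the others are free.\<close>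

lemma card_maps_pair_le:
  assumes fin: "finite S" "finite V" "finite Q" and kl: "k \<in> S" "l \<in> S" "k \<noteq> l"
  shows "card {f \<in> S \<rightarrow>\<^sub>E V. (f k, f l) \<in> Q} \<le> card Q * card V ^ (card S - 2)"
proof -
  let ?F = "\<lambda>(x, y). PiE S (\<lambda>i. if i \<in> {k, l} then (if i = k then {x} else {y}) else V)"
  have F: "card (?F q) = card V ^ (card S - 2)" for q
  proof -
    obtain x y where q: "q = (x, y)" by force
    have "(\<Prod>i\<in>{k, l}. card (if i = k then {x} else {y})) = 1"
      by (intro prod.neutral) auto
    moreover have "card {k, l} = 2" using kl by simp
    ultimately show ?thesis using kl
      unfolding q prod.case by (subst card_PiE_partial[OF fin(1)]) (auto simp: numeral_2_eq_2)
  qed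
  have finF: "finite (?F q)" for q
    using fin by (cases q) (auto intro!: finite_PiE)
  have "f \<in> ?F (f k, f l)" if "f \<in> S \<rightarrow>\<^sub>E V" for f
    using that by (auto simp: PiE_def Pi_def)
  then have "{f \<in> S \<rightarrow>\<^sub>E V. (f k, f l) \<in> Q} \<subseteq> (\<Union>q\<in>Q. ?F q)" by blast
  then have "card {f \<in> S \<rightarrow>\<^sub>E V. (f k, f l) \<in> Q} \<le> card (\<Union>q\<in>Q. ?F q)"
    using finF fin by (intro card_mono) auto
  also have "\<dots> \<le> (\<Sum>q\<in>Q. card (?F q))" by (rule card_UN_le[OF fin(3)])
  finally show ?thesis using F by simp
qed

section \<open>Moving single vertices between classes\<close>

lemma class_size_upd:
  assumes fin: "finite V" and v: "v \<in> V" and j: "j \<noteq> c v"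
  shows "card {x\<in>V. (c(v := j)) x = i} = (if i = j then card {x\<in>V. c x = j} + 1
    else if i = c v then card {x\<in>V. c x = c v} - 1 else card {x\<in>V. c x = i})"
proof -
  consider "i = j" | "i = c v" "i \<noteq> j" | "i \<noteq> j" "i \<noteq> c v" by blast
  then show ?thesis
  proof cases
    case 1
    then have "{x\<in>V. (c(v := j)) x = i} = insert v {x\<in>V. c x = j}" using v j by auto
    then show ?thesis using 1 fin j by simp
  next
    case 2
    then have "{x\<in>V. (c(v := j)) x = i} = {x\<in>V. c x = c v} - {v}" using v j by auto
    then show ?thesis using 2 fin v by (simp add: card_Diff_singleton)
  next
    case 3
    then have "{x\<in>V. (c(v := j)) x = i} = {x\<in>V. c x = i}" using v j by auto
    then show ?thesis using 3 by simp
  qed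
qed

lemma sum_class_sizes:
  fixes c :: "'b \<Rightarrow> nat"
  assumes "finite V" "\<And>x. x \<in> V \<Longrightarrow> c x < r"
  shows "(\<Sum>i<r. card {x\<in>V. c x = i}) = card (V :: 'b set)"
proof -
  have "card (\<Union>i\<in>{..<r}. {x\<in>V. c x = i}) = (\<Sum>i<r. card {x\<in>V. c x = i})"
    using assms by (intro card_UN_disjoint) auto
  moreover have "(\<Union>i\<in>{..<r}. {x\<in>V. c x = i}) = V" using assms by auto
  ultimately show ?thesis by simp
qed

text \<open>Truncated subtraction makes the sum of the \<open>card {x\<in>V. c x = i} - t i\<close>
  the number of surplus vertices. While it is positive there are an overfull and an underfull class,
  because the totals agree; since the targets differ by at most one, the underfull class is the
  smaller one. The premise \<open>move\<close> records that the surplus drops by exactly one, so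
  that moves can also be counted.\<close>

lemma balance_induct:
  fixes t :: "nat \<Rightarrow> nat" and c :: "'b \<Rightarrow> nat"
  assumes fin: "finite V" and c: "\<And>x. x \<in> V \<Longrightarrow> c x < r"
    and t: "(\<Sum>i<r. t i) = card V" "\<And>i j. i < r \<Longrightarrow> j < r \<Longrightarrow> t i \<le> t j + 1"
    and balanced: "\<And>c. (\<And>x. x \<in> V \<Longrightarrow> c x < r) \<Longrightarrow>
      (\<And>i. i < r \<Longrightarrow> card {x\<in>V. c x = i} = t i) \<Longrightarrow> Q c"
    and move: "\<And>c v j. (\<And>x. x \<in> V \<Longrightarrow> c x < r) \<Longrightarrow> v \<in> V \<Longrightarrow> j < r \<Longrightarrow> j \<noteq> c v \<Longrightarrow>
      card {x\<in>V. c x = j} < card {x\<in>V. c x = c v} \<Longrightarrow>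
      (\<Sum>i<r. card {x\<in>V. c x = i} - t i) = Suc (\<Sum>i<r. card {x\<in>V. (c(v := j)) x = i} - t i) \<Longrightarrow>
      Q (c(v := j)) \<Longrightarrow> Q c"
  shows "Q c"
  using c
proof (induction "\<Sum>i<r. card {x\<in>V. c x = i} - t i" arbitrary: c)
  case 0
  have le: "card {x\<in>V. c x = i} \<le> t i" if "i < r" for i
    using 0(1) that by simp
  have "(\<Sum>i<r. t i) = (\<Sum>i<r. card {x\<in>V. c x = i})"
    using sum_class_sizes[OF fin 0(2)] t by simp
  then have "card {x\<in>V. c x = i} = t i" if "i < r" for i
    using sum_mono_inv[of "\<lambda>i. card {x\<in>V. c x = i}" "{..<r}" t i] le that by auto
  then show ?case using balanced[of c] 0(2) by blast
next
  case (Suc n)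
  let ?s = "\<lambda>i. card {x\<in>V. c x = i}"
  have "\<exists>i<r. t i < ?s i"
  proof (rule ccontr)
    assume "\<not> ?thesis"
    then have "\<forall>i<r. ?s i \<le> t i" by (meson not_le)
    then have "(\<Sum>i<r. ?s i - t i) = 0" by simp
    then show False using Suc(2) by simp
  qed
  then obtain i where i: "i < r" "t i < ?s i" by auto
  have "\<exists>j<r. ?s j < t j"
  proof (rule ccontr)
    assume "\<not> ?thesis"
    then have "\<forall>j<r. t j \<le> ?s j" by (meson not_le)
    then have "(\<Sum>i<r. t i) < (\<Sum>i<r. ?s i)"
      using i by (intro sum_strict_mono_ex1) auto
    then show False using sum_class_sizes[OF fin Suc(3)] t by simp
  qed
  then obtain j where j: "j < r" "?s j < t j" by auto
  have ij: "i \<noteq> j" using i j by auto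
  have "?s i > 0" using i by simp
  then obtain v where v: "v \<in> V" "c v = i" by (metis (mono_tags, lifting) card_gt_0_iff empty_Collect_eq)
  have jv: "j \<noteq> c v" using v ij by simp
  have less: "?s j < ?s (c v)" using i j t(2)[OF j(1) i(1)] v by simp
  have new: "card {x\<in>V. (c(v := j)) x = k} =
      (if k = j then ?s j + 1 else if k = i then ?s i - 1 else ?s k)" for k
    using class_size_upd[where c = c and i = k, OF fin v(1) jv] v by simp
  have "(\<Sum>k<r. ?s k - t k) = Suc (\<Sum>k<r. card {x\<in>V. (c(v := j)) x = k} - t k)"
  proof -
    have "(\<Sum>k<r. ?s k - t k) = (?s i - t i) + (\<Sum>k\<in>{..<r} - {i}. ?s k - t k)"
      using i by (simp add: sum.remove)
    also have "?s i - t i = Suc (card {x\<in>V. (c(v := j)) x = i} - t i)"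
      using new[of i] ij i by simp
    also have "(\<Sum>k\<in>{..<r} - {i}. ?s k - t k) =
        (\<Sum>k\<in>{..<r} - {i}. card {x\<in>V. (c(v := j)) x = k} - t k)"
      using new j by (intro sum.cong) auto
    also have "Suc (card {x\<in>V. (c(v := j)) x = i} - t i) + \<dots> =
        Suc (\<Sum>k<r. card {x\<in>V. (c(v := j)) x = k} - t k)"
      using i by (simp add: sum.remove[of "{..<r}" i])
    finally show ?thesis .
  qed
  moreover from this have "Q (c(v := j))"
    using Suc(2,3) j by (intro Suc(1)) auto
  ultimately show ?case
    using move[of c v j] Suc(3) v(1) j(1) jv less by blast
qed

lemma card_arcs_multipartite:
  assumes fin: "finite V" and c: "\<And>x. x \<in> V \<Longrightarrow> c x < (r::nat)"
  shows "card (arcs V (\<lambda>x y. c x \<noteq> c y)) + (\<Sum>i<r. card {x\<in>V. c x = i} ^ 2) = card V ^ 2"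
proof -
  have "card (\<Union>i\<in>{..<r}. {x\<in>V. c x = i} \<times> {x\<in>V. c x = i}) = (\<Sum>i<r. card {x\<in>V. c x = i} ^ 2)"
    using fin by (subst card_UN_disjoint) (auto simp: card_cartesian_product power2_eq_square)
  then have "card (arcs V (\<lambda>x y. c x \<noteq> c y)) + (\<Sum>i<r. card {x\<in>V. c x = i} ^ 2)
     = card (arcs V (\<lambda>x y. c x \<noteq> c y) \<union> (\<Union>i\<in>{..<r}. {x\<in>V. c x = i} \<times> {x\<in>V. c x = i}))"
    using fin by (subst card_Un_disjoint) (auto simp: arcs_def intro: finite_subset[of _ "V \<times> V"])
  also have "arcs V (\<lambda>x y. c x \<noteq> c y) \<union> (\<Union>i\<in>{..<r}. {x\<in>V. c x = i} \<times> {x\<in>V. c x = i}) = V \<times> V"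
    using c by (auto simp: arcs_def)
  finally show ?thesis by (simp add: card_cartesian_product power2_eq_square)
qed

text \<open>The moved vertex becomes adjacent to the rest of its old class and non-adjacent to its
  new one; each changed pair accounts for two arcs. The proof reads this off from the two squares of
  class sizes that change.\<close>

lemma card_arcs_move:
  assumes fin: "finite V" and c: "\<And>x. x \<in> V \<Longrightarrow> c x < (r::nat)" and v: "v \<in> V" and j: "j < r" "j \<noteq> c v"
    and less: "card {x\<in>V. c x = j} < card {x\<in>V. c x = c v}"
  shows "card (arcs V (\<lambda>x y. (c(v := j)) x \<noteq> (c(v := j)) y)) =
    card (arcs V (\<lambda>x y. c x \<noteq> c y)) + 2 * (card {x\<in>V. c x = c v} - 1 - card {x\<in>V. c x = j})"
proof -
  let ?s = "\<lambda>i. card {x\<in>V. c x = i}" and ?s' = "\<lambda>i. card {x\<in>V. (c(v := j)) x = i}"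
  have cv: "c v < r" using c v by simp
  have sum: "(\<Sum>i<r. f i) = f (c v) + (f j + (\<Sum>i\<in>{..<r} - {c v} - {j}. f i))" for f :: "nat \<Rightarrow> nat"
    using cv j by (simp add: sum.remove[of "{..<r}" "c v"] sum.remove[of "{..<r} - {c v}" j])
  have new: "?s' k = (if k = j then ?s j + 1 else if k = c v then ?s (c v) - 1 else ?s k)" for k
    by (rule class_size_upd[where c = c, OF fin v j(2)])
  have rest: "(\<Sum>i\<in>{..<r} - {c v} - {j}. ?s' i ^ 2) = (\<Sum>i\<in>{..<r} - {c v} - {j}. ?s i ^ 2)"
    by (intro sum.cong refl) (simp only: new, simp)
  obtain a where a: "?s (c v) = Suc a" using less by (cases "?s (c v)") auto
  have "?s' (c v) = a" "?s' j = ?s j + 1" using new[of "c v"] new[of j] j a by auto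
  then have e1: "(\<Sum>i<r. ?s' i ^ 2) = a ^ 2 + ((?s j + 1) ^ 2 + (\<Sum>i\<in>{..<r} - {c v} - {j}. ?s i ^ 2))"
    unfolding sum[of "\<lambda>i. ?s' i ^ 2"] rest by simp
  have e2: "(\<Sum>i<r. ?s i ^ 2) = Suc a ^ 2 + (?s j ^ 2 + (\<Sum>i\<in>{..<r} - {c v} - {j}. ?s i ^ 2))"
    unfolding sum[of "\<lambda>i. ?s i ^ 2"] a ..
  obtain e where e: "a = ?s j + e" using less a le_Suc_ex less_Suc_eq_le by auto
  have "Suc a ^ 2 + ?s j ^ 2 = a ^ 2 + (?s j + 1) ^ 2 + 2 * e"
    unfolding e by (simp add: power2_eq_square algebra_simps)
  then have "(\<Sum>i<r. ?s i ^ 2) = (\<Sum>i<r. ?s' i ^ 2) + 2 * e"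
    using e1 e2 by linarith
  moreover have "card (arcs V (\<lambda>x y. c x \<noteq> c y)) + (\<Sum>i<r. ?s i ^ 2) = card V ^ 2"
    by (rule card_arcs_multipartite[OF fin c])
  moreover have "card (arcs V (\<lambda>x y. (c(v := j)) x \<noteq> (c(v := j)) y)) + (\<Sum>i<r. ?s' i ^ 2) = card V ^ 2"
    by (rule card_arcs_multipartite[OF fin]) (use c j in auto)
  moreover have "?s (c v) - 1 - ?s j = e" using a e by simp
  ultimately show ?thesis by linarith
qed

section \<open>Comparison with complete multipartite graphs\<close>

locale pattern =
  fixes S :: "'a set" and P :: "('a \<times> 'a) set"
  assumes finS: "finite S" and PS: "P \<subseteq> S \<times> S" and orient: "(k, l) \<in> P \<Longrightarrow> (l, k) \<notin> P"
begin

lemma irr: "(k, k) \<notin> P"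
  using orient by blast

lemma finP: "finite P"
  using PS finS by (meson finite_SigmaI finite_subset)

lemma card_both: "card (P \<union> P\<inverse>) = 2 * card P"
proof -
  have "P \<inter> P\<inverse> = {}" using orient by auto
  then show ?thesis using finP by (simp add: card_Un_disjoint)
qed

lemma edge_endpoints:
  assumes "(k, l) \<in> P \<union> P\<inverse>"
  shows "k \<in> S" "l \<in> S" "k \<noteq> l" "card S \<ge> 2"
proof -
  show kl: "k \<in> S" "l \<in> S" "k \<noteq> l" using assms PS irr by auto
  then have "card {k, l} \<le> card S" using finS by (intro card_mono) auto
  then show "card S \<ge> 2" using kl by simp
qed

lemma edge_extensions:
  fixes d :: real and V :: "'b set"
  assumes V: "finite V" and kl: "(k, l) \<in> P \<union> P\<inverse>" and xy: "x \<in> V" "y \<in> V" "x \<noteq> y"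
    and sym: "\<And>x y. D x y \<longleftrightarrow> D y x"
    and deg: "\<And>x. x \<in> V \<Longrightarrow> real (card {y\<in>V. D x y}) \<le> d"
  shows "real (card V) ^ (card S - 2) * (1 - (real (card P) * d + real (card S) ^ 2) / real (card V))
    \<le> real (card (extensions S P V D {k, l} (\<lambda>i. if i = k then x else y)))"
proof -
  note kl' = edge_endpoints[OF kl]
  have eq: "{k, l} \<union> (S - {k, l}) = S" using kl' by auto
  have "card (S - {k, l}) = card S - 2" using kl' finS by (simp add: card_Diff_subset)
  then show ?thesis
    using extensions_lower_bound[of V "{k, l}" "\<lambda>i. if i = k then x else y" D d "S - {k, l}" P,
        unfolded eq] V xy kl' finS PS irr sym deg
    by (auto simp: inj_on_def)
qed

lemma extensionsD:
  assumes "f \<in> extensions S P V D {k, l} (\<lambda>i. if i = k then x else y)" and kl: "(k, l) \<in> P \<union> P\<inverse>"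
  shows "f k = x" "f l = y" "f \<in> S \<rightarrow>\<^sub>E V" "inj_on f S"
    and "\<And>i j. (i, j) \<in> P \<Longrightarrow> (i, j) \<noteq> (k, l) \<Longrightarrow> (i, j) \<noteq> (l, k) \<Longrightarrow> \<not> D (f i) (f j)"
  using assms(1) edge_endpoints[OF kl] irr by (auto simp: extensions_def)

text \<open>The embeddings \<open>I\<close> that use only crossing edges of the host belong to both
  counts. Any other embedding into the host puts a pattern edge on an arc inside a class, which
  allows at most \<open>n ^ (h - 2)\<close> maps per arc and pattern edge. In return each missing
  arc and each pattern edge yield at least \<open>n ^ (h - 2) * L\<close> new embeddings whose other
  edges all lie in the host and cross.\<close>

lemma colour_gain:
  fixes d :: real and V :: "'b set" and c :: "'b \<Rightarrow> nat"
  assumes V: "finite V" and sym: "\<And>x y. A x y \<longleftrightarrow> A y x"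
    and deg: "\<And>x. x \<in> V \<Longrightarrow> real (card {y\<in>V. \<not> A x y}) \<le> d"
    and cls: "\<And>i. real (card {x\<in>V. c x = i}) \<le> d"
  defines "L \<equiv> 1 - (real (card P) * (2 * d) + real (card S) ^ 2) / real (card V)"
  shows "real (card (embs S P V A)) + real (card P) * real (card V) ^ (card S - 2) *
      (L * real (card (arcs V (\<lambda>x y. \<not> A x y \<and> c x \<noteq> c y))) -
       real (card (arcs V (\<lambda>x y. A x y \<and> c x = c y))))
    \<le> real (card (embs S P V (\<lambda>x y. c x \<noteq> c y)))"
proof -
  define n where "n = real (card V)"
  define I where "I = embs S P V (\<lambda>x y. A x y \<and> c x \<noteq> c y)"
  define Ins where "Ins = arcs V (\<lambda>x y. A x y \<and> c x = c y)"
  define Mis where "Mis = arcs V (\<lambda>x y. \<not> A x y \<and> c x \<noteq> c y)"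
  \<comment> \<open>A vertex to be avoided is a non-neighbour or lies in the same class. Both sets
    have size at most \<open>d\<close>, hence the \<open>2 * d\<close> in \<open>L\<close>.\<close>
  define D where "D x y \<longleftrightarrow> \<not> (A x y \<and> c x \<noteq> c y)" for x y
  have fin: "finite Ins" "finite Mis" using V by (auto simp: Ins_def Mis_def)
  define F where "F = (\<lambda>(k, l). {f \<in> S \<rightarrow>\<^sub>E V. (f k, f l) \<in> Ins})"
  have finmaps: "finite (S \<rightarrow>\<^sub>E V)" using V finS by (auto intro: finite_PiE)
  have "embs S P V A \<subseteq> I \<union> (\<Union>p\<in>P. F p)"
  proof
    fix f assume f: "f \<in> embs S P V A"
    show "f \<in> I \<union> (\<Union>p\<in>P. F p)"
    proof (cases "f \<in> I")
      case False
      then obtain k l where kl: "(k, l) \<in> P" "c (f k) = c (f l)"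
        using f by (auto simp: I_def embs_def)
      then have "f k \<in> V" "f l \<in> V" "A (f k) (f l)" using f PS by (auto simp: embs_def)
      then have "f \<in> F (k, l)" using kl f by (auto simp: F_def Ins_def arcs_def embs_def)
      then show ?thesis using kl by blast
    qed simp
  qed
  then have "card (embs S P V A) \<le> card (I \<union> (\<Union>p\<in>P. F p))"
    using finP finS V finmaps by (intro card_mono) (auto simp: F_def I_def)
  also have "\<dots> \<le> card I + (\<Sum>p\<in>P. card (F p))"
    by (rule order_trans[OF card_Un_le]) (intro add_left_mono card_UN_le finP)
  also have "(\<Sum>p\<in>P. card (F p)) \<le> (\<Sum>p\<in>P. card Ins * card V ^ (card S - 2))"
  proof (rule sum_mono)
    fix p assume p: "p \<in> P"
    obtain k l where kl: "p = (k, l)" by force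
    show "card (F p) \<le> card Ins * card V ^ (card S - 2)"
      unfolding kl F_def prod.case using edge_endpoints[of k l] p kl
      by (intro card_maps_pair_le finS V fin) auto
  qed
  finally have "card (embs S P V A) \<le> card I + card P * (card Ins * card V ^ (card S - 2))"
    by simp
  then have upper: "real (card (embs S P V A)) \<le> real (card I) + real (card P) * n ^ (card S - 2) * real (card Ins)"
    unfolding n_def by (simp add: algebra_simps flip: of_nat_mult of_nat_add of_nat_power)

  define X where "X = (\<lambda>((k, l), (x, y)). extensions S P V D {k, l} (\<lambda>i. if i = k then x else y))"
  have Dsym: "D x y \<longleftrightarrow> D y x" for x y using sym by (auto simp: D_def)
  have Ddeg: "real (card {y\<in>V. D x y}) \<le> 2 * d" if "x \<in> V" for x
  proof -
    have "card {y\<in>V. D x y} \<le> card ({y\<in>V. \<not> A x y} \<union> {y\<in>V. c y = c x})"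
      using V by (intro card_mono) (auto simp: D_def)
    also have "\<dots> \<le> card {y\<in>V. \<not> A x y} + card {y\<in>V. c y = c x}" by (rule card_Un_le)
    finally show ?thesis using deg[OF that] cls[of "c x"] by linarith
  qed
  have Xbig: "n ^ (card S - 2) * L \<le> real (card (X q))" if "q \<in> P \<times> Mis" for q
  proof -
    obtain k l x y where q: "q = ((k, l), (x, y))" by (metis surj_pair)
    have "(k, l) \<in> P \<union> P\<inverse>" "x \<in> V" "y \<in> V" "x \<noteq> y" using that q by (auto simp: Mis_def arcs_def)
    then show ?thesis
      unfolding q X_def prod.case n_def L_def
      by (intro edge_extensions V Dsym Ddeg) auto
  qed
  have XD: "f k = x" "f l = y" "f \<in> S \<rightarrow>\<^sub>E V" "inj_on f S" "x \<in> V" "y \<in> V" "\<not> A x y" "c x \<noteq> c y"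
    "\<And>i j. (i, j) \<in> P \<Longrightarrow> (i, j) \<noteq> (k, l) \<Longrightarrow> \<not> D (f i) (f j)"
    if "f \<in> X ((k, l), (x, y))" "(k, l) \<in> P" "(x, y) \<in> Mis" for f k l x y
  proof -
    have "f \<in> extensions S P V D {k, l} (\<lambda>i. if i = k then x else y)" "(k, l) \<in> P \<union> P\<inverse>"
      using that by (auto simp: X_def)
    note e = extensionsD[OF this]
    show "f k = x" "f l = y" "f \<in> S \<rightarrow>\<^sub>E V" "inj_on f S" using e by auto
    show "x \<in> V" "y \<in> V" "\<not> A x y" "c x \<noteq> c y" using that by (auto simp: Mis_def arcs_def)
    show "\<not> D (f i) (f j)" if "(i, j) \<in> P" "(i, j) \<noteq> (k, l)" for i j
      using e(5)[OF that] \<open>(k, l) \<in> P\<close> that orient by auto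
  qed
  \<comment> \<open>A map in \<open>X q\<close> has exactly one pattern edge outside the host, the
    one put on the missing arc. So this edge, and with it \<open>q\<close>, can be recovered from
    the map.\<close>
  have disj: "X q \<inter> X q' = {}" if "q \<in> P \<times> Mis" "q' \<in> P \<times> Mis" "q \<noteq> q'" for q q'
  proof (rule ccontr)
    assume "X q \<inter> X q' \<noteq> {}"
    then obtain f where f: "f \<in> X q" "f \<in> X q'" by auto
    obtain k l x y where q: "q = ((k, l), (x, y))" by (metis surj_pair)
    obtain k' l' x' y' where q': "q' = ((k', l'), (x', y'))" by (metis surj_pair)
    have kl: "(k, l) \<in> P" "(x, y) \<in> Mis" "(k', l') \<in> P" "(x', y') \<in> Mis" using that q q' by auto
    note a = XD[OF f(1)[unfolded q] kl(1,2)] and b = XD[OF f(2)[unfolded q'] kl(3,4)]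
    have "(k', l') = (k, l)"
    proof (rule ccontr)
      assume "(k', l') \<noteq> (k, l)"
      then have "\<not> D (f k') (f l')" using a(9) kl by blast
      then show False using b by (simp add: D_def)
    qed
    then show False using a(1,2) b(1,2) q q' that by auto
  qed
  have finX: "finite (X q)" for q using finS V by (auto simp: X_def split: prod.splits)
  have "(\<Union>q\<in>P \<times> Mis. X q) \<union> I \<subseteq> embs S P V (\<lambda>x y. c x \<noteq> c y)"
  proof (intro Un_least UN_least)
    fix q assume qP: "q \<in> P \<times> Mis"
    show "X q \<subseteq> embs S P V (\<lambda>x y. c x \<noteq> c y)"
    proof
      fix f assume f: "f \<in> X q"
      obtain k l x y where q: "q = ((k, l), (x, y))" by (metis surj_pair)
      have kl: "(k, l) \<in> P" "(x, y) \<in> Mis" using q qP by auto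
      note a = XD[OF f[unfolded q] kl]
      have "c (f i) \<noteq> c (f j)" if "(i, j) \<in> P" for i j
        using a(1,2,8) a(9)[OF that] by (cases "(i, j) = (k, l)") (auto simp: D_def)
      then show "f \<in> embs S P V (\<lambda>x y. c x \<noteq> c y)" using a(3,4) by (auto simp: embs_def)
    qed
  qed (auto simp: I_def embs_def)
  then have "card ((\<Union>q\<in>P \<times> Mis. X q) \<union> I) \<le> card (embs S P V (\<lambda>x y. c x \<noteq> c y))"
    using finS V by (intro card_mono) auto
  moreover have "card ((\<Union>q\<in>P \<times> Mis. X q) \<union> I) = card (\<Union>q\<in>P \<times> Mis. X q) + card I"
  proof (rule card_Un_disjoint)
    show "(\<Union>q\<in>P \<times> Mis. X q) \<inter> I = {}"
    proof (rule ccontr)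
      assume "(\<Union>q\<in>P \<times> Mis. X q) \<inter> I \<noteq> {}"
      then obtain f k l x y where f: "f \<in> X ((k, l), (x, y))" "f \<in> I" "(k, l) \<in> P" "(x, y) \<in> Mis"
        by force
      have "A (f k) (f l)" using f by (auto simp: I_def embs_def)
      then show False using XD[OF f(1,3,4)] by auto
    qed
  qed (use finP fin finX finS V in \<open>auto simp: I_def\<close>)
  moreover have "card (\<Union>q\<in>P \<times> Mis. X q) = (\<Sum>q\<in>P \<times> Mis. card (X q))"
    using finP fin finX disj by (intro card_UN_disjoint) auto
  moreover have "(\<Sum>q\<in>P \<times> Mis. n ^ (card S - 2) * L) \<le> (\<Sum>q\<in>P \<times> Mis. real (card (X q)))"
    by (intro sum_mono Xbig)
  ultimately have "real (card P) * real (card Mis) * (n ^ (card S - 2) * L) + real (card I)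
      \<le> real (card (embs S P V (\<lambda>x y. c x \<noteq> c y)))"
    by (simp add: card_cartesian_product flip: of_nat_sum)
  then show ?thesis using upper unfolding n_def Ins_def Mis_def by (simp add: algebra_simps)
qed

text \<open>
  If the sizes of the two classes without \<open>v\<close> agreed, the move would change nothing, by symmetry.
  So only homomorphisms hitting the surplus \<open>W\<close> of the larger class matter, and the move
  makes \<open>v\<close> adjacent to \<open>W\<close>.
\<close>

lemma move_gain:
  fixes d :: real and V :: "'b set" and c :: "'b \<Rightarrow> nat"
  assumes V: "finite V" and v: "v \<in> V" and j: "j \<noteq> c v"
    and less: "card {x\<in>V. c x = j} < card {x\<in>V. c x = c v}"
    and cls: "\<And>i. real (card {x\<in>V. c x = i}) \<le> d"
  defines "L \<equiv> 1 - (real (card P) * (2 * d) + real (card S) ^ 2) / real (card V)"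
    and "e \<equiv> card {x\<in>V. c x = c v} - 1 - card {x\<in>V. c x = j}"
  shows "real (card (embs S P V (\<lambda>x y. c x \<noteq> c y))) + 2 * real (card P) * real e *
      real (card V) ^ (card S - 2) * (L - real (card S) * d / real (card V))
    \<le> real (card (embs S P V (\<lambda>x y. (c(v := j)) x \<noteq> (c(v := j)) y)))"
proof -
  define n where "n = real (card V)"
  define i where "i = c v"
  define c' where "c' = c(v := j)"
  define J where "J = {x\<in>V. c x = j}"
  have n: "n > 0" using V v by (auto simp: n_def card_gt_0_iff)
  have fJ: "finite J" using V by (simp add: J_def)
  have ca: "card {x\<in>V - {v}. c x = i} = card {x\<in>V. c x = i} - 1"
  proof -
    have "{x\<in>V - {v}. c x = i} = {x\<in>V. c x = i} - {v}" by auto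
    then show ?thesis using v by (simp add: i_def card_Diff_singleton)
  qed
  then have "card J \<le> card {x\<in>V - {v}. c x = i}" using less by (simp add: J_def i_def)
  \<comment> \<open>\<open>A0\<close> is a part of the old class, without \<open>v\<close>, of the
    same size as the new class; the rest of the old class is the surplus \<open>W\<close>, of size
    \<open>e\<close>.\<close>
  then obtain A0 where A0: "A0 \<subseteq> {x\<in>V - {v}. c x = i}" "card A0 = card J"
    by (meson obtain_subset_with_card_n)
  define W where "W = {x\<in>V - {v}. c x = i} - A0"
  define U where "U = V - W"
  have fA0: "finite A0" using A0 V by (auto intro: finite_subset)
  have cW: "card W = e"
    using A0 fA0 ca by (simp add: W_def card_Diff_subset e_def J_def i_def)
  have fin: "finite W" "finite U" using V by (auto simp: W_def U_def)
  have W: "w \<in> V" "c w = i" "c' w = i" "w \<noteq> v" if "w \<in> W" for w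
    using that by (auto simp: W_def c'_def)
  have c'v: "c' v = j" "\<And>x. x \<noteq> v \<Longrightarrow> c' x = c x" by (auto simp: c'_def)
  have ij: "i \<noteq> j" "j \<noteq> i" using j by (auto simp: i_def)
  let ?B = "embs S P V (\<lambda>x y. c x \<noteq> c y)"
  let ?B' = "embs S P V (\<lambda>x y. c' x \<noteq> c' y)"
  define H where "H = {f \<in> ?B. f ` S \<inter> W \<noteq> {}}"
  define H' where "H' = {f \<in> ?B'. f ` S \<inter> W \<noteq> {}}"
  have finH: "finite H" "finite H'" using finS V by (auto simp: H_def H'_def)
  have split: "card (embs S P V A) = card (embs S P U A) + card {f \<in> embs S P V A. f ` S \<inter> W \<noteq> {}}"
    for A :: "'b \<Rightarrow> 'b \<Rightarrow> bool"
  proof -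
    have "embs S P V A = embs S P U A \<union> {f \<in> embs S P V A. f ` S \<inter> W \<noteq> {}}"
      by (auto simp: embs_def U_def PiE_def Pi_def)
    moreover have "embs S P U A \<inter> {f \<in> embs S P V A. f ` S \<inter> W \<noteq> {}} = {}"
      by (auto simp: embs_def U_def PiE_def Pi_def)
    ultimately show ?thesis
      using finS V fin card_Un_disjoint[of "embs S P U A" "{f \<in> embs S P V A. f ` S \<inter> W \<noteq> {}}"]
      by simp
  qed
  \<comment> \<open>Without \<open>W\<close>, the old class is \<open>A0\<close> with
    \<open>v\<close> and the new one is \<open>J\<close>; after the move they are \<open>A0\<close>
    and \<open>J\<close> with \<open>v\<close>. As \<open>A0\<close> and \<open>J\<close> have equal
    size, exchanging the two colours matches the sizes before and after.\<close>
  define \<tau> where "\<tau> k = (if k = i then j else if k = j then i else k)" for k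
  have \<tau>: "\<tau> k = \<tau> l \<longleftrightarrow> k = l" for k l using ij by (auto simp: \<tau>_def)
  have "card (embs S P U (\<lambda>x y. c x \<noteq> c y)) = card (embs S P U (\<lambda>x y. \<tau> (c x) \<noteq> \<tau> (c y)))"
    by (simp add: \<tau>)
  also have "\<dots> = card (embs S P U (\<lambda>x y. c' x \<noteq> c' y))"
  proof (rule card_embs_multipartite[OF finS fin(2,2) PS])
    have vJ: "v \<notin> J" "v \<notin> A0" using j A0 by (auto simp: J_def)
    fix k
    consider "k = i" | "k = j" | "k \<noteq> i" "k \<noteq> j" by blast
    then show "card {x\<in>U. \<tau> (c x) = k} = card {x\<in>U. c' x = k}"
    proof cases
      case 1
      have "{x\<in>U. \<tau> (c x) = k} = J" using 1 ij by (auto simp: U_def J_def W_def \<tau>_def split: if_splits)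
      moreover have "{x\<in>U. c' x = k} = A0" using 1 ij A0 by (auto simp: U_def W_def c'_def i_def)
      ultimately show ?thesis using A0 by simp
    next
      case 2
      have "{x\<in>U. \<tau> (c x) = k} = insert v A0"
        using 2 ij A0 v by (auto simp: U_def W_def \<tau>_def i_def split: if_splits)
      moreover have "{x\<in>U. c' x = k} = insert v J"
        using 2 ij v by (auto simp: U_def W_def c'_def J_def split: if_splits)
      ultimately show ?thesis using A0 vJ fA0 fJ by simp
    next
      case 3
      then have "{x\<in>U. \<tau> (c x) = k} = {x\<in>U. c' x = k}"
        by (auto simp: \<tau>_def c'_def i_def split: if_splits)
      then show ?thesis by simp
    qed
  qed
  finally have same: "card ?B + card H' = card ?B' + card H"
    using split[of "\<lambda>x y. c x \<noteq> c y"] split[of "\<lambda>x y. c' x \<noteq> c' y"] by (simp add: H_def H'_def)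

  define P2 where "P2 = P \<union> P\<inverse>"
  have P2: "finite P2" "card P2 = 2 * card P" using finP card_both by (auto simp: P2_def)

  \<comment> \<open>Among the embeddings that meet \<open>W\<close>, the move destroys only those
    with a pattern edge from \<open>v\<close> to \<open>J\<close>. A further vertex \<open>q\<close>
    goes to \<open>W\<close>, so three values are restricted and the loss carries the small factor
    \<open>h * d / n\<close>.\<close>
  define Z where "Z = {((k, l), q). (k, l) \<in> P2 \<and> q \<in> S - {k, l}}"
  define F where "F = (\<lambda>((k, l), q). PiE S (\<lambda>i. if i \<in> {k, l, q} then
    (if i = k then {v} else if i = l then J else W) else V))"
  have Z: "Z \<subseteq> P2 \<times> S" by (auto simp: Z_def)
  then have finZ: "finite Z" using P2 finS by (auto intro: finite_subset)
  have "card Z \<le> card (P2 \<times> S)" using Z P2 finS by (intro card_mono) auto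
  then have cZ: "card Z \<le> 2 * card P * card S" using P2 by (simp add: card_cartesian_product)
  \<comment> \<open>Multiplication by \<open>n\<close> expresses the count with the exponent
    \<open>card S - 2\<close> of the gain, although three values are restricted.\<close>
  have F: "real (card (F z)) * n = real (card J) * real (card W) * n ^ (card S - 2)" if "z \<in> Z" for z
  proof -
    obtain k l q where z: "z = ((k, l), q)" by (metis surj_pair)
    have kl: "k \<in> S" "l \<in> S" "k \<noteq> l" "q \<in> S" "q \<noteq> k" "q \<noteq> l"
      using that edge_endpoints[of k l] by (auto simp: z Z_def P2_def)
    have "card {k, l, q} \<le> card S" using kl finS by (intro card_mono) auto
    then have S3: "card S - 2 = Suc (card S - 3)" using kl by simp
    have "card (F z) = (\<Prod>i\<in>{k, l, q}. card (if i = k then {v} else if i = l then J else W))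
        * card V ^ (card S - card {k, l, q})"
      unfolding z F_def prod.case using kl by (intro card_PiE_partial finS) auto
    also have "\<dots> = card J * card W * card V ^ (card S - 3)"
      using kl by (simp add: numeral_3_eq_3)
    finally show ?thesis unfolding S3 by (simp add: n_def)
  qed
  have "H - H' \<subseteq> (\<Union>z\<in>Z. F z)"
  proof
    fix f assume f: "f \<in> H - H'"
    then have fS: "\<And>x. x \<in> S \<Longrightarrow> f x \<in> V" "f \<in> S \<rightarrow>\<^sub>E V" and inj: "inj_on f S"
      and fc: "\<And>k l. (k, l) \<in> P \<Longrightarrow> c (f k) \<noteq> c (f l)" by (auto simp: H_def embs_def)
    obtain q where q: "q \<in> S" "f q \<in> W" using f by (auto simp: H_def)
    obtain k l where kl: "(k, l) \<in> P" "c' (f k) = c' (f l)"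
      using f by (auto simp: H_def H'_def embs_def)
    note klS = edge_endpoints[of k l]
    have "\<exists>k l. (k, l) \<in> P2 \<and> f k = v \<and> f l \<in> J"
    proof (cases "f k = v")
      case True
      then have "f l \<noteq> v" using inj klS kl by (auto simp: inj_on_def)
      then have "f l \<in> J" using True kl c'v klS fS by (auto simp: J_def)
      then show ?thesis using True kl by (auto simp: P2_def)
    next
      case False
      then have "f l = v" using kl c'v fc[OF kl(1)] by metis
      then have "f k \<in> J" using False kl c'v klS fS by (auto simp: J_def)
      then show ?thesis using \<open>f l = v\<close> kl by (auto simp: P2_def)
    qed
    then obtain k l where kl: "(k, l) \<in> P2" "f k = v" "f l \<in> J" by blast
    have "f q \<noteq> v" "f q \<notin> J" using W[OF q(2)] ij by (auto simp: J_def)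
    then have "((k, l), q) \<in> Z" using kl q by (auto simp: Z_def)
    moreover have "f \<in> F ((k, l), q)"
      using kl q fS(2) by (auto simp: F_def PiE_def Pi_def)
    ultimately show "f \<in> (\<Union>z\<in>Z. F z)" by blast
  qed
  moreover have "finite (F z)" for z
  proof -
    obtain k l q where z: "z = ((k, l), q)" by (metis surj_pair)
    show ?thesis unfolding z F_def prod.case by (intro finite_PiE finS) (simp add: V fin fJ)
  qed
  then have "finite (\<Union>z\<in>Z. F z)" using finZ by blast
  ultimately have "card (H - H') \<le> card (\<Union>z\<in>Z. F z)" by (rule card_mono[rotated])
  also have "\<dots> \<le> (\<Sum>z\<in>Z. card (F z))" by (rule card_UN_le[OF finZ])
  finally have "real (card (H - H')) \<le> (\<Sum>z\<in>Z. real (card (F z)))"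
    unfolding of_nat_sum[symmetric] by (rule of_nat_mono)
  then have "real (card (H - H')) * n \<le> (\<Sum>z\<in>Z. real (card (F z)) * n)"
    unfolding sum_distrib_right[symmetric] using n by (intro mult_right_mono) auto
  also have "\<dots> = real (card Z) * (real (card J) * real (card W) * n ^ (card S - 2))"
    using F by simp
  also have "\<dots> \<le> (2 * real (card P) * real (card S)) * (d * real e * n ^ (card S - 2))"
  proof (intro mult_mono)
    show "real (card Z) \<le> 2 * real (card P) * real (card S)"
      using of_nat_mono[OF cZ, where 'a = real] by simp
    show "real (card J) \<le> d" using cls[of j] by (simp add: J_def)
  qed (use n cW order_trans[OF of_nat_0_le_iff cls[of j]] in auto)
  finally have bad: "real (card (H - H')) \<le> 2 * real (card P) * real e * n ^ (card S - 2) * (real (card S) * d / n)"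
    using n by (simp add: field_simps)

  \<comment> \<open>Pairs that share a class before or after the move are avoided, so the planted
    pattern edge between \<open>v\<close> and \<open>W\<close> is the only one that is improper
    before the move.\<close>
  define D where "D x y \<longleftrightarrow> c x = c y \<or> c' x = c' y" for x y
  define X where "X = (\<lambda>((k, l), w). extensions S P V D {k, l} (\<lambda>i. if i = k then v else w))"
  have Dsym: "D x y \<longleftrightarrow> D y x" for x y by (auto simp: D_def)
  have cls': "real (card {x\<in>V. c' x = k}) \<le> d" for k
  proof -
    have "card {x\<in>V. c' x = k} \<le> max (card {x\<in>V. c x = c v}) (card {x\<in>V. c x = k})"
      using class_size_upd[where c = c and i = k, OF V v j] less unfolding c'_def
      by (auto split: if_splits)
    then show ?thesis using cls[of "c v"] cls[of k] by linarith
  qed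
  have Ddeg: "real (card {y\<in>V. D x y}) \<le> 2 * d" if "x \<in> V" for x
  proof -
    have "card {y\<in>V. D x y} \<le> card ({y\<in>V. c y = c x} \<union> {y\<in>V. c' y = c' x})"
      using V by (intro card_mono) (auto simp: D_def)
    also have "\<dots> \<le> card {y\<in>V. c y = c x} + card {y\<in>V. c' y = c' x}" by (rule card_Un_le)
    finally show ?thesis using cls[of "c x"] cls'[of "c' x"] by linarith
  qed
  have Xbig: "n ^ (card S - 2) * L \<le> real (card (X q))" if "q \<in> P2 \<times> W" for q
  proof -
    obtain k l w where q: "q = ((k, l), w)" by (metis surj_pair)
    have "(k, l) \<in> P \<union> P\<inverse>" "w \<in> V" "v \<noteq> w" using that q W by (auto simp: P2_def)
    then show ?thesis
      unfolding q X_def prod.case n_def L_def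
      by (intro edge_extensions V v Dsym Ddeg) auto
  qed
  have XD: "f k = v" "f l = w" "f \<in> S \<rightarrow>\<^sub>E V" "inj_on f S" "k \<in> S" "l \<in> S"
    "\<And>i j. (i, j) \<in> P2 \<Longrightarrow> (i, j) \<noteq> (k, l) \<Longrightarrow> (i, j) \<noteq> (l, k) \<Longrightarrow> \<not> D (f i) (f j)"
    if "f \<in> X ((k, l), w)" "(k, l) \<in> P2" for f k l w
  proof -
    have kl: "f \<in> extensions S P V D {k, l} (\<lambda>i. if i = k then v else w)" "(k, l) \<in> P \<union> P\<inverse>"
      using that by (auto simp: X_def P2_def)
    note e = extensionsD[OF kl]
    show "f k = v" "f l = w" "f \<in> S \<rightarrow>\<^sub>E V" "inj_on f S" using e by auto
    show "k \<in> S" "l \<in> S" using edge_endpoints[OF kl(2)] by auto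
    show "\<not> D (f i) (f j)" if "(i, j) \<in> P2" "(i, j) \<noteq> (k, l)" "(i, j) \<noteq> (l, k)" for i j
      using e(5)[of i j] e(5)[of j i] Dsym that by (auto simp: P2_def)
  qed
  \<comment> \<open>Injectivity of \<open>f\<close> determines the pattern vertex placed on
    \<open>v\<close>. A second pattern edge from it into \<open>W\<close> would join two vertices of
    the same old class, which \<open>D\<close> forbids.\<close>
  have disj: "X q \<inter> X q' = {}" if "q \<in> P2 \<times> W" "q' \<in> P2 \<times> W" "q \<noteq> q'" for q q'
  proof (rule ccontr)
    assume "X q \<inter> X q' \<noteq> {}"
    then obtain f where f: "f \<in> X q" "f \<in> X q'" by auto
    obtain k l w where q: "q = ((k, l), w)" by (metis surj_pair)
    obtain k' l' w' where q': "q' = ((k', l'), w')" by (metis surj_pair)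
    have kl: "(k, l) \<in> P2" "w \<in> W" "(k', l') \<in> P2" "w' \<in> W" using that q q' by auto
    note a = XD[OF f(1)[unfolded q] kl(1)] and b = XD[OF f(2)[unfolded q'] kl(3)]
    have k: "k' = k" using a(1,4,5) b(1,5) by (auto simp: inj_on_def)
    have "l' = l"
    proof (rule ccontr)
      assume "l' \<noteq> l"
      then have "\<not> D (f k') (f l')" using a(7)[OF kl(3)] k kl(3) irr by (auto simp: P2_def)
      then show False using b(1,2) W[OF kl(4)] by (simp add: D_def i_def)
    qed
    then show False using a(1,2) b(1,2) q q' that k by auto
  qed
  have finX: "finite (X q)" for q using finS V by (auto simp: X_def split: prod.splits)
  have "(\<Union>q\<in>P2 \<times> W. X q) \<subseteq> H' - H"
  proof (intro UN_least)
    fix q assume qP: "q \<in> P2 \<times> W"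
    show "X q \<subseteq> H' - H"
    proof
      fix f assume f: "f \<in> X q"
      obtain k l w where q: "q = ((k, l), w)" by (metis surj_pair)
      have kl: "(k, l) \<in> P2" "w \<in> W" using q qP by auto
      note a = XD[OF f[unfolded q] kl(1)]
      have "c' (f x) \<noteq> c' (f y)" if "(x, y) \<in> P" for x y
      proof (cases "(x, y) = (k, l) \<or> (x, y) = (l, k)")
        case True
        then show ?thesis using a(1,2) W[OF kl(2)] c'v ij by auto
      next
        case False
        then show ?thesis using a(7)[of x y] that by (auto simp: D_def P2_def)
      qed
      then have "f \<in> ?B'" using a(3,4) by (auto simp: embs_def)
      moreover have "f ` S \<inter> W \<noteq> {}" using a(2,6) kl by auto
      moreover have "f \<notin> ?B"
      proof
        assume "f \<in> ?B"
        then have "c (f x) \<noteq> c (f y)" if "(x, y) \<in> P" for x y using that by (auto simp: embs_def)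
        from this[of k l] this[of l k] show False
          using kl a(1,2) W[OF kl(2)] by (auto simp: P2_def i_def)
      qed
      ultimately show "f \<in> H' - H" by (auto simp: H_def H'_def)
    qed
  qed
  then have "card (\<Union>q\<in>P2 \<times> W. X q) \<le> card (H' - H)"
    using finH by (intro card_mono) auto
  moreover have "card (\<Union>q\<in>P2 \<times> W. X q) = (\<Sum>q\<in>P2 \<times> W. card (X q))"
    using P2 fin finX disj by (intro card_UN_disjoint) auto
  moreover have "(\<Sum>q\<in>P2 \<times> W. n ^ (card S - 2) * L) \<le> (\<Sum>q\<in>P2 \<times> W. real (card (X q)))"
    by (intro sum_mono Xbig)
  ultimately have good: "2 * real (card P) * real e * (n ^ (card S - 2) * L) \<le> real (card (H' - H))"
    using P2 cW by (simp add: card_cartesian_product flip: of_nat_sum)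
  have "card H + card (H' - H) = card (H \<union> H')"
    using finH card_Un_disjoint[of H "H' - H"] by (simp add: Un_Diff_cancel)
  also have "\<dots> = card H' + card (H - H')"
    using finH card_Un_disjoint[of H' "H - H'"] by (simp add: Un_Diff_cancel Un_commute)
  finally have "real (card ?B) + real (card (H' - H)) = real (card ?B') + real (card (H - H'))"
    using same by linarith
  then have "real (card ?B) + (2 * real (card P) * real e * (n ^ (card S - 2) * L)
      - 2 * real (card P) * real e * n ^ (card S - 2) * (real (card S) * d / n)) \<le> real (card ?B')"
    using good bad by linarith
  then show ?thesis unfolding n_def c'_def by (simp add: algebra_simps)
qed

end

section \<open>Deleting a vertex\<close>

text \<open>An upper counterpart to Bernoulli's inequality: for \<open>k * z \<le> 1\<close> the
  higher terms cancel at most half of the linear one. The lost half is made up for later, because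
  summing over pattern vertices counts every pattern edge twice.\<close>

lemma power_one_minus_le:
  fixes z :: real
  assumes "0 \<le> z" "z \<le> 1" "real k * z \<le> 1"
  shows "(1 - z) ^ k \<le> 1 - real k * z / 2"
  using assms(3)
proof (induction k)
  case (Suc k)
  have kz: "real k * z \<le> 1" using Suc.prems assms by (simp add: algebra_simps)
  have "(1 - z) ^ Suc k \<le> (1 - z) * (1 - real k * z / 2)"
    using Suc.IH[OF kz] assms by (simp add: mult_left_mono)
  also have "\<dots> = 1 - z - real k * z / 2 + (real k * z) * z / 2" by (simp add: field_simps)
  also have "\<dots> \<le> 1 - z - real k * z / 2 + 1 * z / 2"
    using kz assms by (intro add_left_mono divide_right_mono mult_right_mono) auto
  finally show ?case by (simp add: field_simps)
qed simp

definition turan_embs :: "'a set \<Rightarrow> ('a \<times> 'a) set \<Rightarrow> nat \<Rightarrow> nat \<Rightarrow> nat" where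
  "turan_embs S P r n = card (embs S P {..<n} (\<lambda>x y. x mod r \<noteq> y mod r))"

definition turan_arcs :: "nat \<Rightarrow> nat \<Rightarrow> nat" where
  "turan_arcs r n = card (arcs {..<n} (\<lambda>x y. x mod r \<noteq> y mod r))"

lemma turan_class_le:
  assumes "r > 0"
  shows "real (card {x. x < n \<and> x mod r = i}) \<le> real n / real r + 1"
proof (cases "i < r")
  case True
  have "\<lfloor>real n / real r\<rfloor> \<le> \<lceil>real n / real r\<rceil>" by (rule floor_le_ceiling)
  then have "int (card {x. x < n \<and> x mod r = i}) \<le> \<lceil>real n / real r\<rceil>"
    using turan_part_size[OF True, of n] by auto
  then show ?thesis using of_int_ceiling_le_add_one[of "real n / real r"] by linarith
next
  case False
  then have "{x. x < n \<and> x mod r = i} = {}" using assms by auto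
  then show ?thesis by (simp del: Collect_empty_eq)
qed

lemma turan_classes_balanced:
  fixes i j r n :: nat
  assumes "i < r" "j < r"
  shows "card {x. x < n \<and> x mod r = i} \<le> card {x. x < n \<and> x mod r = j} + 1"
proof -
  have "\<lfloor>real n / real r\<rfloor> \<le> \<lceil>real n / real r\<rceil>" "\<lceil>real n / real r\<rceil> \<le> \<lfloor>real n / real r\<rfloor> + 1"
    by linarith+
  then have "int (card {x. x < n \<and> x mod r = i}) \<le> int (card {x. x < n \<and> x mod r = j}) + 1"
    using turan_part_size[OF assms(1), of n] turan_part_size[OF assms(2), of n]
    by (elim insertE) (linarith | simp)+
  then show ?thesis by simp
qed

lemma turan_classes_sum:
  assumes "r > 0"
  shows "(\<Sum>i<r. card {x. x < n \<and> x mod r = i}) = n"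
  using sum_class_sizes[of "{..<n}" "\<lambda>x. x mod r" r] assms by simp

lemma card_arcs_balanced:
  fixes c :: "'b \<Rightarrow> nat"
  assumes V: "finite V" "card V = n" and r: "r > 0" and c: "\<And>x. x \<in> V \<Longrightarrow> c x < r"
    and eq: "\<And>i. i < r \<Longrightarrow> card {x\<in>V. c x = i} = card {x. x < n \<and> x mod r = i}"
  shows "card (arcs V (\<lambda>x y. c x \<noteq> c y)) = turan_arcs r n"
proof -
  have "card (arcs V (\<lambda>x y. c x \<noteq> c y)) + (\<Sum>i<r. card {x\<in>V. c x = i} ^ 2) = n ^ 2"
    using card_arcs_multipartite[of V c r] c V by auto
  moreover have "turan_arcs r n + (\<Sum>i<r. card {x. x < n \<and> x mod r = i} ^ 2) = n ^ 2"
    using card_arcs_multipartite[of "{..<n}" "\<lambda>x. x mod r" r] r by (simp add: turan_arcs_def)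
  moreover have "(\<Sum>i<r. card {x\<in>V. c x = i} ^ 2) = (\<Sum>i<r. card {x. x < n \<and> x mod r = i} ^ 2)"
    using eq by (intro sum.cong) auto
  ultimately show ?thesis by linarith
qed

lemma turan_arcs_Suc_le: "turan_arcs r (Suc n) \<le> turan_arcs r n + 2 * Suc n"
proof -
  let ?R = "\<lambda>x y. x mod r \<noteq> y mod r"
  have "arcs {..<Suc n} ?R \<subseteq> arcs {..<n} ?R \<union> ({n} \<times> {..<Suc n} \<union> {..<Suc n} \<times> {n})"
    by (auto simp: arcs_def)
  then have "turan_arcs r (Suc n) \<le> card (arcs {..<n} ?R \<union> ({n} \<times> {..<Suc n} \<union> {..<Suc n} \<times> {n}))"
    unfolding turan_arcs_def by (intro card_mono) auto
  also have "\<dots> \<le> card (arcs {..<n} ?R) + card ({n} \<times> {..<Suc n} \<union> {..<Suc n} \<times> {n})"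
    by (rule card_Un_le)
  also have "\<dots> \<le> card (arcs {..<n} ?R) + (card ({n} \<times> {..<Suc n}) + card ({..<Suc n} \<times> {n}))"
    by (intro add_left_mono card_Un_le)
  finally show ?thesis by (simp add: turan_arcs_def card_cartesian_product)
qed

lemma card_arcs_le: "finite V \<Longrightarrow> card (arcs V A) \<le> card V ^ 2"
  using card_mono[of "V \<times> V" "arcs V A"]
  by (auto simp: arcs_def card_cartesian_product power2_eq_square)

context pattern
begin

lemma card_P_le: "2 * card P \<le> card S * (card S - 1)"
proof -
  have "P \<union> P\<inverse> \<subseteq> S \<times> S - (\<lambda>x. (x, x)) ` S" using PS irr by auto
  then have "card (P \<union> P\<inverse>) \<le> card (S \<times> S - (\<lambda>x. (x, x)) ` S)"
    using finS by (intro card_mono) auto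
  also have "\<dots> = card (S \<times> S) - card ((\<lambda>x. (x, x)) ` S)"
    using finS by (intro card_Diff_subset) auto
  also have "card ((\<lambda>x. (x, x)) ` S) = card S" by (intro card_image) (auto simp: inj_on_def)
  finally show ?thesis by (simp add: card_both card_cartesian_product diff_mult_distrib2)
qed

lemma card_embs_le_power: "finite V \<Longrightarrow> card (embs S P V A) \<le> card V ^ card S"
  using card_mono[of "S \<rightarrow>\<^sub>E V" "embs S P V A"] finS
  by (auto simp: embs_def finite_PiE card_funcsetE)

text \<open>An embedding through \<open>v\<close> places some pattern vertex \<open>k\<close> there
  and the pattern neighbours of \<open>k\<close> among the neighbours of \<open>v\<close>; the other
  vertices are left unrestricted. This allows at most
  \<open>n ^ (h - 1) * (1 - z) ^ card (nb k)\<close> maps.\<close>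

lemma card_embs_remove_le:
  fixes z :: real
  assumes V: "finite V" and v: "v \<in> V" and sym: "\<And>x y. A x y \<longleftrightarrow> A y x"
    and irrA: "\<And>x. \<not> A x x"
    and z: "0 \<le> z" "z \<le> 1" "real (card S) * z \<le> 1"
    and deg: "real (card {y\<in>V. A v y}) \<le> real (card V) * (1 - z)"
  shows "real (card (embs S P V A)) \<le> real (card (embs S P (V - {v}) A)) +
    real (card V) ^ (card S - 1) * (real (card S) - real (card P) * z)"
proof -
  define n where "n = real (card V)"
  define N where "N = {y\<in>V. A v y}"
  define nb where "nb k = {l. (k, l) \<in> P \<union> P\<inverse>}" for k
  define F where "F k = PiE S (\<lambda>i. if i \<in> insert k (nb k) then (if i = k then {v} else N) else V)" for k
  have nbS: "nb k \<subseteq> S" "k \<notin> nb k" for k using PS irr by (auto simp: nb_def)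
  have fnb: "finite (nb k)" for k using nbS finS by (metis finite_subset)
  have n: "n \<ge> 0" by (simp add: n_def)
  have F: "real (card (F k)) \<le> n ^ (card S - 1) * (1 - real (card (nb k)) * z / 2)" if k: "k \<in> S" for k
  proof -
    have sub: "insert k (nb k) \<subseteq> S" using nbS k by auto
    have c: "card (insert k (nb k)) = Suc (card (nb k))" using nbS(2) fnb by simp
    then have le: "Suc (card (nb k)) \<le> card S" using sub finS card_mono by metis
    have "card (F k) = (\<Prod>i\<in>insert k (nb k). card (if i = k then {v} else N)) *
        card V ^ (card S - card (insert k (nb k)))"
      unfolding F_def by (rule card_PiE_partial[OF finS sub])
    also have "(\<Prod>i\<in>insert k (nb k). card (if i = k then {v} else N)) =
        (\<Prod>i\<in>nb k. card (if i = k then {v} else N))"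
      using nbS(2) fnb by simp
    also have "\<dots> = (\<Prod>i\<in>nb k. card N)" using nbS(2) by (intro prod.cong) auto
    finally have "card (F k) = card N ^ card (nb k) * card V ^ (card S - Suc (card (nb k)))"
      using c by simp
    then have "real (card (F k)) = real (card N) ^ card (nb k) * n ^ (card S - Suc (card (nb k)))"
      by (simp add: n_def)
    also have "\<dots> \<le> (n * (1 - z)) ^ card (nb k) * n ^ (card S - Suc (card (nb k)))"
      using deg n by (intro mult_right_mono power_mono) (auto simp: n_def N_def)
    also have "\<dots> = n ^ (card (nb k) + (card S - Suc (card (nb k)))) * (1 - z) ^ card (nb k)"
      by (simp add: power_mult_distrib power_add)
    also have "card (nb k) + (card S - Suc (card (nb k))) = card S - 1" using le by simp
    also have "n ^ (card S - 1) * (1 - z) ^ card (nb k) \<le> n ^ (card S - 1) * (1 - real (card (nb k)) * z / 2)"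
    proof (intro mult_left_mono power_one_minus_le z)
      have "real (card (nb k)) * z \<le> real (card S) * z" using le z by (intro mult_right_mono) auto
      then show "real (card (nb k)) * z \<le> 1" using z by linarith
    qed (use n in simp)
    finally show ?thesis .
  qed
  have "embs S P V A \<subseteq> embs S P (V - {v}) A \<union> (\<Union>k\<in>S. F k)"
  proof
    fix f assume f: "f \<in> embs S P V A"
    then have fS: "f \<in> S \<rightarrow>\<^sub>E V" and fA: "\<And>k l. (k, l) \<in> P \<Longrightarrow> A (f k) (f l)"
      by (auto simp: embs_def)
    show "f \<in> embs S P (V - {v}) A \<union> (\<Union>k\<in>S. F k)"
    proof (cases "\<exists>k\<in>S. f k = v")
      case True
      then obtain k where k: "k \<in> S" "f k = v" by auto
      have "f l \<in> N" if "l \<in> nb k" for l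
        using that fA[of k l] fA[of l k] sym k fS nbS[of k] by (auto simp: nb_def N_def)
      then have "f \<in> F k" using fS k unfolding F_def by (auto simp: PiE_def Pi_def)
      then show ?thesis using k by blast
    next
      case False
      then have "f \<in> S \<rightarrow>\<^sub>E (V - {v})" using fS by (auto simp: PiE_def Pi_def)
      then show ?thesis using f by (auto simp: embs_def)
    qed
  qed
  moreover have "finite (F k)" for k
    unfolding F_def by (intro finite_PiE finS) (simp add: V N_def)
  then have "finite (embs S P (V - {v}) A \<union> (\<Union>k\<in>S. F k))" using finS V by simp
  ultimately have "card (embs S P V A) \<le> card (embs S P (V - {v}) A \<union> (\<Union>k\<in>S. F k))"
    by (rule card_mono[rotated])
  also have "\<dots> \<le> card (embs S P (V - {v}) A) + card (\<Union>k\<in>S. F k)" by (rule card_Un_le)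
  also have "\<dots> \<le> card (embs S P (V - {v}) A) + (\<Sum>k\<in>S. card (F k))"
    by (intro add_left_mono card_UN_le finS)
  finally have "real (card (embs S P V A)) \<le> real (card (embs S P (V - {v}) A)) + (\<Sum>k\<in>S. real (card (F k)))"
    unfolding of_nat_sum[symmetric] of_nat_add[symmetric] by (rule of_nat_mono)
  also have "(\<Sum>k\<in>S. real (card (F k))) \<le> (\<Sum>k\<in>S. n ^ (card S - 1) * (1 - real (card (nb k)) * z / 2))"
    by (intro sum_mono F)
  also have "\<dots> = n ^ (card S - 1) * (real (card S) - (\<Sum>k\<in>S. real (card (nb k))) * z / 2)"
    by (simp add: sum_distrib_left[symmetric] sum_subtractf sum_distrib_right sum_divide_distrib)
  \<comment> \<open>Handshake: the factor two absorbs the half from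
    \<open>power_one_minus_le\<close>.\<close>
  also have "(\<Sum>k\<in>S. real (card (nb k))) = 2 * real (card P)"
  proof -
    have "P \<union> P\<inverse> = Sigma S nb" using PS by (auto simp: nb_def)
    then have "2 * card P = (\<Sum>k\<in>S. card (nb k))" using card_both finS fnb by simp
    then show ?thesis by (metis of_nat_mult of_nat_numeral of_nat_sum)
  qed
  finally show ?thesis unfolding n_def by simp
qed

text \<open>In the residue model, removing the last vertex \<open>n'\<close> from the Turan graph
  leaves the Turan graph on \<open>n'\<close> vertices. For each pattern vertex \<open>k\<close> the
  embeddings with \<open>k\<close> at \<open>n'\<close> are counted greedily, avoiding classes of
  size at most \<open>n / r + 1\<close>; injectivity makes these families disjoint.\<close>

lemma turan_embs_Suc_ge:
  assumes r: "r > 0" and n: "n = Suc n'"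
  shows "real (turan_embs S P r n') + real (card S) * real n ^ (card S - 1) *
      (1 - (real (card P) * (real n / real r + 1) + real (card S) ^ 2) / real n)
    \<le> real (turan_embs S P r n)"
proof -
  let ?R = "\<lambda>x y. x mod r \<noteq> y mod r"
  let ?X = "\<lambda>k. extensions S P {..<n} (\<lambda>x y. x mod r = y mod r) {k} (\<lambda>_. n')"
  let ?L = "real n ^ (card S - 1) *
      (1 - (real (card P) * (real n / real r + 1) + real (card S) ^ 2) / real n)"
  have X: "?L \<le> real (card (?X k))" if k: "k \<in> S" for k
  proof -
    have eq: "{k} \<union> (S - {k}) = S" using k by auto
    have c: "card (S - {k}) = card S - 1" using k finS by simp
    have "{y \<in> {..<n}. x mod r = y mod r} = {y. y < n \<and> y mod r = x mod r}" for x by auto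
    then have "real (card {y \<in> {..<n}. x mod r = y mod r}) \<le> real n / real r + 1" for x
      using turan_class_le[OF r, of n "x mod r"] by simp
    then have "real (card {..<n}) ^ card (S - {k}) *
        (1 - (real (card P) * (real n / real r + 1) + real (card ({k} \<union> (S - {k}))) ^ 2) / real (card {..<n}))
        \<le> real (card (extensions ({k} \<union> (S - {k})) P {..<n} (\<lambda>x y. x mod r = y mod r) {k} (\<lambda>_. n')))"
      by (intro extensions_lower_bound) (use finS PS irr n k in auto)
    then show ?thesis unfolding eq c by simp
  qed
  have XD: "f k = n'" "f \<in> S \<rightarrow>\<^sub>E {..<n}" "inj_on f S" "\<forall>(i, j)\<in>P. ?R (f i) (f j)"
    if "f \<in> ?X k" for f k using that irr unfolding extensions_def by auto
  have disj: "?X k \<inter> ?X l = {}" if "k \<in> S" "l \<in> S" "k \<noteq> l" for k l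
  proof (rule ccontr)
    assume "?X k \<inter> ?X l \<noteq> {}"
    then obtain f where f: "f \<in> ?X k" "f \<in> ?X l" by auto
    then have "f k = f l" "inj_on f S" using XD(1,3) by metis+
    then show False using that by (auto simp: inj_on_def)
  qed
  have E0: "embs S P {..<n'} ?R \<inter> (\<Union>k\<in>S. ?X k) = {}"
  proof (rule ccontr)
    assume "embs S P {..<n'} ?R \<inter> (\<Union>k\<in>S. ?X k) \<noteq> {}"
    then obtain f k where f: "f \<in> embs S P {..<n'} ?R" "k \<in> S" "f \<in> ?X k" by auto
    then have "f k \<in> {..<n'}" by (auto simp: embs_def)
    then show False using XD(1)[OF f(3)] by simp
  qed
  have finX: "finite (?X k)" for k using finS by simp
  have "(\<Sum>k\<in>S. ?L) \<le> (\<Sum>k\<in>S. real (card (?X k)))" by (intro sum_mono X)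
  also have "\<dots> = real (card (\<Union>k\<in>S. ?X k))"
    using finS finX disj by (subst card_UN_disjoint) auto
  finally have 1: "real (card S) * ?L \<le> real (card (\<Union>k\<in>S. ?X k))" by simp
  have "card (embs S P {..<n'} ?R) + card (\<Union>k\<in>S. ?X k) = card (embs S P {..<n'} ?R \<union> (\<Union>k\<in>S. ?X k))"
    using finS finX E0 by (intro card_Un_disjoint[symmetric]) auto
  also have "\<dots> \<le> card (embs S P {..<n} ?R)"
  proof (rule card_mono)
    have "embs S P {..<n'} ?R \<subseteq> embs S P {..<n} ?R"
      using n unfolding embs_def by (fastforce simp: PiE_def Pi_def less_Suc_eq)
    moreover have "?X k \<subseteq> embs S P {..<n} ?R" for k
      using XD unfolding embs_def by blast
    ultimately show "embs S P {..<n'} ?R \<union> (\<Union>k\<in>S. ?X k) \<subseteq> embs S P {..<n} ?R" by blast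
  qed (use finS in simp)
  finally show ?thesis using 1 by (simp add: turan_embs_def algebra_simps)
qed

end

section \<open>The inequality for large host graphs\<close>

locale large_turan_pattern = pattern +
  fixes r :: nat
  assumes P_ne: "P \<noteq> {}" and r_ge: "r \<ge> 4 * card S ^ 3 + 11 * card S ^ 2"
begin

lemma S2: "card S \<ge> 2"
proof -
  obtain k l where "(k, l) \<in> P" using P_ne by auto
  then show ?thesis using edge_endpoints[of k l] by auto
qed

lemma P1: "card P \<ge> 1"
  using P_ne finP by (simp add: Suc_leI card_gt_0_iff)

lemma r_pos: "r > 0"
proof -
  have "card S ^ 2 > 0" using S2 by simp
  then show ?thesis using r_ge by linarith
qed

text \<open>The cubic part of the bound on \<open>r\<close> is spent here, via
  \<open>(h - 1) * h * (h + 1) \<le> h ^ 3\<close>. It keeps the greedy loss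
  \<open>card P * (2 * gap)\<close> at 1/4 or below.\<close>

lemma r_bound1: "4 * (2 * card P * (card S + 1)) \<le> r"
proof -
  have "2 * card P * (card S + 1) \<le> card S * (card S - 1) * (card S + 1)"
    using card_P_le by (intro mult_right_mono) auto
  also have "\<dots> = card S * ((card S - 1) * (card S + 1))" by (simp only: mult.assoc)
  also have "(card S - 1) * (card S + 1) \<le> card S * card S"
    by (simp add: diff_mult_distrib)
  finally have "2 * card P * (card S + 1) \<le> card S ^ 3" by (simp add: power3_eq_cube)
  then show ?thesis using r_ge by linarith
qed

text \<open>Controls the loss of a move, which comes from embeddings with a pattern edge between the
  moved vertex and the receiving class that also meet the surplus.\<close>

lemma r_bound2: "4 * (card S * (card S + 1)) \<le> r"
proof -
  have "card S \<le> card S ^ 2" using S2 by (simp add: power2_eq_square)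
  moreover have "4 * (card S * (card S + 1)) = 4 * card S ^ 2 + 4 * card S"
    by (simp add: power2_eq_square)
  ultimately have "4 * (card S * (card S + 1)) \<le> 11 * card S ^ 2" by linarith
  then show ?thesis using r_ge by linarith
qed

text \<open>Threshold for non-neighbours as a fraction of \<open>n\<close>, one unit of
  \<open>1 / r\<close> above the value at which a deletion would break even to leading
  order.\<close>

definition gap :: real where "gap = (real (card S) + 1) / real r"

lemma gap: "real (card P) * (2 * gap) \<le> 1 / 4" "real (card S) * gap \<le> 1 / 4" "0 < gap" "gap \<le> 1"
proof -
  have "real (4 * (2 * card P * (card S + 1))) \<le> real r" using r_bound1 by (rule of_nat_mono)
  then show "real (card P) * (2 * gap) \<le> 1 / 4" using r_pos by (simp add: gap_def field_simps)
  have "real (4 * (card S * (card S + 1))) \<le> real r" using r_bound2 by (rule of_nat_mono)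
  then show h: "real (card S) * gap \<le> 1 / 4" using r_pos by (simp add: gap_def field_simps)
  show g: "0 < gap" using r_pos by (simp add: gap_def)
  have "gap \<le> real (card S) * gap" using g S2 by simp
  then show "gap \<le> 1" using h by linarith
qed

text \<open>Small enough in two ways: deleting a vertex lowers the weighted arc deficit by at most
  \<open>n ^ (h - 1) / (4 * r)\<close>, a quarter of the available gain
  \<open>n ^ (h - 1) / r\<close>; and \<open>\<kappa> \<le> 1 / 8\<close> stays within what is won
  per missing arc in dense hosts and in balancing moves.\<close>

definition \<kappa> :: real where "\<kappa> = 1 / (4 * real r * real (card S))"

lemma \<kappa>: "0 < \<kappa>" "\<kappa> \<le> 1 / 8"
proof -
  show "0 < \<kappa>" using r_pos S2 by (simp add: \<kappa>_def)
  have "1 * 2 \<le> real r * real (card S)" using r_pos S2 by (intro mult_mono) auto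
  then have "8 \<le> 4 * real r * real (card S)" by simp
  then show "\<kappa> \<le> 1 / 8" unfolding \<kappa>_def by (intro divide_left_mono) auto
qed

text \<open>Of the loss, 1/4 comes from the bound on \<open>gap\<close> and 1/8 from
  \<open>n \<ge> 8 * card S ^ 2\<close>. What matters is that 5/8 exceeds 1/2 by enough to leave
  room for \<open>\<kappa>\<close>.\<close>

lemma L_ge:
  assumes n: "n \<ge> 8 * card S ^ 2"
  shows "5 / 8 \<le> 1 - (real (card P) * (2 * (gap * real n)) + real (card S) ^ 2) / real n"
proof -
  have "card S ^ 2 > 0" using S2 by simp
  then have np: "real n > 0" using n by linarith
  have "real (8 * card S ^ 2) \<le> real n" using n by (rule of_nat_mono)
  then have "real (card S) ^ 2 / real n \<le> 1 / 8" using np by (simp add: field_simps)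
  moreover have "real (card P) * (2 * (gap * real n)) / real n = real (card P) * (2 * gap)"
    using np by simp
  ultimately show ?thesis using gap(1) unfolding add_divide_distrib by linarith
qed

text \<open>A move creates \<open>2 * e\<close> arcs and at least
  \<open>2 * card P * e * n ^ (h - 2) * (5 / 8 - 1 / 4)\<close> embeddings. As
  \<open>\<kappa>\<close> is less than 3/8, the left-hand side does not decrease along the moves
  that lead to balanced classes.\<close>

lemma multipartite_le_turan:
  fixes V :: "'b set"
  assumes V: "finite V" "card V = n" and n: "n \<ge> 8 * card S ^ 2"
    and c: "\<And>x. x \<in> V \<Longrightarrow> c x < r"
    and cls: "\<And>i. real (card {x\<in>V. c x = i}) \<le> gap * real n"
  shows "real (card (embs S P V (\<lambda>x y. c x \<noteq> c y))) +
      \<kappa> * real n ^ (card S - 2) * (real (turan_arcs r n) - real (card (arcs V (\<lambda>x y. c x \<noteq> c y))))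
    \<le> real (turan_embs S P r n)"
proof -
  let ?t = "\<lambda>i. card {x. x < n \<and> x mod r = i}"
  \<comment> \<open>The class bound is a premise inside \<open>Q\<close>, because
    \<open>move_gain\<close> needs it at every colouring met on the way. It survives a move since
    the receiving class was strictly smaller.\<close>
  define Q where "Q c \<longleftrightarrow> (\<forall>i. real (card {x\<in>V. c x = i}) \<le> gap * real n) \<longrightarrow>
    real (card (embs S P V (\<lambda>x y. c x \<noteq> c y))) +
      \<kappa> * real n ^ (card S - 2) * (real (turan_arcs r n) - real (card (arcs V (\<lambda>x y. c x \<noteq> c y))))
    \<le> real (turan_embs S P r n)" for c :: "'b \<Rightarrow> nat"
  have tsum: "(\<Sum>i<r. ?t i) = card V" using turan_classes_sum[OF r_pos] V by simp
  have "Q c"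
  proof (rule balance_induct[where V = V and r = r and t = ?t])
    show "finite V" "sum ?t {..<r} = card V" by (rule V tsum)+
    show "c x < r" if "x \<in> V" for x using c that .
    show "?t i \<le> ?t j + 1" if "i < r" "j < r" for i j using turan_classes_balanced that .
  next
    fix c :: "'b \<Rightarrow> nat"
    assume balanced: "\<And>x. x \<in> V \<Longrightarrow> c x < r" "\<And>i. i < r \<Longrightarrow> card {x\<in>V. c x = i} = ?t i"
    have eq: "card {x\<in>V. c x = i} = card {x \<in> {..<n}. x mod r = i}" for i
    proof (cases "i < r")
      case True
      then show ?thesis using balanced(2) by simp
    next
      case False
      then have "{x\<in>V. c x = i} = {}" "{x \<in> {..<n}. x mod r = i} = {}"
        using balanced(1) r_pos by auto
      then show ?thesis by (simp only: card.empty)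
    qed
    have "card (embs S P V (\<lambda>x y. c x \<noteq> c y)) = turan_embs S P r n"
      unfolding turan_embs_def by (intro card_embs_multipartite finS V PS eq) simp
    moreover have "card (arcs V (\<lambda>x y. c x \<noteq> c y)) = turan_arcs r n"
      using V r_pos balanced by (intro card_arcs_balanced) auto
    ultimately show "Q c" by (simp add: Q_def)
  next
    fix c :: "'b \<Rightarrow> nat" and v j
    assume move: "\<And>x. x \<in> V \<Longrightarrow> c x < r" "v \<in> V" "j < r" "j \<noteq> c v"
      "card {x\<in>V. c x = j} < card {x\<in>V. c x = c v}" "Q (c(v := j))"
    define e where "e = card {x\<in>V. c x = c v} - 1 - card {x\<in>V. c x = j}"
    define L where "L = 1 - (real (card P) * (2 * (gap * real n)) + real (card S) ^ 2) / real n"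
    have np: "real n > 0" using V move(2) by (auto simp: card_gt_0_iff)
    show "Q c" unfolding Q_def
    proof
      assume cls: "\<forall>i. real (card {x\<in>V. c x = i}) \<le> gap * real n"
      have "real (card {x\<in>V. (c(v := j)) x = i}) \<le> gap * real n" for i
      proof -
        have "card {x\<in>V. (c(v := j)) x = i} \<le> max (card {x\<in>V. c x = c v}) (card {x\<in>V. c x = i})"
          using class_size_upd[where c = c and i = i, OF V(1) move(2,4)] move(5)
          by (auto split: if_splits)
        then show ?thesis using cls[rule_format, of "c v"] cls[rule_format, of i] by linarith
      qed
      then have IH: "real (card (embs S P V (\<lambda>x y. (c(v := j)) x \<noteq> (c(v := j)) y))) +
          \<kappa> * real n ^ (card S - 2) *
          (real (turan_arcs r n) - real (card (arcs V (\<lambda>x y. (c(v := j)) x \<noteq> (c(v := j)) y))))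
        \<le> real (turan_embs S P r n)"
        using move(6) unfolding Q_def by blast
      have arcs: "real (card (arcs V (\<lambda>x y. (c(v := j)) x \<noteq> (c(v := j)) y))) =
          real (card (arcs V (\<lambda>x y. c x \<noteq> c y))) + 2 * real e"
        unfolding e_def using card_arcs_move[where c = c, OF V(1) move(1-5)] by simp
      have gain: "real (card (embs S P V (\<lambda>x y. c x \<noteq> c y))) + 2 * real (card P) * real e *
          real n ^ (card S - 2) * (L - real (card S) * (gap * real n) / real n)
        \<le> real (card (embs S P V (\<lambda>x y. (c(v := j)) x \<noteq> (c(v := j)) y)))"
        using move_gain[where c = c and d = "gap * real n", OF V(1) move(2,4,5)] cls
        unfolding L_def e_def V(2) by blast
      have "5 / 8 \<le> L" unfolding L_def by (rule L_ge[OF n])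
      moreover have "real (card S) * (gap * real n) / real n \<le> 1 / 4" using gap(2) np by simp
      ultimately have "1 * \<kappa> \<le> real (card P) * (L - real (card S) * (gap * real n) / real n)"
        using P1 \<kappa> by (intro mult_mono) auto
      then have "\<kappa> * real n ^ (card S - 2) * (2 * real e) \<le>
          (real (card P) * (L - real (card S) * (gap * real n) / real n)) * real n ^ (card S - 2) * (2 * real e)"
        by (intro mult_right_mono) auto
      then show "real (card (embs S P V (\<lambda>x y. c x \<noteq> c y))) +
          \<kappa> * real n ^ (card S - 2) * (real (turan_arcs r n) - real (card (arcs V (\<lambda>x y. c x \<noteq> c y))))
        \<le> real (turan_embs S P r n)"
        using IH gain unfolding arcs by (simp add: algebra_simps)
    qed
  qed
  then show ?thesis using cls by (simp add: Q_def)
qed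

text \<open>
  The middle term makes the bound \<open>excess \<le> 0\<close> control the number of edges of the host graph
  as well, which is what stability needs.
\<close>

definition excess :: "'b set \<Rightarrow> ('b \<Rightarrow> 'b \<Rightarrow> bool) \<Rightarrow> real" where
  "excess V A = real (card (embs S P V A)) +
     \<kappa> * real (card V) ^ (card S - 2) * (real (turan_arcs r (card V)) - real (card (arcs V A))) -
     real (turan_embs S P r (card V))"

text \<open>Compared with the graph of the colouring, the host has \<open>g1\<close> arcs inside
  classes and lacks \<open>g2\<close> arcs, while \<open>g0\<close> arcs are common. The count rises
  by at least \<open>card P * w * (L * g2 - g1)\<close> on the way to that graph, and
  \<open>multipartite_le_turan\<close> leads from there to the Turan graph.\<close>

lemma excess_dense:
  fixes V :: "'b set"
  assumes V: "finite V" and n: "card V \<ge> 8 * card S ^ 2"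
    and sym: "\<And>x y. A x y \<longleftrightarrow> A y x" and irrA: "\<And>x. \<not> A x x"
    and free: "\<And>K. K \<subseteq> V \<Longrightarrow> card K = r + 1 \<Longrightarrow> \<exists>x\<in>K. \<exists>y\<in>K. x \<noteq> y \<and> \<not> A x y"
    and deg: "\<And>x. x \<in> V \<Longrightarrow> real (card {y\<in>V. \<not> A x y}) \<le> gap * real (card V)"
  shows "excess V A \<le> 0"
proof -
  define n where "n = card V"
  let ?d = "gap * real n"
  have "0 \<le> ?d" using gap(3) by simp
  then have "\<exists>c :: 'b \<Rightarrow> nat. (\<forall>x\<in>V. c x < r) \<and> (\<forall>i. real (card {x\<in>V. c x = i}) \<le> ?d) \<and>
    card (arcs V A) + card (arcs V (\<lambda>x y. A x y \<and> c x = c y)) \<le> card (arcs V (\<lambda>x y. c x \<noteq> c y))"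
    unfolding n_def by (intro fueredi_colouring V sym irrA free deg) auto
  then obtain c :: "'b \<Rightarrow> nat" where c0: "\<forall>x\<in>V. c x < r"
    and cls0: "\<forall>i. real (card {x\<in>V. c x = i}) \<le> ?d"
    and arcs: "card (arcs V A) + card (arcs V (\<lambda>x y. A x y \<and> c x = c y)) \<le> card (arcs V (\<lambda>x y. c x \<noteq> c y))"
    by (elim exE conjE)
  note c = c0[rule_format] and cls = cls0[rule_format]
  define g1 where "g1 = card (arcs V (\<lambda>x y. A x y \<and> c x = c y))"
  define g2 where "g2 = card (arcs V (\<lambda>x y. \<not> A x y \<and> c x \<noteq> c y))"
  define g0 where "g0 = card (arcs V (\<lambda>x y. A x y \<and> c x \<noteq> c y))"
  have "arcs V A = arcs V (\<lambda>x y. A x y \<and> c x = c y) \<union> arcs V (\<lambda>x y. A x y \<and> c x \<noteq> c y)"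
    by (auto simp: arcs_def)
  moreover have "arcs V (\<lambda>x y. A x y \<and> c x = c y) \<inter> arcs V (\<lambda>x y. A x y \<and> c x \<noteq> c y) = {}"
    by (auto simp: arcs_def)
  ultimately have a1: "card (arcs V A) = g1 + g0"
    using V by (simp add: card_Un_disjoint g1_def g0_def)
  have "arcs V (\<lambda>x y. c x \<noteq> c y) = arcs V (\<lambda>x y. \<not> A x y \<and> c x \<noteq> c y) \<union> arcs V (\<lambda>x y. A x y \<and> c x \<noteq> c y)"
    by (auto simp: arcs_def)
  moreover have "arcs V (\<lambda>x y. \<not> A x y \<and> c x \<noteq> c y) \<inter> arcs V (\<lambda>x y. A x y \<and> c x \<noteq> c y) = {}"
    by (auto simp: arcs_def)
  ultimately have a2: "card (arcs V (\<lambda>x y. c x \<noteq> c y)) = g2 + g0"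
    using V by (simp add: card_Un_disjoint g2_def g0_def)
  have g: "2 * real g1 \<le> real g2" using arcs a1 a2 unfolding g1_def[symmetric] by linarith
  define L where "L = 1 - (real (card P) * (2 * ?d) + real (card S) ^ 2) / real n"
  have L: "5 / 8 \<le> L" unfolding L_def n_def by (rule L_ge[OF n])
  define w where "w = real n ^ (card S - 2)"
  have w: "0 \<le> w" by (simp add: w_def)
  have gain: "real (card (embs S P V A)) + real (card P) * w * (L * real g2 - real g1)
      \<le> real (card (embs S P V (\<lambda>x y. c x \<noteq> c y)))"
    using colour_gain[OF V sym deg[folded n_def] cls] unfolding L_def w_def n_def g1_def g2_def by simp
  have "1 / 8 * real g2 \<le> L * real g2 - real g1"
    \<comment> \<open>The inequality \<open>2 * g1 \<le> g2\<close> of the colouring and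
      \<open>L \<ge> 5 / 8\<close> leave \<open>5 / 8 - 1 / 2\<close> of \<open>g2\<close>. The
      quantity \<open>g2 - g1\<close> below is the difference of the two arc numbers.\<close>
    using g L mult_right_mono[OF L, of "real g2"] by simp
  moreover have "\<kappa> * (real g2 - real g1) \<le> 1 / 8 * real g2"
    using \<kappa> g by (intro mult_mono) auto
  ultimately have x: "\<kappa> * (real g2 - real g1) \<le> L * real g2 - real g1" by linarith
  have "\<kappa> * (real g2 - real g1) \<ge> 0" using g \<kappa> by (intro mult_nonneg_nonneg) auto
  then have "1 * (L * real g2 - real g1) \<le> real (card P) * (L * real g2 - real g1)"
    using x P1 by (intro mult_right_mono) auto
  then have "w * (\<kappa> * (real g2 - real g1)) \<le> w * (real (card P) * (L * real g2 - real g1))"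
    using x w by (intro mult_left_mono) auto
  moreover have "real (card (embs S P V (\<lambda>x y. c x \<noteq> c y))) + \<kappa> * w * (real (turan_arcs r n) - (real g2 + real g0))
      \<le> real (turan_embs S P r n)"
    using multipartite_le_turan[OF V n_def[symmetric] n[folded n_def] c cls] unfolding a2 w_def by simp
  ultimately show ?thesis
    using gain unfolding excess_def a1 n_def[symmetric] w_def[symmetric] by (simp add: algebra_simps)
qed

text \<open>In units of \<open>n ^ (h - 1)\<close>, the host loses at most
  \<open>h - m * gap\<close> embeddings with \<open>v\<close>, whereas the Turan graph loses at
  least about \<open>h * (1 - m / r)\<close>. The latter is larger by \<open>m / r\<close>, which
  pays for the lower-order terms and for the change of the arc deficit.\<close>

lemma excess_remove:
  fixes V :: "'b set"
  assumes V: "finite V" and v: "v \<in> V" and n: "card V \<ge> 2 * r * card S * (card P + card S ^ 2)"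
    and sym: "\<And>x y. A x y \<longleftrightarrow> A y x" and irrA: "\<And>x. \<not> A x x"
    and deg: "gap * real (card V) < real (card {y\<in>V. \<not> A v y})"
  shows "excess V A \<le> excess (V - {v}) A - 1 / (4 * real r)"
proof -
  obtain n' where n': "card V = Suc n'" using V v by (metis card_Suc_Diff1)
  obtain k where k: "card S = k + 2" using S2 le_Suc_ex by (metis add.commute)
  define N where "N = real (card V)"
  have N: "N \<ge> 1" using n' by (simp add: N_def)
  have cV: "card (V - {v}) = n'" using V v n' by simp
  have rp: "real r > 0" using r_pos by simp
  define h where "h = real (card S)"
  define m where "m = real (card P)"
  have hm: "h \<ge> 2" "m \<ge> 1" using S2 P1 by (auto simp: h_def m_def)
  have "card {y\<in>V. A v y} + card {y\<in>V. \<not> A v y} = card ({y\<in>V. A v y} \<union> {y\<in>V. \<not> A v y})"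
    using V by (intro card_Un_disjoint[symmetric]) auto
  also have "{y\<in>V. A v y} \<union> {y\<in>V. \<not> A v y} = V" by auto
  finally have "real (card {y\<in>V. A v y}) \<le> N * (1 - gap)"
    using deg by (simp add: N_def algebra_simps flip: of_nat_add)
  then have rem: "real (card (embs S P V A)) \<le> real (card (embs S P (V - {v}) A)) + N ^ Suc k * (h - m * gap)"
    using card_embs_remove_le[OF V v sym irrA, of gap] gap k
    unfolding N_def h_def m_def by simp
  have tur: "real (turan_embs S P r n') + h * N ^ Suc k * (1 - (m * (N / real r + 1) + h ^ 2) / N)
      \<le> real (turan_embs S P r (card V))"
    using turan_embs_Suc_ge[OF r_pos n'] k unfolding N_def h_def m_def by simp
  define Y where "Y = real (turan_arcs r n') - real (card (arcs (V - {v}) A))"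
  have "turan_arcs r n' \<le> n' ^ 2"
    unfolding turan_arcs_def using card_arcs_le[of "{..<n'}"] by simp
  then have "real (turan_arcs r n') \<le> real n' ^ 2" by (simp flip: of_nat_power)
  also have "\<dots> \<le> N ^ 2" using n' by (intro power_mono) (auto simp: N_def)
  finally have Y: "Y \<le> N ^ 2" by (simp add: Y_def)
  have "real (turan_arcs r (card V)) \<le> real (turan_arcs r n') + 2 * N"
    using of_nat_mono[OF turan_arcs_Suc_le[of r n'], where 'a = real] n' by (simp add: N_def)
  moreover have "card (arcs (V - {v}) A) \<le> card (arcs V A)"
    using V by (intro card_mono) (auto simp: arcs_def intro: finite_subset[of _ "V \<times> V"])
  ultimately have "real (turan_arcs r (card V)) - real (card (arcs V A)) \<le> Y + 2 * N"
    unfolding Y_def by linarith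
  then have "N ^ k * (real (turan_arcs r (card V)) - real (card (arcs V A))) \<le> N ^ k * (Y + 2 * N)"
    using N by (intro mult_left_mono) auto
  also have "\<dots> = N ^ k * Y + 2 * N ^ Suc k" by (simp add: algebra_simps)
  \<comment> \<open>The weight changes from \<open>N ^ k\<close> to \<open>(N - 1) ^ k\<close> as
    well. For \<open>Y \<le> 0\<close> this change is favourable; for positive \<open>Y\<close>,
    Bernoulli's inequality and \<open>Y \<le> N ^ 2\<close> bound it. Together with the term
    \<open>2 * N\<close> the total is \<open>k + 2 = h\<close> times
    \<open>N ^ (h - 1)\<close>.\<close>
  also have "N ^ k * Y \<le> (N - 1) ^ k * Y + real k * N ^ Suc k"
  proof (cases "Y \<le> 0")
    case True
    have "(N - 1) ^ k \<le> N ^ k" using N by (intro power_mono) auto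
    then have "N ^ k * Y \<le> (N - 1) ^ k * Y" using True by (intro mult_right_mono_neg) auto
    moreover have "0 \<le> real k * N ^ Suc k" using N by simp
    ultimately show ?thesis by linarith
  next
    case False
    have "N * (N ^ k - (N - 1) ^ k) \<le> real k * N ^ k"
    proof -
      have "1 + real k * (- 1 / N) \<le> (1 + - 1 / N) ^ k"
        using N by (intro Bernoulli_inequality) (simp add: field_simps)
      then have "N ^ k * (1 - real k / N) \<le> N ^ k * (1 - 1 / N) ^ k"
        using N by (intro mult_left_mono) auto
      also have "\<dots> = (N - 1) ^ k" using N by (simp add: field_simps flip: power_mult_distrib)
      finally show ?thesis using N by (simp add: field_simps)
    qed
    then have "N * (N ^ k - (N - 1) ^ k) * N \<le> real k * N ^ k * N"
      using N by (intro mult_right_mono) auto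
    moreover have "(N ^ k - (N - 1) ^ k) * Y \<le> (N ^ k - (N - 1) ^ k) * N ^ 2"
      using Y N by (intro mult_left_mono) (auto intro!: power_mono)
    ultimately show ?thesis by (simp add: power2_eq_square algebra_simps)
  qed
  finally have "N ^ k * (real (turan_arcs r (card V)) - real (card (arcs V A)))
      \<le> (N - 1) ^ k * Y + h * N ^ Suc k"
    by (simp add: h_def k algebra_simps)
  then have "\<kappa> * (N ^ k * (real (turan_arcs r (card V)) - real (card (arcs V A))))
      \<le> \<kappa> * ((N - 1) ^ k * Y + h * N ^ Suc k)"
    using \<kappa>(1) by (intro mult_left_mono) auto
  also have "\<dots> = \<kappa> * (N - 1) ^ k * Y + N ^ Suc k * (1 / (4 * real r))"
    using hm rp by (simp add: \<kappa>_def h_def[symmetric] field_simps)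
  finally have pot: "\<kappa> * N ^ k * (real (turan_arcs r (card V)) - real (card (arcs V A)))
      \<le> \<kappa> * (N - 1) ^ k * Y + N ^ Suc k * (1 / (4 * real r))" by (simp add: mult.assoc)
  have e1: "excess V A = real (card (embs S P V A)) +
      \<kappa> * N ^ k * (real (turan_arcs r (card V)) - real (card (arcs V A))) - real (turan_embs S P r (card V))"
    by (simp add: excess_def N_def k)
  have e2: "excess (V - {v}) A = real (card (embs S P (V - {v}) A)) + \<kappa> * (N - 1) ^ k * Y -
      real (turan_embs S P r n')"
    by (simp add: excess_def cV k Y_def N_def n')
  have "excess V A - excess (V - {v}) A \<le> N ^ Suc k * (h - m * gap)
      - h * N ^ Suc k * (1 - (m * (N / real r + 1) + h ^ 2) / N) + N ^ Suc k * (1 / (4 * real r))"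
    using rem tur pot unfolding e1 e2 by linarith
  also have "\<dots> = N ^ Suc k * (h * (m * (N / real r + 1) + h ^ 2) / N - m * gap + 1 / (4 * real r))"
    by (simp add: algebra_simps)
  \<comment> \<open>Here the \<open>+ 1\<close> in \<open>gap\<close> takes effect:
    \<open>h * m / r\<close> cancels and \<open>- m / r\<close> is left.\<close>
  also have "h * (m * (N / real r + 1) + h ^ 2) / N - m * gap = h * (m + h ^ 2) / N - m / real r"
    using N rp by (simp add: gap_def h_def[symmetric] field_simps)
  also have "N ^ Suc k * (h * (m + h ^ 2) / N - m / real r + 1 / (4 * real r)) \<le> N ^ Suc k * (- 1 / (4 * real r))"
  proof (intro mult_left_mono)
    \<comment> \<open>Of the gain \<open>1 / r\<close>, one half covers the lower-order terms, a
      quarter the arc deficit, and a quarter remains.\<close>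
    have "real (2 * r * card S * (card P + card S ^ 2)) \<le> N"
      unfolding N_def using n by (rule of_nat_mono)
    then have "2 * real r * (h * (m + h ^ 2)) \<le> N" by (simp add: h_def m_def mult.assoc)
    then have "h * (m + h ^ 2) / N \<le> 1 / (2 * real r)" using N rp by (simp add: field_simps)
    moreover have "1 / real r \<le> m / real r" using hm rp by (simp add: divide_right_mono)
    moreover have "1 / (2 * real r) - 1 / real r + 1 / (4 * real r) = - 1 / (4 * real r)"
      using rp by (simp add: field_simps)
    ultimately show "h * (m + h ^ 2) / N - m / real r + 1 / (4 * real r) \<le> - 1 / (4 * real r)" by linarith
  qed (use N in simp)
  also have "\<dots> \<le> 1 * (- 1 / (4 * real r))"
    using N rp by (intro mult_right_mono_neg one_le_power) auto
  finally show ?thesis by simp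
qed

text \<open>Deletions stop either at a host covered by \<open>excess_dense\<close> or at
  \<open>n1\<close> vertices, where only the trivial bound \<open>M\<close> is known but
  \<open>k\<close> deletions have been made. The bound \<open>max 0 (M - \<delta> * real k)\<close>
  covers both ends of the process.\<close>

lemma eventually_excess_nonpos:
  "\<exists>n0. \<forall>(V :: 'b set) A. finite V \<longrightarrow> card V \<ge> n0 \<longrightarrow> (\<forall>x y. A x y \<longleftrightarrow> A y x) \<longrightarrow> (\<forall>x. \<not> A x x) \<longrightarrow>
    (\<forall>K. K \<subseteq> V \<longrightarrow> card K = r + 1 \<longrightarrow> (\<exists>x\<in>K. \<exists>y\<in>K. x \<noteq> y \<and> \<not> A x y)) \<longrightarrow> excess V A \<le> 0"
proof -
  \<comment> \<open>The two summands of \<open>n1\<close> serve the dense case and the deletion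
    step. \<open>M\<close> admits all maps on \<open>n1\<close> vertices as embeddings and all
    ordered pairs as missing arcs.\<close>
  define n1 where "n1 = 8 * card S ^ 2 + 2 * r * card S * (card P + card S ^ 2)"
  define M where "M = real n1 ^ card S + \<kappa> * real n1 ^ (card S - 2) * real n1 ^ 2"
  define \<delta> where "\<delta> = 1 / (4 * real r)"
  have \<delta>: "\<delta> > 0" using r_pos by (simp add: \<delta>_def)
  have step: "excess V A \<le> max 0 (M - \<delta> * real k)"
    if "finite V" "card V = n1 + k" "\<And>x y. A x y \<longleftrightarrow> A y x" "\<And>x. \<not> A x x"
      "\<And>K. K \<subseteq> V \<Longrightarrow> card K = r + 1 \<Longrightarrow> \<exists>x\<in>K. \<exists>y\<in>K. x \<noteq> y \<and> \<not> A x y"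
    for V :: "'b set" and A k
    using that
  proof (induction k arbitrary: V)
    case 0
    have n1: "card V = n1" using 0 by simp
    have "card (embs S P V A) \<le> n1 ^ card S" using card_embs_le_power[OF 0(1), of A] n1 by simp
    then have "real (card (embs S P V A)) \<le> real n1 ^ card S" by (simp flip: of_nat_power)
    moreover have "turan_arcs r n1 \<le> n1 ^ 2"
      unfolding turan_arcs_def using card_arcs_le[of "{..<n1}"] by simp
    then have "real (turan_arcs r n1) \<le> real n1 ^ 2" by (simp flip: of_nat_power)
    then have "real (turan_arcs r n1) - real (card (arcs V A)) \<le> real n1 ^ 2" by linarith
    then have "\<kappa> * real n1 ^ (card S - 2) * (real (turan_arcs r n1) - real (card (arcs V A)))
        \<le> \<kappa> * real n1 ^ (card S - 2) * real n1 ^ 2"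
      by (rule mult_left_mono) (use \<kappa>(1) in auto)
    ultimately have "excess V A \<le> M" unfolding excess_def n1 M_def by linarith
    then show ?case by simp
  next
    case (Suc k)
    show ?case
    proof (cases "\<forall>x\<in>V. real (card {y\<in>V. \<not> A x y}) \<le> gap * real (card V)")
      case True
      have "excess V A \<le> 0"
        using Suc.prems True by (intro excess_dense) (auto simp: n1_def)
      then show ?thesis by simp
    next
      case False
      then obtain v where v: "v \<in> V" "gap * real (card V) < real (card {y\<in>V. \<not> A v y})" by force
      have "excess V A \<le> excess (V - {v}) A - \<delta>"
        unfolding \<delta>_def using Suc.prems v by (intro excess_remove) (auto simp: n1_def)
      moreover have "excess (V - {v}) A \<le> max 0 (M - \<delta> * real k)"
      proof (rule Suc.IH)
        show "\<exists>x\<in>K. \<exists>y\<in>K. x \<noteq> y \<and> \<not> A x y" if "K \<subseteq> V - {v}" "card K = r + 1" for K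
          using that by (intro Suc.prems(5)) auto
      qed (use Suc.prems v in auto)
      ultimately show ?thesis using \<delta> by (simp add: algebra_simps max_def split: if_splits)
    qed
  qed
  define k0 where "k0 = nat \<lceil>M / \<delta>\<rceil>"
  show ?thesis
  proof (rule exI[of _ "n1 + k0"], intro allI impI)
    fix V :: "'b set" and A
    assume V: "finite V" "card V \<ge> n1 + k0" "\<forall>x y. A x y \<longleftrightarrow> A y x" "\<forall>x. \<not> A x x"
      "\<forall>K. K \<subseteq> V \<longrightarrow> card K = r + 1 \<longrightarrow> (\<exists>x\<in>K. \<exists>y\<in>K. x \<noteq> y \<and> \<not> A x y)"
    define k where "k = card V - n1"
    have "M / \<delta> \<le> real k" using V(2) unfolding k_def k0_def by linarith
    then have "M - \<delta> * real k \<le> 0" using \<delta> by (simp add: field_simps)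
    moreover have "excess V A \<le> max 0 (M - \<delta> * real k)"
      using V by (intro step) (auto simp: k_def)
    ultimately show "excess V A \<le> 0" by simp
  qed
qed

end

section \<open>Copies and homomorphisms\<close>

text \<open>An injective numbering of the vertices directs every edge from its smaller to its larger
  end.\<close>

lemma sgraph_orientation:
  assumes "sgraph H"
  shows "\<exists>P. pattern (verts H) P \<and> edges H = (\<lambda>(k, l). {k, l}) ` P"
proof -
  have fin: "finite (verts H)" and e: "\<And>e. e \<in> edges H \<Longrightarrow> e \<subseteq> verts H \<and> card e = 2"
    using assms by (auto simp: sgraph_def)
  obtain f :: "'a \<Rightarrow> nat" where f: "inj_on f (verts H)"
    using fin finite_imp_inj_to_nat_seg by blast
  define P where "P = {(k, l). k \<in> verts H \<and> l \<in> verts H \<and> {k, l} \<in> edges H \<and> f k < f l}"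
  have "edges H = (\<lambda>(k, l). {k, l}) ` P"
  proof (intro set_eqI iffI)
    fix s assume s: "s \<in> edges H"
    then obtain k l where kl: "s = {k, l}" "k \<noteq> l" using e by (meson card_2_iff)
    then have kl': "k \<in> verts H" "l \<in> verts H" using e[OF s] by auto
    then have "f k \<noteq> f l" using f kl(2) by (auto simp: inj_on_def)
    then have "f k < f l \<or> f l < f k" by linarith
    then have "(k, l) \<in> P \<or> (l, k) \<in> P"
      using kl kl' s by (auto simp: P_def insert_commute)
    then show "s \<in> (\<lambda>(k, l). {k, l}) ` P" using kl(1) by (auto simp: image_iff insert_commute)
  qed (auto simp: P_def)
  moreover have "pattern (verts H) P" using fin by unfold_locales (auto simp: P_def)
  ultimately show ?thesis by blast
qed

text \<open>Maps are extensional, so that each isomorphism is a single element.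
  \<open>isos H H\<close> is the automorphism group, whose order relates embeddings to
  copies.\<close>

definition isos :: "'a ugraph \<Rightarrow> 'b ugraph \<Rightarrow> ('a \<Rightarrow> 'b) set" where
  "isos H F = {f \<in> verts H \<rightarrow>\<^sub>E verts F. bij_betw f (verts H) (verts F) \<and> edges F = (\<lambda>e. f ` e) ` edges H}"

lemma finite_isos: "finite (verts H) \<Longrightarrow> finite (verts F) \<Longrightarrow> finite (isos H F)"
  unfolding isos_def by (rule finite_subset[of _ "verts H \<rightarrow>\<^sub>E verts F"]) (auto intro!: finite_PiE)

lemma card_isos_le:
  assumes H: "sgraph H" and F': "finite (verts F')"
    and g: "bij_betw g (verts F) (verts F')" "edges F' = (\<lambda>e. g ` e) ` edges F"
  shows "card (isos H F) \<le> card (isos H F')"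
proof (rule card_inj_on_le[where f = "\<lambda>f. restrict (g \<circ> f) (verts H)"])
  have e: "\<And>e. e \<in> edges H \<Longrightarrow> e \<subseteq> verts H" and fin: "finite (verts H)"
    using H by (auto simp: sgraph_def)
  show "inj_on (\<lambda>f. restrict (g \<circ> f) (verts H)) (isos H F)"
  proof (rule inj_onI)
    fix f f' assume f: "f \<in> isos H F" "f' \<in> isos H F"
      and eq: "restrict (g \<circ> f) (verts H) = restrict (g \<circ> f') (verts H)"
    have ff: "f \<in> verts H \<rightarrow>\<^sub>E verts F" "f' \<in> verts H \<rightarrow>\<^sub>E verts F" using f by (auto simp: isos_def)
    show "f = f'"
    proof (rule PiE_ext[OF ff])
      fix x assume x: "x \<in> verts H"
      then have "g (f x) = g (f' x)" using fun_cong[OF eq, of x] by simp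
      then show "f x = f' x" using g(1) ff x by (auto simp: bij_betw_def inj_on_def)
    qed
  qed
  show "(\<lambda>f. restrict (g \<circ> f) (verts H)) ` isos H F \<subseteq> isos H F'"
  proof clarify
    fix f assume f: "f \<in> isos H F"
    then have b: "bij_betw f (verts H) (verts F)" and ef: "edges F = (\<lambda>e. f ` e) ` edges H"
      by (auto simp: isos_def)
    have "bij_betw (g \<circ> f) (verts H) (verts F')" by (rule bij_betw_trans[OF b g(1)])
    then have b': "bij_betw (restrict (g \<circ> f) (verts H)) (verts H) (verts F')"
      by (subst bij_betw_cong[where g = "g \<circ> f"]) auto
    have R: "restrict (g \<circ> f) (verts H) ` s = g ` f ` s" if "s \<in> edges H" for s
      using e[OF that] by (auto simp: image_iff subset_iff)
    have "edges F' = (\<lambda>e. g ` f ` e) ` edges H" unfolding g(2) ef by (rule image_image)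
    also have "\<dots> = (\<lambda>e. restrict (g \<circ> f) (verts H) ` e) ` edges H"
      by (rule image_cong[OF refl]) (erule R[symmetric])
    finally have "edges F' = (\<lambda>e. restrict (g \<circ> f) (verts H) ` e) ` edges H" .
    moreover have "restrict (g \<circ> f) (verts H) \<in> verts H \<rightarrow>\<^sub>E verts F'"
      using b' by (auto simp: bij_betw_def)
    ultimately show "restrict (g \<circ> f) (verts H) \<in> isos H F'" using b' by (simp add: isos_def)
  qed
  show "finite (isos H F')" using fin F' by (rule finite_isos)
qed

lemma card_isos_eq:
  assumes H: "sgraph H" and F: "sgraph F" and iso: "isomorphic H F"
  shows "card (isos H F) = card (isos H H)"
proof (rule antisym)
  have fin: "finite (verts H)" "finite (verts F)" using H F by (auto simp: sgraph_def)
  obtain g where g: "bij_betw g (verts H) (verts F)" "edges F = (\<lambda>e. g ` e) ` edges H"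
    using iso by (auto simp: isomorphic_def)
  show "card (isos H H) \<le> card (isos H F)" using H fin(2) g by (rule card_isos_le)
  have inv: "bij_betw (inv_into (verts H) g) (verts F) (verts H)" by (rule bij_betw_inv_into[OF g(1)])
  have "inv_into (verts H) g ` g ` e = e" if "e \<in> edges H" for e
  proof -
    have "e \<subseteq> verts H" using that H by (auto simp: sgraph_def)
    then show ?thesis using g(1) by (auto simp: bij_betw_def image_iff subset_iff inv_into_f_f)
  qed
  then have "edges H = (\<lambda>e. inv_into (verts H) g ` e) ` edges F"
    unfolding g(2) image_image by simp
  then show "card (isos H F) \<le> card (isos H H)" using H fin(1) inv by (intro card_isos_le)
qed

abbreviation adj :: "'b ugraph \<Rightarrow> 'b \<Rightarrow> 'b \<Rightarrow> bool" where
  "adj G x y \<equiv> {x, y} \<in> edges G"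

text \<open>Each embedding has an image subgraph, and every copy arises as such an image. The fibre
  over a copy \<open>F\<close> is \<open>isos H F\<close>, which has as many elements as the
  automorphism group of \<open>H\<close>.\<close>

lemma card_embs_eq_copies:
  assumes H: "sgraph H" and G: "sgraph G" and P: "edges H = (\<lambda>(k, l). {k, l}) ` P" "P \<subseteq> verts H \<times> verts H"
  shows "card (embs (verts H) P (verts G) (adj G)) = copies H G * card (isos H H)"
proof -
  have fin: "finite (verts H)" "finite (verts G)" using H G by (auto simp: sgraph_def)
  let ?E = "embs (verts H) P (verts G) (adj G)"
  let ?C = "{F. subgraph F G \<and> isomorphic H F}"
  define Im :: "('a \<Rightarrow> 'b) \<Rightarrow> 'b ugraph" where
    "Im f = \<lparr>verts = f ` verts H, edges = (\<lambda>e. f ` e) ` edges H\<rparr>" for f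
  have He: "\<And>e. e \<in> edges H \<Longrightarrow> e \<subseteq> verts H \<and> card e = 2" using H by (auto simp: sgraph_def)
  have fibre: "{f \<in> ?E. Im f = F} = isos H F" if F: "F \<in> ?C" for F
  proof (intro set_eqI iffI)
    fix f assume "f \<in> {f \<in> ?E. Im f = F}"
    then have f: "f \<in> ?E" "Im f = F" by auto
    then have inj: "inj_on f (verts H)" and ext: "f \<in> verts H \<rightarrow>\<^sub>E verts G" by (auto simp: embs_def)
    have F': "verts F = f ` verts H" "edges F = (\<lambda>e. f ` e) ` edges H"
      using f(2) by (auto simp: Im_def)
    have "f \<in> verts H \<rightarrow>\<^sub>E verts F" using ext F' by (auto simp: PiE_def Pi_def)
    then show "f \<in> isos H F" using inj F' by (simp add: isos_def bij_betw_def)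
  next
    fix f assume f: "f \<in> isos H F"
    have sub: "verts F \<subseteq> verts G" "edges F \<subseteq> edges G" using F by (auto simp: subgraph_def)
    have F': "verts F = f ` verts H" "edges F = (\<lambda>e. f ` e) ` edges H" "inj_on f (verts H)"
      "f \<in> verts H \<rightarrow>\<^sub>E verts F"
      using f by (auto simp: isos_def bij_betw_def)
    have "{f k, f l} \<in> edges G" if "(k, l) \<in> P" for k l
    proof -
      have "{k, l} \<in> edges H" using that P by auto
      then have "f ` {k, l} \<in> edges F" unfolding F'(2) by (rule imageI)
      then show ?thesis using sub by auto
    qed
    moreover have "f \<in> verts H \<rightarrow>\<^sub>E verts G" using F'(4) sub by (auto simp: PiE_def Pi_def)
    ultimately have "f \<in> ?E" using F'(3) by (auto simp: embs_def)
    moreover have "Im f = F" using F' by (simp add: Im_def)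
    ultimately show "f \<in> {f \<in> ?E. Im f = F}" by simp
  qed
  have ImE: "Im ` ?E = ?C"
  proof (intro set_eqI iffI)
    fix F assume "F \<in> Im ` ?E"
    then obtain f where f: "f \<in> ?E" "F = Im f" by auto
    have inj: "inj_on f (verts H)" and fV: "f ` verts H \<subseteq> verts G"
      and fP: "\<And>k l. (k, l) \<in> P \<Longrightarrow> {f k, f l} \<in> edges G" using f(1) by (auto simp: embs_def)
    have "sgraph F"
      unfolding sgraph_def
    proof (intro conjI ballI)
      fix s assume "s \<in> edges F"
      then obtain e where e: "e \<in> edges H" "s = f ` e" by (auto simp: f(2) Im_def)
      then show "s \<subseteq> verts F" using He by (auto simp: f(2) Im_def)
      have "inj_on f e" using inj He[OF e(1)] inj_on_subset by blast
      then show "card s = 2" using e He by (simp add: card_image)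
    qed (simp add: f(2) Im_def fin)
    moreover have "edges F \<subseteq> edges G" using fP P by (auto simp: f(2) Im_def)
    ultimately have "subgraph F G" using fV by (simp add: subgraph_def f(2) Im_def)
    moreover have "isomorphic H F"
      unfolding isomorphic_def using inj by (intro exI[of _ f]) (simp add: f(2) Im_def bij_betw_def)
    ultimately show "F \<in> ?C" by simp
  next
    fix F assume F: "F \<in> ?C"
    then obtain g where g: "bij_betw g (verts H) (verts F)" "edges F = (\<lambda>e. g ` e) ` edges H"
      by (auto simp: isomorphic_def)
    have R: "restrict g (verts H) ` e = g ` e" if "e \<in> edges H" for e
      using He[OF that] by (auto simp: image_iff subset_iff)
    have "edges F = (\<lambda>e. restrict g (verts H) ` e) ` edges H"
      unfolding g(2) by (rule image_cong[OF refl]) (erule R[symmetric])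
    moreover have "bij_betw (restrict g (verts H)) (verts H) (verts F)"
      using g(1) by (subst bij_betw_cong[where g = g]) auto
    ultimately have "restrict g (verts H) \<in> isos H F" by (auto simp: isos_def bij_betw_def)
    then have "restrict g (verts H) \<in> {f \<in> ?E. Im f = F}" unfolding fibre[OF F] .
    then show "F \<in> Im ` ?E" by (auto intro: rev_image_eqI)
  qed
  have "card ?E = (\<Sum>f\<in>?E. 1)" by simp
  also have "\<dots> = (\<Sum>F\<in>Im ` ?E. \<Sum>f\<in>{f \<in> ?E. Im f = F}. 1)"
    using fin by (intro sum.image_gen) simp
  also have "\<dots> = (\<Sum>F\<in>?C. card (isos H F))"
    unfolding ImE using fibre by (intro sum.cong) simp_all
  also have "\<dots> = (\<Sum>F\<in>?C. card (isos H H))"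
    using H by (intro sum.cong card_isos_eq) (auto simp: subgraph_def)
  finally show ?thesis by (simp add: copies_def)
qed

lemma card_isos_pos:
  assumes "sgraph H"
  shows "card (isos H H) > 0"
proof -
  have fin: "finite (verts H)" and e: "\<And>e. e \<in> edges H \<Longrightarrow> e \<subseteq> verts H" using assms by (auto simp: sgraph_def)
  have "bij_betw (restrict id (verts H)) (verts H) (verts H)"
    by (subst bij_betw_cong[where g = id]) auto
  moreover have "(\<lambda>e. restrict id (verts H) ` e) ` edges H = (\<lambda>e. e) ` edges H"
    using e by (intro image_cong) (auto simp: image_iff subset_iff)
  ultimately have "restrict id (verts H) \<in> isos H H" by (auto simp: isos_def)
  then show ?thesis using finite_isos[OF fin fin] card_gt_0_iff by blast
qed

section \<open>Clique-free hosts and the Turan graph\<close>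

lemma adj_irrefl: "sgraph G \<Longrightarrow> \<not> adj G x x"
  by (force simp: sgraph_def)

lemma free_of_complete_nonadjacent:
  assumes free: "free_of (complete_graph k) G" and K: "K \<subseteq> verts G" "card K = k" and fin: "finite (verts G)"
  shows "\<exists>x\<in>K. \<exists>y\<in>K. x \<noteq> y \<and> \<not> adj G x y"
proof (rule ccontr)
  assume "\<not> ?thesis"
  then have cl: "adj G x y" if "x \<in> K" "y \<in> K" "x \<noteq> y" for x y using that by blast
  define F where "F = \<lparr>verts = K, edges = {e. e \<subseteq> K \<and> card e = 2}\<rparr>"
  have finK: "finite K" using K fin finite_subset by blast
  obtain g where g: "bij_betw g {..<k} K"
    using ex_bij_betw_nat_finite[OF finK] K(2) by (auto simp: atLeast0LessThan)
  have "edges F \<subseteq> edges G"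
  proof
    fix e assume "e \<in> edges F"
    then have e: "e \<subseteq> K" "card e = 2" by (auto simp: F_def)
    then obtain x y where "e = {x, y}" "x \<noteq> y" by (meson card_2_iff)
    then show "e \<in> edges G" using e cl by auto
  qed
  then have "subgraph F G" using K finK by (auto simp: subgraph_def sgraph_def F_def)
  moreover have "isomorphic (complete_graph k) F"
    unfolding isomorphic_def
  proof (intro exI conjI)
    show "bij_betw g (verts (complete_graph k)) (verts F)" using g by (simp add: complete_graph_def F_def)
    have "{e. e \<subseteq> K \<and> card e = 2} = (\<lambda>e. g ` e) ` {e. e \<subseteq> {..<k} \<and> card e = 2}"
    proof (intro set_eqI iffI)
      fix e assume "e \<in> {e. e \<subseteq> K \<and> card e = 2}"
      then obtain s where s: "s \<subseteq> {..<k}" "e = g ` s" "card e = 2"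
        using g by (auto simp: bij_betw_def subset_image_iff)
      then have "card s = 2" using g card_image[of g s] by (metis bij_betw_def inj_on_subset)
      then show "e \<in> (\<lambda>e. g ` e) ` {e. e \<subseteq> {..<k} \<and> card e = 2}" using s by blast
    next
      fix e assume "e \<in> (\<lambda>e. g ` e) ` {e. e \<subseteq> {..<k} \<and> card e = 2}"
      then obtain s where s: "s \<subseteq> {..<k}" "card s = 2" "e = g ` s" by auto
      then have "card e = 2" using g card_image[of g s] by (metis bij_betw_def inj_on_subset)
      then show "e \<in> {e. e \<subseteq> K \<and> card e = 2}" using s g by (auto simp: bij_betw_def)
    qed
    then show "edges F = (\<lambda>e. g ` e) ` edges (complete_graph k)" by (simp add: complete_graph_def F_def)
  qed
  ultimately show False using free by (auto simp: free_of_def)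
qed

lemma adj_turan: "adj (turan_graph r n) x y \<longleftrightarrow> x < n \<and> y < n \<and> x mod r \<noteq> y mod r"
  by (auto simp: turan_graph_def doubleton_eq_iff)

lemma sgraph_turan: "sgraph (turan_graph r n)"
  by (auto simp: sgraph_def turan_graph_def card_2_iff)

text \<open>By pigeonhole two of \<open>r + 1\<close> clique vertices would share a residue modulo
  \<open>r\<close>, but such vertices are not adjacent.\<close>

lemma turan_host:
  assumes "r > 0"
  shows "turan_graph r n \<in> host_graphs n (complete_graph (r + 1))"
proof -
  have "free_of (complete_graph (r + 1)) (turan_graph r n)"
    unfolding free_of_def
  proof
    assume "\<exists>F. subgraph F (turan_graph r n) \<and> isomorphic (complete_graph (r + 1)) F"
    then obtain F g where F: "subgraph F (turan_graph r n)"
      and g: "bij_betw g {..<r + 1} (verts F)" "edges F = (\<lambda>e. g ` e) ` edges (complete_graph (r + 1))"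
      by (auto simp: isomorphic_def complete_graph_def)
    have "(\<lambda>k. g k mod r) ` {..<r + 1} \<subseteq> {..<r}" using assms by auto
    then have "card ((\<lambda>k. g k mod r) ` {..<r + 1}) \<le> card {..<r}" by (intro card_mono) auto
    then have "\<not> inj_on (\<lambda>k. g k mod r) {..<r + 1}" by (intro pigeonhole) simp
    then obtain k l where kl: "k < r + 1" "l < r + 1" "k \<noteq> l" "g k mod r = g l mod r"
      by (auto simp: inj_on_def)
    then have "{k, l} \<in> edges (complete_graph (r + 1))" by (simp add: complete_graph_def)
    then have "g ` {k, l} \<in> edges F" unfolding g(2) by (rule imageI)
    then have "adj (turan_graph r n) (g k) (g l)" using F by (auto simp: subgraph_def)
    then show False using kl by (simp add: adj_turan)
  qed
  then show ?thesis using sgraph_turan by (simp add: host_graphs_def turan_graph_def)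
qed

lemma card_embs_turan:
  assumes "P \<subseteq> S \<times> S"
  shows "card (embs S P {..<n} (adj (turan_graph r n))) = turan_embs S P r n"
proof -
  have "embs S P {..<n} (adj (turan_graph r n)) = embs S P {..<n} (\<lambda>x y. x mod r \<noteq> y mod r)"
    unfolding adj_turan using assms by (fastforce simp: embs_def)
  then show ?thesis by (simp add: turan_embs_def)
qed

section \<open>Stability of Turan's theorem\<close>

lemma card_arcs_multipartite_le:
  fixes c :: "'b \<Rightarrow> nat"
  assumes V: "finite V" "card V = n" and r: "r > 0" and c: "\<And>x. x \<in> V \<Longrightarrow> c x < r"
  shows "card (arcs V (\<lambda>x y. c x \<noteq> c y)) \<le> turan_arcs r n"
proof (rule balance_induct[where V = V and r = r and t = "\<lambda>i. card {x. x < n \<and> x mod r = i}" and c = c])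
  show "finite V" by (rule V)
  show "(\<Sum>i<r. card {x. x < n \<and> x mod r = i}) = card V" using turan_classes_sum[OF r] V by simp
  show "c x < r" if "x \<in> V" for x using c that .
  show "card {x. x < n \<and> x mod r = i} \<le> card {x. x < n \<and> x mod r = j} + 1" if "i < r" "j < r" for i j
    using turan_classes_balanced that .
next
  fix c :: "'b \<Rightarrow> nat"
  assume "\<And>x. x \<in> V \<Longrightarrow> c x < r" "\<And>i. i < r \<Longrightarrow> card {x\<in>V. c x = i} = card {x. x < n \<and> x mod r = i}"
  then show "card (arcs V (\<lambda>x y. c x \<noteq> c y)) \<le> turan_arcs r n"
    using card_arcs_balanced[OF V r] by simp
next
  fix c :: "'b \<Rightarrow> nat" and v j
  assume move: "\<And>x. x \<in> V \<Longrightarrow> c x < r" "v \<in> V" "j < r" "j \<noteq> c v"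
    "card {x\<in>V. c x = j} < card {x\<in>V. c x = c v}"
    "card (arcs V (\<lambda>x y. (c(v := j)) x \<noteq> (c(v := j)) y)) \<le> turan_arcs r n"
  then show "card (arcs V (\<lambda>x y. c x \<noteq> c y)) \<le> turan_arcs r n"
    using card_arcs_move[where c = c, OF V(1) move(1-5)] by simp
qed

text \<open>Every balancing move recolours one vertex and lowers the surplus by exactly one, so the
  initial surplus bounds the number of recoloured vertices.\<close>

lemma balanced_recolouring:
  fixes c :: "'b \<Rightarrow> nat" and t :: "nat \<Rightarrow> nat"
  assumes V: "finite V" and c: "\<And>x. x \<in> V \<Longrightarrow> c x < r"
    and t: "(\<Sum>i<r. t i) = card V" "\<And>i j. i < r \<Longrightarrow> j < r \<Longrightarrow> t i \<le> t j + 1"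
  shows "\<exists>c'. (\<forall>x\<in>V. c' x < r) \<and> (\<forall>i<r. card {x\<in>V. c' x = i} = t i) \<and>
    card {x\<in>V. c' x \<noteq> c x} \<le> (\<Sum>i<r. card {x\<in>V. c x = i} - t i)"
proof (rule balance_induct[where V = V and r = r and t = t and c = c])
  show "finite V" "(\<Sum>i<r. t i) = card V" by (rule V t)+
  show "c x < r" if "x \<in> V" for x using c that .
  show "t i \<le> t j + 1" if "i < r" "j < r" for i j using t(2) that .
next
  fix c :: "'b \<Rightarrow> nat"
  assume "\<And>x. x \<in> V \<Longrightarrow> c x < r" "\<And>i. i < r \<Longrightarrow> card {x\<in>V. c x = i} = t i"
  then show "\<exists>c'. (\<forall>x\<in>V. c' x < r) \<and> (\<forall>i<r. card {x\<in>V. c' x = i} = t i) \<and>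
    card {x\<in>V. c' x \<noteq> c x} \<le> (\<Sum>i<r. card {x\<in>V. c x = i} - t i)"
    by (intro exI[of _ c]) simp
next
  fix c :: "'b \<Rightarrow> nat" and v j
  assume v: "v \<in> V"
    and S: "(\<Sum>i<r. card {x\<in>V. c x = i} - t i) = Suc (\<Sum>i<r. card {x\<in>V. (c(v := j)) x = i} - t i)"
    and "\<exists>c'. (\<forall>x\<in>V. c' x < r) \<and> (\<forall>i<r. card {x\<in>V. c' x = i} = t i) \<and>
      card {x\<in>V. c' x \<noteq> (c(v := j)) x} \<le> (\<Sum>i<r. card {x\<in>V. (c(v := j)) x = i} - t i)"
  then obtain c' where c': "\<forall>x\<in>V. c' x < r" "\<forall>i<r. card {x\<in>V. c' x = i} = t i"
    "card {x\<in>V. c' x \<noteq> (c(v := j)) x} \<le> (\<Sum>i<r. card {x\<in>V. (c(v := j)) x = i} - t i)"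
    by (elim exE conjE)
  have "card {x\<in>V. c' x \<noteq> c x} \<le> card (insert v {x\<in>V. c' x \<noteq> (c(v := j)) x})"
    using V by (intro card_mono) auto
  also have "\<dots> \<le> Suc (card {x\<in>V. c' x \<noteq> (c(v := j)) x})" by (rule card_insert_le_m1) simp_all
  also have "\<dots> \<le> (\<Sum>i<r. card {x\<in>V. c x = i} - t i)" unfolding S using c'(3) by simp
  finally show "\<exists>c'. (\<forall>x\<in>V. c' x < r) \<and> (\<forall>i<r. card {x\<in>V. c' x = i} = t i) \<and>
    card {x\<in>V. c' x \<noteq> c x} \<le> (\<Sum>i<r. card {x\<in>V. c x = i} - t i)"
    using c'(1,2) by (intro exI[of _ c']) (rule conjI[OF _ conjI])
qed

lemma turan_class_floor:
  assumes "i < r"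
  shows "n div r \<le> card {x. x < n \<and> x mod r = i}" "card {x. x < n \<and> x mod r = i} \<le> n div r + 1"
proof -
  have f: "\<lfloor>real n / real r\<rfloor> = int (n div r)" by (simp add: floor_divide_of_nat_eq)
  have c: "int (n div r) \<le> \<lceil>real n / real r\<rceil>" "\<lceil>real n / real r\<rceil> \<le> int (n div r) + 1"
    using f by linarith+
  have t: "int (card {x. x < n \<and> x mod r = i}) = int (n div r) \<or>
      int (card {x. x < n \<and> x mod r = i}) = \<lceil>real n / real r\<rceil>"
    using turan_part_size[OF assms, of n] f by simp
  show "n div r \<le> card {x. x < n \<and> x mod r = i}" "card {x. x < n \<and> x mod r = i} \<le> n div r + 1"
    using t c by linarith+
qed

text \<open>The arc deficit is the difference of the sums of squared class sizes, so it controls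
  squared deviations from the target sizes. The free parameter \<open>L\<close> replaces
  Cauchy-Schwarz by \<open>2 * L * \<bar>x\<bar> - L ^ 2 \<le> x ^ 2\<close>. Writing the targets as
  \<open>q + e\<close> with \<open>0 \<le> e \<le> 1\<close> makes the large linear term
  \<open>2 * q * x\<close> vanish in the sum.\<close>

lemma class_excess_le:
  fixes c :: "'b \<Rightarrow> nat" and L :: real
  assumes V: "finite V" "card V = n" and r: "r > 0" and c: "\<And>x. x \<in> V \<Longrightarrow> c x < r"
    and g: "real (turan_arcs r n) - real (card (arcs V (\<lambda>x y. c x \<noteq> c y))) \<le> \<gamma>" and L: "L \<ge> 2"
  shows "2 * L * real (\<Sum>i<r. card {x\<in>V. c x = i} - card {x. x < n \<and> x mod r = i}) \<le> \<gamma> + real r * L ^ 2"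
proof -
  define b where "b i = real (card {x\<in>V. c x = i})" for i
  define t where "t i = real (card {x. x < n \<and> x mod r = i})" for i
  define q where "q = real (n div r)"
  define X where "X = (\<Sum>i<r. card {x\<in>V. c x = i} - card {x. x < n \<and> x mod r = i})"
  have sb: "(\<Sum>i<r. b i) = real n"
    using sum_class_sizes[of V c r] c V unfolding b_def by (metis of_nat_sum)
  have st: "(\<Sum>i<r. t i) = real n"
    using turan_classes_sum[OF r, of n] unfolding t_def by (metis of_nat_sum)
  \<comment> \<open>Both size sequences sum to \<open>n\<close>, so the surplus is half of the total
    deviation.\<close>
  have "real X = (\<Sum>i<r. real (card {x\<in>V. c x = i} - card {x. x < n \<and> x mod r = i}))"
    by (simp add: X_def)
  also have "\<dots> = (\<Sum>i<r. (\<bar>b i - t i\<bar> + (b i - t i)) / 2)"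
    by (intro sum.cong) (auto simp: b_def t_def of_nat_diff abs_if)
  also have "\<dots> = (\<Sum>i<r. \<bar>b i - t i\<bar>) / 2"
    using sb st by (simp add: sum_divide_distrib[symmetric] sum.distrib sum_subtractf)
  finally have X: "(\<Sum>i<r. \<bar>b i - t i\<bar>) = 2 * real X" by simp
  have "card (arcs V (\<lambda>x y. c x \<noteq> c y)) + (\<Sum>i<r. card {x\<in>V. c x = i} ^ 2) = n ^ 2"
    using card_arcs_multipartite[of V c r] c V by auto
  then have "real (card (arcs V (\<lambda>x y. c x \<noteq> c y))) + (\<Sum>i<r. b i ^ 2) = real n ^ 2"
    unfolding b_def by (simp flip: of_nat_power of_nat_add of_nat_sum)
  moreover have "turan_arcs r n + (\<Sum>i<r. card {x. x < n \<and> x mod r = i} ^ 2) = n ^ 2"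
    using card_arcs_multipartite[of "{..<n}" "\<lambda>x. x mod r" r] r by (simp add: turan_arcs_def)
  then have "real (turan_arcs r n) + (\<Sum>i<r. t i ^ 2) = real n ^ 2"
    unfolding t_def by (simp flip: of_nat_power of_nat_add of_nat_sum)
  ultimately have sq: "(\<Sum>i<r. b i ^ 2 - t i ^ 2) \<le> \<gamma>"
    using g by (simp add: sum_subtractf)
  have "(2 * L - 2) * \<bar>b i - t i\<bar> + 2 * q * (b i - t i) - L ^ 2 \<le> b i ^ 2 - t i ^ 2" if "i < r" for i
  proof -
    define x where "x = b i - t i"
    define e where "e = t i - q"
    have e: "0 \<le> e" "e \<le> 1"
      using turan_class_floor[OF that, of n] unfolding e_def t_def q_def by linarith+
    have "0 \<le> (\<bar>x\<bar> - L) ^ 2" by simp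
    then have 1: "2 * L * \<bar>x\<bar> - L ^ 2 \<le> x ^ 2" by (simp add: power2_diff algebra_simps)
    have "\<bar>e * x\<bar> \<le> 1 * \<bar>x\<bar>" unfolding abs_mult using e by (intro mult_right_mono) auto
    then have 2: "- \<bar>x\<bar> \<le> e * x" by linarith
    have "b i ^ 2 - t i ^ 2 = x ^ 2 + 2 * q * x + 2 * (e * x)"
      by (simp add: x_def e_def power2_eq_square algebra_simps)
    then show ?thesis using 1 2 by (simp add: x_def[symmetric] algebra_simps)
  qed
  then have "(\<Sum>i<r. (2 * L - 2) * \<bar>b i - t i\<bar> + 2 * q * (b i - t i) - L ^ 2) \<le> (\<Sum>i<r. b i ^ 2 - t i ^ 2)"
    by (intro sum_mono) auto
  also have "(\<Sum>i<r. (2 * L - 2) * \<bar>b i - t i\<bar> + 2 * q * (b i - t i) - L ^ 2)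
      = (2 * L - 2) * (\<Sum>i<r. \<bar>b i - t i\<bar>) + 2 * q * ((\<Sum>i<r. b i) - (\<Sum>i<r. t i)) - real r * L ^ 2"
    by (simp only: sum_subtractf sum.distrib sum_distrib_left[symmetric] sum_constant card_lessThan)
  also have "\<dots> = (2 * L - 2) * (2 * real X) - real r * L ^ 2" using sb st X by simp
  finally have "(4 * L - 4) * real X \<le> \<gamma> + real r * L ^ 2" using sq by (simp add: algebra_simps)
  \<comment> \<open>Here \<open>L \<ge> 2\<close> enters, through
    \<open>2 * L \<le> 4 * L - 4\<close>.\<close>
  moreover have "2 * L * real X \<le> (4 * L - 4) * real X" using L by (intro mult_right_mono) auto
  ultimately show ?thesis unfolding X_def by linarith
qed

text \<open>Ordered pairs are counted, so an edge present in only one of two graphs contributes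
  2.\<close>

definition mismatch :: "'b set \<Rightarrow> ('b \<Rightarrow> 'b \<Rightarrow> bool) \<Rightarrow> ('b \<Rightarrow> 'b \<Rightarrow> bool) \<Rightarrow> nat" where
  "mismatch V A B = card (arcs V (\<lambda>x y. A x y \<noteq> B x y))"

lemma mismatch_triangle: "finite V \<Longrightarrow> mismatch V A C \<le> mismatch V A B + mismatch V B C"
proof -
  assume V: "finite V"
  have "card (arcs V (\<lambda>x y. A x y \<noteq> C x y)) \<le>
      card (arcs V (\<lambda>x y. A x y \<noteq> B x y) \<union> arcs V (\<lambda>x y. B x y \<noteq> C x y))"
    by (rule card_mono) (use V in simp, auto simp: arcs_def)
  then show ?thesis
    unfolding mismatch_def using card_Un_le order_trans by blast
qed

lemma mismatch_recolour_le:
  assumes V: "finite V"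
  shows "mismatch V (\<lambda>x y. c x \<noteq> c y) (\<lambda>x y. c' x \<noteq> c' y) \<le> 2 * (card V * card {x\<in>V. c' x \<noteq> c x})"
proof -
  let ?W = "{x\<in>V. c' x \<noteq> c x}"
  have "mismatch V (\<lambda>x y. c x \<noteq> c y) (\<lambda>x y. c' x \<noteq> c' y) \<le> card (V \<times> ?W \<union> ?W \<times> V)"
    unfolding mismatch_def using V by (intro card_mono) (auto simp: arcs_def)
  also have "\<dots> \<le> card (V \<times> ?W) + card (?W \<times> V)" by (rule card_Un_le)
  finally show ?thesis by (simp add: card_cartesian_product mult.commute)
qed

lemma mismatch_eq_card_arcs:
  assumes "finite V"
  shows "mismatch V A B = card (arcs V (\<lambda>x y. A x y \<and> \<not> B x y)) + card (arcs V (\<lambda>x y. \<not> A x y \<and> B x y))"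
proof -
  have "arcs V (\<lambda>x y. A x y \<noteq> B x y) = arcs V (\<lambda>x y. A x y \<and> \<not> B x y) \<union> arcs V (\<lambda>x y. \<not> A x y \<and> B x y)"
    by (auto simp: arcs_def)
  moreover have "arcs V (\<lambda>x y. A x y \<and> \<not> B x y) \<inter> arcs V (\<lambda>x y. \<not> A x y \<and> B x y) = {}"
    by (auto simp: arcs_def)
  ultimately show ?thesis using assms by (simp add: mismatch_def card_Un_disjoint)
qed

lemma card_arcs_add:
  fixes V :: "'b set"
  assumes "finite V"
  shows "card (arcs V A) + card (arcs V (\<lambda>x y. \<not> A x y \<and> B x y)) =
    card (arcs V B) + card (arcs V (\<lambda>x y. A x y \<and> \<not> B x y))"
proof -
  have *: "card (arcs V A) = card (arcs V (\<lambda>x y. A x y \<and> B x y)) + card (arcs V (\<lambda>x y. A x y \<and> \<not> B x y))"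
    for A B :: "'b \<Rightarrow> 'b \<Rightarrow> bool"
  proof -
    have "arcs V A = arcs V (\<lambda>x y. A x y \<and> B x y) \<union> arcs V (\<lambda>x y. A x y \<and> \<not> B x y)"
      by (auto simp: arcs_def)
    moreover have "arcs V (\<lambda>x y. A x y \<and> B x y) \<inter> arcs V (\<lambda>x y. A x y \<and> \<not> B x y) = {}"
      by (auto simp: arcs_def)
    ultimately show ?thesis using assms by (simp add: card_Un_disjoint)
  qed
  show ?thesis using *[of A B] *[of B A] by (simp add: conj_commute)
qed

text \<open>The colouring is used with the trivial degree bound \<open>n\<close>. Its graph lies
  between host and Turan graph in the number of arcs, which bounds the arcs inside classes by
  \<open>\<gamma>\<close> and the missing ones by \<open>2 * \<gamma>\<close>. By
  \<open>class_excess_le\<close> few vertices have to be recoloured to balance the classes, each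
  affecting at most \<open>2 * n\<close> arcs. The parameter \<open>L\<close> stays free, to be
  chosen proportional to \<open>n\<close>.\<close>

lemma turan_theorem_stability:
  fixes A :: "'b \<Rightarrow> 'b \<Rightarrow> bool" and L \<gamma> :: real
  assumes V: "finite V" "card V = n" and r: "r > 0"
    and sym: "\<And>x y. A x y \<longleftrightarrow> A y x" and irrA: "\<And>x. \<not> A x x"
    and free: "\<And>K. K \<subseteq> V \<Longrightarrow> card K = r + 1 \<Longrightarrow> \<exists>x\<in>K. \<exists>y\<in>K. x \<noteq> y \<and> \<not> A x y"
  shows "card (arcs V A) \<le> turan_arcs r n"
    and "real (turan_arcs r n) - real (card (arcs V A)) \<le> \<gamma> \<Longrightarrow> 2 \<le> L \<Longrightarrow>
      \<exists>c. (\<forall>x\<in>V. c x < r) \<and> (\<forall>i<r. card {x\<in>V. c x = i} = card {x. x < n \<and> x mod r = i}) \<and>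
        real (mismatch V A (\<lambda>x y. c x \<noteq> c y)) \<le> 3 * \<gamma> + real n * (\<gamma> / L + real r * L)"
proof -
  have "\<exists>c :: 'b \<Rightarrow> nat. (\<forall>x\<in>V. c x < r) \<and> (\<forall>i. real (card {x\<in>V. c x = i}) \<le> real n) \<and>
    card (arcs V A) + card (arcs V (\<lambda>x y. A x y \<and> c x = c y)) \<le> card (arcs V (\<lambda>x y. c x \<noteq> c y))"
  proof (intro fueredi_colouring V sym irrA free)
    show "real (card {y\<in>V. \<not> A x y}) \<le> real n" for x
      using card_mono[of V "{y\<in>V. \<not> A x y}"] V by auto
  qed auto
  then obtain c :: "'b \<Rightarrow> nat" where c0: "\<forall>x\<in>V. c x < r"
    and arcs: "card (arcs V A) + card (arcs V (\<lambda>x y. A x y \<and> c x = c y)) \<le> card (arcs V (\<lambda>x y. c x \<noteq> c y))"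
    by (elim exE conjE)
  note c = c0[rule_format]
  have BT: "card (arcs V (\<lambda>x y. c x \<noteq> c y)) \<le> turan_arcs r n"
    using V r c by (rule card_arcs_multipartite_le)
  then show "card (arcs V A) \<le> turan_arcs r n" using arcs by linarith
  assume g: "real (turan_arcs r n) - real (card (arcs V A)) \<le> \<gamma>" and L: "2 \<le> L"
  let ?B = "\<lambda>x y. c x \<noteq> c y"
  define X where "X = (\<Sum>i<r. card {x\<in>V. c x = i} - card {x. x < n \<and> x mod r = i})"
  have "real (turan_arcs r n) - real (card (arcs V ?B)) \<le> \<gamma>" using g arcs by linarith
  from class_excess_le[OF V r c this L]
  have "2 * L * real X \<le> \<gamma> + real r * L ^ 2" unfolding X_def by blast
  then have X: "2 * real X \<le> \<gamma> / L + real r * L" using L by (simp add: field_simps power2_eq_square)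
  have "\<exists>c'. (\<forall>x\<in>V. c' x < r) \<and> (\<forall>i<r. card {x\<in>V. c' x = i} = card {x. x < n \<and> x mod r = i}) \<and>
    card {x\<in>V. c' x \<noteq> c x} \<le> X"
    unfolding X_def using V turan_classes_sum[OF r] c turan_classes_balanced
    by (intro balanced_recolouring) auto
  then obtain c' where c': "\<forall>x\<in>V. c' x < r" "\<forall>i<r. card {x\<in>V. c' x = i} = card {x. x < n \<and> x mod r = i}"
    "card {x\<in>V. c' x \<noteq> c x} \<le> X" by (elim exE conjE)
  have "real (card (arcs V (\<lambda>x y. A x y \<and> \<not> ?B x y))) \<le> \<gamma>"
    using arcs BT g by simp
  moreover have "real (card (arcs V (\<lambda>x y. \<not> A x y \<and> ?B x y))) \<le> 2 * \<gamma>"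
    using card_arcs_add[OF V(1), of A ?B] arcs BT g by simp
  ultimately have 1: "real (mismatch V A ?B) \<le> 3 * \<gamma>"
    unfolding mismatch_eq_card_arcs[OF V(1)] by simp
  have "mismatch V ?B (\<lambda>x y. c' x \<noteq> c' y) \<le> 2 * (card V * card {x\<in>V. c' x \<noteq> c x})"
    by (rule mismatch_recolour_le[OF V(1)])
  also have "\<dots> \<le> 2 * (card V * X)" using c'(3) by simp
  finally have "real (mismatch V ?B (\<lambda>x y. c' x \<noteq> c' y)) \<le> real n * (2 * real X)"
    using of_nat_mono[where 'a = real] V by fastforce
  also have "\<dots> \<le> real n * (\<gamma> / L + real r * L)" using X by (intro mult_left_mono) auto
  finally have 2: "real (mismatch V ?B (\<lambda>x y. c' x \<noteq> c' y)) \<le> real n * (\<gamma> / L + real r * L)" .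
  have "real (mismatch V A (\<lambda>x y. c' x \<noteq> c' y)) \<le> 3 * \<gamma> + real n * (\<gamma> / L + real r * L)"
    using mismatch_triangle[OF V(1), of A "\<lambda>x y. c' x \<noteq> c' y" ?B] 1 2 by linarith
  then show "\<exists>c. (\<forall>x\<in>V. c x < r) \<and> (\<forall>i<r. card {x\<in>V. c x = i} = card {x. x < n \<and> x mod r = i}) \<and>
        real (mismatch V A (\<lambda>x y. c x \<noteq> c y)) \<le> 3 * \<gamma> + real n * (\<gamma> / L + real r * L)"
    using c'(1,2) by blast
qed

text \<open>The complete multipartite graph \<open>F\<close> with colouring \<open>c\<close> is a
  candidate in the minimum, since equal class sizes make it isomorphic to the Turan graph.\<close>

lemma edit_dist_turan_le:
  fixes G :: "'b ugraph" and c :: "'b \<Rightarrow> nat"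
  assumes G: "sgraph G" "card (verts G) = n" and r: "r > 0" and c: "\<forall>x\<in>verts G. c x < r"
    and sizes: "\<forall>i<r. card {x\<in>verts G. c x = i} = card {x. x < n \<and> x mod r = i}"
  shows "edit_dist G (turan_graph r n) \<le> mismatch (verts G) (adj G) (\<lambda>x y. c x \<noteq> c y)"
proof -
  let ?V = "verts G"
  have V: "finite ?V" using G by (simp add: sgraph_def)
  define F where "F = \<lparr>verts = ?V, edges = {{x, y} |x y. x \<in> ?V \<and> y \<in> ?V \<and> c x \<noteq> c y}\<rparr>"
  have adjF: "adj F x y \<longleftrightarrow> x \<in> ?V \<and> y \<in> ?V \<and> c x \<noteq> c y" for x y
    by (auto simp: F_def doubleton_eq_iff)
  have sF: "sgraph F" using V by (auto simp: sgraph_def F_def card_2_iff)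
  have "card {x\<in>?V. c x = i} = card {x \<in> {..<n}. x mod r = i}" for i
  proof (cases "i < r")
    case False
    then have "{x\<in>?V. c x = i} = {}" "{x \<in> {..<n}. x mod r = i} = {}" using c r by auto
    then show ?thesis by (simp only: card.empty)
  qed (use sizes in simp)
  then obtain \<beta> where \<beta>: "bij_betw \<beta> ?V {..<n}" "\<forall>x\<in>?V. \<beta> x mod r = c x"
    using same_class_sizes_bij[OF V finite_lessThan, of c n "\<lambda>x. x mod r"] by blast
  have \<beta>V: "\<beta> x < n" if "x \<in> ?V" for x using bij_betwE[OF \<beta>(1)] that by auto
  have "edges (turan_graph r n) = (\<lambda>e. \<beta> ` e) ` edges F"
  proof (intro set_eqI iffI)
    fix e assume "e \<in> edges (turan_graph r n)"
    then obtain u v where e: "e = {u, v}" "u < n" "v < n" "u mod r \<noteq> v mod r"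
      by (auto simp: turan_graph_def)
    then have "u \<in> \<beta> ` ?V" "v \<in> \<beta> ` ?V" using \<beta>(1) by (auto simp: bij_betw_def)
    then obtain x y where xy: "x \<in> ?V" "u = \<beta> x" "y \<in> ?V" "v = \<beta> y" by blast
    then have "adj F x y" using e(4) \<beta>(2) by (auto simp: adjF)
    moreover have "e = \<beta> ` {x, y}" using e xy by simp
    ultimately show "e \<in> (\<lambda>e. \<beta> ` e) ` edges F" by (rule rev_image_eqI)
  next
    fix e assume "e \<in> (\<lambda>e. \<beta> ` e) ` edges F"
    then obtain x y where xy: "x \<in> ?V" "y \<in> ?V" "c x \<noteq> c y" "e = \<beta> ` {x, y}" by (auto simp: F_def)
    then have "adj (turan_graph r n) (\<beta> x) (\<beta> y)" using \<beta>(2) \<beta>V by (auto simp: adj_turan)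
    then show "e \<in> edges (turan_graph r n)" using xy by simp
  qed
  then have iso: "isomorphic F (turan_graph r n)"
    unfolding isomorphic_def using \<beta>(1) by (intro exI[of _ \<beta>]) (simp add: F_def turan_graph_def)
  let ?M = "arcs ?V (\<lambda>x y. adj G x y \<noteq> (c x \<noteq> c y))"
  have "edit_dist G (turan_graph r n) \<le> card ((edges G - edges F) \<union> (edges F - edges G))"
    unfolding edit_dist_def by (rule Least_le) (use sF iso in \<open>auto simp: F_def\<close>)
  also have "\<dots> \<le> card ((\<lambda>(x, y). {x, y}) ` ?M)"
  proof (rule card_mono)
    show "edges G - edges F \<union> (edges F - edges G) \<subseteq> (\<lambda>(x, y). {x, y}) ` ?M"
    proof
      fix e assume e: "e \<in> edges G - edges F \<union> (edges F - edges G)"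
      then have "e \<subseteq> ?V" "card e = 2" using G(1) sF by (auto simp: sgraph_def F_def)
      then obtain x y where xy: "e = {x, y}" "x \<in> ?V" "y \<in> ?V" by (auto simp: card_2_iff)
      then have "adj G x y \<noteq> (c x \<noteq> c y)" using e adjF[of x y] by auto
      then have "(x, y) \<in> ?M" using xy by (simp add: arcs_def)
      then show "e \<in> (\<lambda>(x, y). {x, y}) ` ?M" using xy(1) by (auto intro: rev_image_eqI)
    qed
  qed (use V in simp)
  also have "\<dots> \<le> card ?M" using V by (intro card_image_le) simp
  finally show ?thesis by (simp add: mismatch_def)
qed

section \<open>Goodness and stability from the inequality\<close>

text \<open>The upper bound does double duty: it also makes the set of values finite, as
  \<open>Max\<close> requires.\<close>

lemma ex_eqI:
  assumes "r > 0" and "\<And>G. G \<in> host_graphs n (complete_graph (r + 1)) \<Longrightarrow> copies H G \<le> copies H (turan_graph r n)"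
  shows "ex n H (complete_graph (r + 1)) = copies H (turan_graph r n)"
  unfolding ex_def
proof (rule Max_eqI)
  show "finite (copies H ` host_graphs n (complete_graph (r + 1)))"
    by (rule finite_subset[of _ "{..copies H (turan_graph r n)}"]) (use assms(2) in auto)
qed (use assms(2) turan_host[OF assms(1)] in auto)

lemma host_copies:
  assumes H: "sgraph H" and P: "edges H = (\<lambda>(k, l). {k, l}) ` P" "P \<subseteq> verts H \<times> verts H"
  shows "G \<in> host_graphs n F \<Longrightarrow> card (embs (verts H) P (verts G) (adj G)) = copies H G * card (isos H H)"
    and "turan_embs (verts H) P r n = copies H (turan_graph r n) * card (isos H H)"
proof -
  show "card (embs (verts H) P (verts G) (adj G)) = copies H G * card (isos H H)" if "G \<in> host_graphs n F"
    using that H P by (intro card_embs_eq_copies) (auto simp: host_graphs_def)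
  have "card (embs (verts H) P {..<n} (adj (turan_graph r n))) = copies H (turan_graph r n) * card (isos H H)"
    using card_embs_eq_copies[OF H sgraph_turan P, of r n] by (simp add: turan_graph_def)
  then show "turan_embs (verts H) P r n = copies H (turan_graph r n) * card (isos H H)"
    using card_embs_turan[OF P(2)] by simp
qed

text \<open>Without edges an embedding is just an injective map, and any bijection of the vertex
  sets transports it.\<close>

lemma turan_good_edgeless:
  assumes H: "sgraph H" "edges H = {}" and r: "r > 0"
  shows "turan_good r H"
  unfolding turan_good_def
proof (intro exI[of _ 0] allI impI ex_eqI r)
  fix n G assume G: "G \<in> host_graphs n (complete_graph (r + 1))"
  have finH: "finite (verts H)" using H by (simp add: sgraph_def)
  have V: "finite (verts G)" "card (verts G) = n" using G by (auto simp: host_graphs_def sgraph_def)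
  obtain \<beta> where \<beta>: "bij_betw \<beta> (verts G) {..<n}"
    using finite_same_card_bij[of "verts G" "{..<n}"] V by auto
  have "card (embs (verts H) {} (verts G) (adj G)) = card (embs (verts H) {} (verts G) (\<lambda>_ _. False))"
    by (simp add: embs_def)
  also have "\<dots> \<le> card (embs (verts H) {} {..<n} (\<lambda>x y. x mod r \<noteq> y mod r))"
    using finH \<beta> by (intro card_embs_le[where \<beta> = \<beta>]) (auto simp: bij_betw_def)
  also have "\<dots> = turan_embs (verts H) {} r n" by (simp add: turan_embs_def)
  finally have "copies H G * card (isos H H) \<le> copies H (turan_graph r n) * card (isos H H)"
    using host_copies(1)[OF H(1) _ _ G, of "{}"] host_copies(2)[OF H(1), of "{}" r n] H(2) by simp
  then show "copies H G \<le> copies H (turan_graph r n)" using card_isos_pos[OF H(1)] by simp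
qed

lemma turan_good_stable:
  assumes H: "sgraph H" "edges H \<noteq> {}" and r: "r \<ge> 4 * card (verts H) ^ 3 + 11 * card (verts H) ^ 2"
  shows "turan_good r H" "turan_stable r H"
proof -
  obtain P where P: "pattern (verts H) P" "edges H = (\<lambda>(k, l). {k, l}) ` P"
    using sgraph_orientation[OF H(1)] by blast
  interpret large_turan_pattern "verts H" P r
    using P H(2) r by (intro large_turan_pattern.intro) (auto simp: large_turan_pattern_axioms_def)
  let ?K = "complete_graph (r + 1)" and ?h = "card (verts H)" and ?a = "real (card (isos H H))"
  note emb = host_copies[OF H(1) P(2) PS]
  have a: "?a > 0" using card_isos_pos[OF H(1)] by simp
  have host: "finite (verts G)" "card (verts G) = n" "adj G x y \<longleftrightarrow> adj G y x" "\<not> adj G x x"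
    "K \<subseteq> verts G \<Longrightarrow> card K = r + 1 \<Longrightarrow> \<exists>x\<in>K. \<exists>y\<in>K. x \<noteq> y \<and> \<not> adj G x y"
    if "G \<in> host_graphs n ?K" for G n x y K
    using that adj_irrefl free_of_complete_nonadjacent[of "r + 1" G K]
    by (auto simp: host_graphs_def sgraph_def insert_commute)
  obtain n0 where n0: "\<forall>(V :: nat set) A. finite V \<longrightarrow> card V \<ge> n0 \<longrightarrow> (\<forall>x y. A x y \<longleftrightarrow> A y x) \<longrightarrow>
    (\<forall>x. \<not> A x x) \<longrightarrow> (\<forall>K. K \<subseteq> V \<longrightarrow> card K = r + 1 \<longrightarrow> (\<exists>x\<in>K. \<exists>y\<in>K. x \<noteq> y \<and> \<not> A x y)) \<longrightarrow> excess V A \<le> 0"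
    using eventually_excess_nonpos by blast
  have arcs_le: "card (arcs (verts G) (adj G)) \<le> turan_arcs r n" if "G \<in> host_graphs n ?K" for G n
    using host[OF that] r_pos by (intro turan_theorem_stability(1)) auto
  have main: "?a * real (copies H G) + \<kappa> * real n ^ (?h - 2) *
      (real (turan_arcs r n) - real (card (arcs (verts G) (adj G)))) \<le> ?a * real (copies H (turan_graph r n))"
    if G: "G \<in> host_graphs n ?K" and n: "n \<ge> n0" for G n
  proof -
    have "excess (verts G) (adj G) \<le> 0"
      using n0[rule_format, of "verts G" "adj G"] host[OF G] n by blast
    then show ?thesis
      using host(2)[OF G] emb(1)[OF G] emb(2)[of r n] by (simp add: excess_def mult.commute)
  qed
  have le: "copies H G \<le> copies H (turan_graph r n)" if G: "G \<in> host_graphs n ?K" and n: "n \<ge> n0" for G n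
  proof -
    have "0 \<le> \<kappa> * real n ^ (?h - 2) * (real (turan_arcs r n) - real (card (arcs (verts G) (adj G))))"
      using \<kappa>(1) arcs_le[OF G] by (intro mult_nonneg_nonneg) auto
    then have "?a * real (copies H G) \<le> ?a * real (copies H (turan_graph r n))"
      using main[OF G n] by linarith
    then show ?thesis using a by simp
  qed
  have ex: "ex n H ?K = copies H (turan_graph r n)" if "n \<ge> n0" for n
    using le that by (intro ex_eqI r_pos)
  then show "turan_good r H" unfolding turan_good_def by blast
  show "turan_stable r H"
    unfolding turan_stable_def
  proof (intro allI impI)
    fix \<epsilon> :: real assume \<epsilon>: "\<epsilon> > 0"
    have rp: "real r > 0" using r_pos by simp
    \<comment> \<open>With \<open>\<gamma> = \<zeta> * n ^ 2\<close> and
      \<open>L = \<eta> * n\<close> the bound of \<open>turan_theorem_stability\<close> becomes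
      \<open>3 * \<zeta> + \<zeta> / \<eta> + r * \<eta>\<close> times \<open>n ^ 2\<close>, and
      each summand is made at most \<open>\<epsilon> / 3\<close>. The factor
      \<open>\<kappa> / ?a\<close> in \<open>\<delta>\<close> translates copies into embeddings and
      these into arcs.\<close>
    define \<eta> where "\<eta> = \<epsilon> / (3 * real r)"
    define \<zeta> where "\<zeta> = min (\<epsilon> / 9) (\<epsilon> * \<eta> / 3)"
    define \<delta> where "\<delta> = \<zeta> * \<kappa> / ?a"
    have \<eta>: "\<eta> > 0" using \<epsilon> rp by (simp add: \<eta>_def)
    have \<zeta>: "\<zeta> > 0" using \<epsilon> \<eta> by (simp add: \<zeta>_def)
    have \<delta>: "\<delta> > 0" using \<zeta> \<kappa>(1) a by (simp add: \<delta>_def)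
    \<comment> \<open>Ensures \<open>\<eta> * n \<ge> 2\<close>, as required of \<open>L\<close>;
      the \<open>+ 1\<close> gives \<open>n > 0\<close>.\<close>
    define n1 where "n1 = max n0 (nat \<lceil>2 / \<eta>\<rceil> + 1)"
    show "\<exists>\<delta>>0. \<exists>n0. \<forall>n\<ge>n0. \<forall>G\<in>host_graphs n ?K.
        real (copies H G) \<ge> real (ex n H ?K) - \<delta> * real n ^ ?h \<longrightarrow>
        real (edit_dist G (turan_graph r n)) \<le> \<epsilon> * real n ^ 2"
    proof (intro exI[of _ \<delta>] conjI \<delta> exI[of _ n1] allI impI ballI)
      fix n G assume n: "n \<ge> n1" and G: "G \<in> host_graphs n ?K"
        and near: "real (copies H G) \<ge> real (ex n H ?K) - \<delta> * real n ^ ?h"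
      have n0: "n \<ge> n0" and np: "real n > 0" and n\<eta>: "2 / \<eta> \<le> real n"
        using n by (auto simp: n1_def) linarith+
      define D where "D = real (turan_arcs r n) - real (card (arcs (verts G) (adj G)))"
      have "?a * (real (copies H (turan_graph r n)) - \<delta> * real n ^ ?h) \<le> ?a * real (copies H G)"
        using near a ex[OF n0] by (intro mult_left_mono) auto
      \<comment> \<open>Being nearly extremal leaves a slack of only \<open>\<delta> * n ^ h\<close>
        copies in \<open>main\<close>, which limits the arc deficit \<open>D\<close>.\<close>
      then have "\<kappa> * real n ^ (?h - 2) * D \<le> ?a * \<delta> * real n ^ ?h"
        using main[OF G n0] by (simp add: D_def algebra_simps)
      also have "?a * \<delta> = \<kappa> * \<zeta>" using a by (simp add: \<delta>_def)
      also have "real n ^ ?h = real n ^ (?h - 2) * real n ^ 2"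
        using S2 by (simp only: power_add[symmetric] le_add_diff_inverse2)
      finally have "(\<kappa> * real n ^ (?h - 2)) * D \<le> (\<kappa> * real n ^ (?h - 2)) * (\<zeta> * real n ^ 2)"
        by (simp add: algebra_simps)
      then have D: "D \<le> \<zeta> * real n ^ 2"
        using \<kappa>(1) np by (simp add: mult_le_cancel_left_pos)
      have L: "2 \<le> \<eta> * real n" using n\<eta> \<eta> by (simp add: field_simps)
      obtain c where c: "\<forall>x\<in>verts G. c x < r"
        "\<forall>i<r. card {x\<in>verts G. c x = i} = card {x. x < n \<and> x mod r = i}"
        and mis: "real (mismatch (verts G) (adj G) (\<lambda>x y. c x \<noteq> c y)) \<le>
          3 * (\<zeta> * real n ^ 2) + real n * (\<zeta> * real n ^ 2 / (\<eta> * real n) + real r * (\<eta> * real n))"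
        using turan_theorem_stability(2)[OF host(1,2)[OF G] r_pos host(3,4)[OF G] host(5)[OF G]
            D[unfolded D_def] L] by blast
      have "3 * (\<zeta> * real n ^ 2) \<le> 3 * (\<epsilon> / 9 * real n ^ 2)"
        by (intro mult_left_mono mult_right_mono) (auto simp: \<zeta>_def)
      moreover have "real n * (\<zeta> * real n ^ 2 / (\<eta> * real n)) = \<zeta> / \<eta> * real n ^ 2"
        using np \<eta> by (simp add: field_simps power2_eq_square)
      moreover have "\<zeta> / \<eta> * real n ^ 2 \<le> \<epsilon> / 3 * real n ^ 2"
      proof (rule mult_right_mono)
        have "\<zeta> \<le> \<epsilon> * \<eta> / 3" by (simp add: \<zeta>_def)
        then show "\<zeta> / \<eta> \<le> \<epsilon> / 3" using \<eta> by (simp add: field_simps)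
      qed simp
      moreover have "real n * (real r * (\<eta> * real n)) = \<epsilon> / 3 * real n ^ 2"
        using rp by (simp add: \<eta>_def power2_eq_square)
      ultimately have "real (mismatch (verts G) (adj G) (\<lambda>x y. c x \<noteq> c y)) \<le> \<epsilon> * real n ^ 2"
        using mis unfolding distrib_left by linarith
      moreover have "edit_dist G (turan_graph r n) \<le> mismatch (verts G) (adj G) (\<lambda>x y. c x \<noteq> c y)"
        using G r_pos c by (intro edit_dist_turan_le) (auto simp: host_graphs_def)
      ultimately show "real (edit_dist G (turan_graph r n)) \<le> \<epsilon> * real n ^ 2" by linarith
    qed
  qed
qed

text \<open>For edgeless \<open>H\<close> all graphs on \<open>n\<close> vertices contain equally
  many copies, so a large count cannot force closeness to the Turan graph; hence the premise on
  stability. A nonempty vertex set makes the lower bound on \<open>r\<close> positive.\<close>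

theorem theorem1p5:
  fixes H :: "'a ugraph" and r :: nat
  assumes "sgraph H" and "verts H \<noteq> {}"
    and "r \<ge> 4 * card (verts H) ^ 3 + 11 * card (verts H) ^ 2"
  shows "turan_good r H \<and> (edges H \<noteq> {} \<longrightarrow> turan_stable r H)"
proof (cases "edges H = {}")
  case True
  have "card (verts H) > 0" using assms by (auto simp: sgraph_def card_gt_0_iff)
  then have "card (verts H) ^ 2 > 0" by simp
  then have "r > 0" using assms(3) by linarith
  then show ?thesis using turan_good_edgeless assms(1) True by blast
next
  case False
  then show ?thesis using turan_good_stable assms by blast
qed

end
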